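(* Let $N\ge2$ be an integer. For any integer $m$, \[ \langle W_m\rangle^{{\rm SU}(N)_{-N-1/2}}(x;q)=\sum_{k=\lceil m/N\rceil}^{\infty}\sum_{i=1}^N Y_{i,m,k}(x,q), \] where the functions $Y_{i,m,k}(x,q)$ ($1\le i\le N$, $m,k\in\mathbb{Z}$) are defined as follows: \[ Y_{i,0,k}(x,q)=\begin{cases}\dfrac{(-x)^{Nk}q^{Nk^2/2}}{(q;q)_k},&k\ge0,\\ 0,&k<0;\end{cases} \] for $1\le m\le N$, \[ Y_{i,m,k}(x,q)=\begin{cases}\dfrac{(-1)^{Nk+1}x^{Nk-m}q^{(Nk^2+m)/2-(N+1-i)k}}{(q;q)_{k-1}},& N-i+1\le m\le N\text{ and }k>0,\\ 0,& 0<m<N-i+1\text{ or }k\le0;\end{cases} \] and for other $m$ recursively \[ Y_{i,m,k}(x,q)=\begin{cases}q^{1/2}x^{-1}\big(Y_{i,m-1,k}(x,q)+(-1)^Nq^{m+i-k-N-1}Y_{i,m-N-1,k-1}(x,q)\big),& m>N,\\ (-1)^{N-1}q^{k-i-m+1}\big(Y_{i,m+N,k+1}(x,q)-xq^{-1/2}Y_{i,m+N+1,k+1}(x,q)\big),& m<0.\end{cases} \]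
   Context: Let $|q|<1$, $x$ a nonzero parameter, $(a;q)_\infty=\prod_{k\ge0}(1-aq^k)$, $(a;q)_n=\prod_{k=0}^{n-1}(1-aq^k)$. Let $s_1,\dots,s_{N-1}$ be variables and $s_N:=(s_1\cdots s_{N-1})^{-1}$. For $m\in\mathbb{Z}$ define \[ \langle W_m\rangle^{{\rm SU}(N)_{-N-1/2}}(x;q):=\frac{(q;q)_\infty^{N-1}}{N!}\oint\prod_{i=1}^{N-1}\frac{ds_i}{2\pi i s_i}\prod_{\substack{i,j=1\\ i\ne j}}^N(s_is_j^{-1};q)_\infty\prod_{i=1}^N(q^{1/2}s_ix;q)_\infty\sum_{i=1}^N s_i^m, \] where the integral denotes the constant term in $s_1,\dots,s_{N-1}$ of the integrand expanded as a formal Laurent series in the $s_i$ (equivalently the contour integral over unit circles). $\lceil\cdot\rceil$ is the ceiling function. *)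

theory Defs
  imports "HOL-Analysis.Analysis"
begin

definition qpoch_inf :: "complex \<Rightarrow> complex \<Rightarrow> complex" where
  "qpoch_inf a q = (\<Prod>k. 1 - a * q ^ k)"

definition qpoch :: "complex \<Rightarrow> complex \<Rightarrow> nat \<Rightarrow> complex" where
  "qpoch a q n = (\<Prod>k<n. 1 - a * q ^ k)"

definition svar :: "nat \<Rightarrow> (nat \<Rightarrow> real) \<Rightarrow> nat \<Rightarrow> complex" where
  "svar N th i = (if i = N then inverse (\<Prod>j\<in>{1..<N}. cis (2 * pi * th j))
                  else cis (2 * pi * th i))"

text \<open>Integrand; r plays the role of q^{1/2} (r^2 = q).\<close>
definition Wintegrand :: "nat \<Rightarrow> int \<Rightarrow> complex \<Rightarrow> complex \<Rightarrow> complex \<Rightarrow> (nat \<Rightarrow> real) \<Rightarrow> complex" where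
  "Wintegrand N m x q r th =
     (let s = svar N th in
       (\<Prod>i\<in>{1..N}. \<Prod>j\<in>{1..N}-{i}. qpoch_inf (s i / s j) q)
       * (\<Prod>i\<in>{1..N}. qpoch_inf (r * s i * x) q)
       * (\<Sum>i\<in>{1..N}. s i powi m))"

text \<open>Wilson line index: the contour integral over the unit torus, written as an
  integral over the angles in [0,1]^{N-1}.\<close>
definition Wline :: "nat \<Rightarrow> int \<Rightarrow> complex \<Rightarrow> complex \<Rightarrow> complex \<Rightarrow> complex" where
  "Wline N m x q r =
     (qpoch_inf q q) ^ (N - 1) / of_nat (fact N)
     * integral\<^sup>L (PiM {1..<N} (\<lambda>_. restrict_space lborel {0..1::real}))
                   (Wintegrand N m x q r)"

function Y :: "nat \<Rightarrow> nat \<Rightarrow> int \<Rightarrow> int \<Rightarrow> complex \<Rightarrow> complex \<Rightarrow> complex \<Rightarrow> complex" where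
  "Y N i m k x q r =
    (if m = 0 then
       (if k \<ge> 0 then (-x) ^ (N * nat k) * r ^ (N * (nat k)\<^sup>2) / qpoch q q (nat k) else 0)
     else if 1 \<le> m \<and> m \<le> int N then
       (if int N - int i + 1 \<le> m \<and> k > 0 then
          (-1) ^ (N * nat k + 1) * x powi (int N * k - m)
            * r powi (int N * k\<^sup>2 + m - 2 * (int N + 1 - int i) * k) / qpoch q q (nat (k - 1))
        else 0)
     else if m > int N then
       r * inverse x * (Y N i (m - 1) k x q r
          + (-1) ^ N * q powi (m + int i - k - int N - 1) * Y N i (m - int N - 1) (k - 1) x q r)
     else if N = 0 then 0 \<comment> \<open>degenerate N = 0, excluded by N \<ge> 2; only ensures termination\<close>
     else
       (-1) ^ (N - 1) * q powi (k - int i - m + 1)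
         * (Y N i (m + int N) (k + 1) x q r - x * inverse r * Y N i (m + int N + 1) (k + 1) x q r))"
  by pat_completeness auto
termination
  by (relation "Wellfounded.measure (\<lambda>(N, i, m, k, x, q, r).
        if m > int N then nat (m - int N) else if m < 0 then nat (- m) else 0)") auto

end

theory Submission
  imports Defs "HOL-Probability.Probability" "HOL-Complex_Analysis.Complex_Analysis"
    "HOL-Library.Real_Mod" "Jordan_Normal_Form.Determinant"
begin

text \<open>
  Write \<open>D\<close> for the product over \<open>i < j\<close> of \<open>(s\<^sub>j - s\<^sub>i) (q s\<^sub>i/s\<^sub>j; q) (q s\<^sub>j/s\<^sub>i; q)\<close>. The measure
  \<open>\<Prod>\<^sub>i\<^sub>\<noteq>\<^sub>j (s\<^sub>i/s\<^sub>j; q)\<close> is \<open>D\<close> times the Vandermonde product in the inverse variables; expanding the latter by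
  Leibniz and using that \<open>D\<close> is alternating, a constant term of the measure times a symmetric function \<open>F\<close>
  becomes \<open>N!\<close> times that of \<open>D F s\<^sup>-\<^sup>\<delta>\<close>. Sorting by degree turns the \<open>SU(N)\<close> integral into the sum over \<open>k\<close> of
  \<open>N\<close>-variable constant terms twisted by the \<open>-k\<close>-th power of \<open>s\<^sub>1 \<dots> s\<^sub>N\<close>, and the power sum \<open>\<Sum>\<^sub>i s\<^sub>i\<^sup>m\<close> splits
  each of them into \<open>N\<close> terms, which are the \<open>Y\<^sub>i\<^sub>,\<^sub>m\<^sub>,\<^sub>k\<close> up to a constant: since \<open>D\<close> is quasi-periodic under
  \<open>s\<^sub>i \<mapsto> q s\<^sub>i\<close>, this substitution gives the recursion in \<open>m\<close>, and for \<open>0 \<le> m \<le> N\<close> the exponents repeat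
  or are permuted into a staircase, where the same substitution gives a recursion in \<open>k\<close>.
  The remaining constant \<open>c\<^sub>N\<close>, the constant term of \<open>D s\<^sup>-\<^sup>\<delta>\<close>, is found by inserting \<open>\<Prod>\<^sub>i (s\<^sub>i; q)\<^sub>a (q/s\<^sub>i; q)\<close>:
  passing from \<open>a\<close> to \<open>a + 1\<close> divides by \<open>1 - q\<^sup>a\<^sup>+\<^sup>1\<close>, the value at \<open>a = 0\<close> is \<open>c\<^sub>N\<close>, and the limit is \<open>c\<^sub>N\<^sub>+\<^sub>1\<close>.
\<close>

section \<open>Infinite q-Pochhammer symbols\<close>

text \<open>It is removed by scaling an SU(N) point with a free variable w. The measure depends only
  on ratios and does not see w, so w records the degree n of the x-dependent factors. Averaging over
  N-th roots of unity leaves only the degrees n = N k - m, and n \<ge> 0 is the origin of the bound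
  k \<ge> m/N in the summation. Constant terms are integrals of actual functions, not coefficients
  of formal series. A substitution is then a change of contour radius, legitimate because every
  integrand is holomorphic in each variable away from 0. Setting a single Vandermonde factor aside
  is what makes this work: it expands into finitely many monomials, while the complementary factor
  remains both alternating and quasi-periodic.\<close>

lemma summable_qpoch:
  fixes q :: complex
  assumes "norm q < 1"
  shows "summable (\<lambda>k. norm (a * q ^ k))"
  using assms by (auto simp: norm_mult norm_power intro!: summable_mult summable_geometric)

lemma qpoch_tendsto:
  assumes "norm q < 1"
  shows "(\<lambda>n. qpoch a q n) \<longlonglongrightarrow> qpoch_inf a q"
proof -
  have "abs_convergent_prod (\<lambda>k. 1 + (- (a * q ^ k)))"
    unfolding abs_convergent_prod_conv_summable using summable_qpoch[OF assms, of a] by simp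
  then have "convergent_prod (\<lambda>k. 1 - a * q ^ k)"
    using abs_convergent_prod_imp_convergent_prod by fastforce
  then have "(\<lambda>k. 1 - a * q ^ k) has_prod qpoch_inf a q"
    unfolding qpoch_inf_def by (rule convergent_prod_has_prod)
  then have "(\<lambda>n. \<Prod>k\<le>n. 1 - a * q ^ k) \<longlonglongrightarrow> qpoch_inf a q"
    by (rule has_prod_imp_tendsto)
  then have "(\<lambda>n. qpoch a q (Suc n)) \<longlonglongrightarrow> qpoch_inf a q"
    unfolding qpoch_def lessThan_Suc_atMost .
  then show ?thesis by (rule LIMSEQ_imp_Suc)
qed

lemma qpoch_Suc: "qpoch a q (Suc n) = qpoch a q n * (1 - a * q ^ n)"
  by (simp add: qpoch_def)

lemma qpoch_Suc_shift: "qpoch a q (Suc n) = (1 - a) * qpoch (a * q) q n"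
  unfolding qpoch_def by (subst prod.lessThan_Suc_shift) (simp add: mult.assoc)

lemma qpoch_0 [simp]: "qpoch a q 0 = 1"
  by (simp add: qpoch_def)

lemma qpoch_inf_0 [simp]: "qpoch_inf 0 q = 1"
  by (simp add: qpoch_inf_def)

lemma qpoch_inf_rec:
  assumes "norm q < 1"
  shows "qpoch_inf a q = (1 - a) * qpoch_inf (a * q) q"
proof -
  have "(\<lambda>n. qpoch a q (Suc n)) \<longlonglongrightarrow> (1 - a) * qpoch_inf (a * q) q"
    unfolding qpoch_Suc_shift by (intro tendsto_intros qpoch_tendsto assms)
  moreover have "(\<lambda>n. qpoch a q (Suc n)) \<longlonglongrightarrow> qpoch_inf a q"
    using qpoch_tendsto[OF assms] by (rule LIMSEQ_Suc)
  ultimately show ?thesis using LIMSEQ_unique by blast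
qed

text \<open>The partial products converge uniformly on closed unit discs by the geometric majorant
  \<open>R * norm q ^ n\<close>. Holomorphy in the argument is what later permits moving contours
  through every q-product.\<close>

lemma holomorphic_qpoch_inf:
  assumes q: "norm q < 1"
  shows "(\<lambda>a. qpoch_inf a q) holomorphic_on A"
proof -
  have "(\<lambda>a. qpoch_inf a q) holomorphic_on UNIV"
  proof (rule holomorphic_uniform_sequence)
    show "(\<lambda>a. qpoch a q n) holomorphic_on UNIV" for n
      unfolding qpoch_def by (intro holomorphic_intros)
    fix x :: complex
    define R where "R = norm x + 1"
    have "uniformly_convergent_on (cball x 1) (\<lambda>N a. \<Sum>n<N. norm (- a * q ^ n))"
    proof (rule Weierstrass_m_test')
      fix n y assume "y \<in> cball x 1"
      then have "norm y \<le> R"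
        using norm_triangle_ineq2[of y x] by (simp add: R_def dist_norm norm_minus_commute)
      then show "norm (norm (- y * q ^ n)) \<le> R * norm q ^ n"
        by (simp add: norm_mult norm_power mult_right_mono)
    next
      show "summable (\<lambda>n. R * norm q ^ n)"
        using q by (intro summable_mult summable_geometric) simp
    qed
    then have "uniformly_convergent_on (cball x 1) (\<lambda>N a. \<Prod>n<N. 1 + - a * q ^ n)"
      by (intro uniformly_convergent_on_prod) (auto intro!: continuous_intros)
    then obtain l where l: "uniform_limit (cball x 1) (\<lambda>n a. qpoch a q n) l sequentially"
      unfolding uniformly_convergent_on_def qpoch_def by auto
    have "l a = qpoch_inf a q" if "a \<in> cball x 1" for a
      using tendsto_uniform_limitI[OF l that] qpoch_tendsto[OF q] LIMSEQ_unique by blast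
    with l have "uniform_limit (cball x 1) (\<lambda>n a. qpoch a q n) (\<lambda>a. qpoch_inf a q) sequentially"
      by (metis (mono_tags, lifting) uniform_limit_cong')
    then show "\<exists>d>0. cball x d \<subseteq> UNIV \<and>
        uniform_limit (cball x d) (\<lambda>n a. qpoch a q n) (\<lambda>a. qpoch_inf a q) sequentially"
      by (intro exI[of _ 1]) auto
  qed simp
  then show ?thesis by (rule holomorphic_on_subset) simp
qed

section \<open>Constant terms in one variable\<close>

abbreviation unit_leb :: "real measure" where
  "unit_leb \<equiv> restrict_space lborel {0..1}"

lemma prob_space_unit_leb: "prob_space unit_leb"
  by (rule prob_space_restrict_space) auto

definition CT :: "(complex \<Rightarrow> complex) \<Rightarrow> complex" where
  "CT g = (\<integral>t. g (cis (2 * pi * t)) \<partial>unit_leb)"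

lemma unit_leb_integral_FTC:
  fixes f F :: "real \<Rightarrow> complex"
  assumes "continuous_on UNIV f" and "\<And>t. (F has_vector_derivative f t) (at t)"
  shows "(\<integral>t. f t \<partial>unit_leb) = F 1 - F 0"
proof -
  have "(f has_integral (F 1 - F 0)) {0..1}"
    by (rule fundamental_theorem_of_calculus)
       (auto intro: assms(2) has_vector_derivative_at_within)
  moreover have "set_integrable lborel {0..1} f"
    by (rule borel_integrable_atLeastAtMost') (use assms(1) continuous_on_subset in blast)
  ultimately show ?thesis
    by (simp add: integral_restrict_space set_borel_integral_eq_integral(2) integral_unique
        flip: set_lebesgue_integral_def)
qed

text \<open>With \<open>G\<close> a primitive of \<open>w \<mapsto> g (exp w)\<close>, the integral over the circle of radius \<open>\<bar>c\<bar>\<close> is an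
  increment of \<open>G\<close> over a multiple of the period, and that increment does not depend on the base point.\<close>
lemma CT_scale_power:
  assumes g: "g holomorphic_on -{0}" and c: "c \<noteq> 0" and n: "n > 0"
  shows "CT (\<lambda>z. g (c * z ^ n)) = CT g"
proof -
  have "(\<lambda>w. g (exp w)) holomorphic_on UNIV"
  proof -
    have "range exp \<subseteq> - {0::complex}" using exp_not_eq_zero by (metis ComplI imageE singletonD subsetI)
    from holomorphic_on_compose[OF holomorphic_on_exp holomorphic_on_subset[OF g this]]
    show ?thesis by (simp add: o_def)
  qed
  then obtain G where G: "\<And>w. (G has_field_derivative g (exp w)) (at w)"
    using holomorphic_convex_primitive'[of UNIV "\<lambda>w. g (exp w)"] by auto
  define p where "p = 2 * of_real pi * \<i>"
  have exp_p: "exp (w + p) = exp w" for w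
    by (simp add: p_def exp_add)
  have "((\<lambda>w. G (w + p) - G w) has_field_derivative 0) (at w)" for w
  proof -
    have "((\<lambda>w. G (w + p)) has_field_derivative g (exp (w + p)) * 1) (at w)"
      by (rule DERIV_chain2[OF G]) (auto intro!: derivative_eq_intros)
    from DERIV_diff[OF this G[of w]] show ?thesis by (simp add: exp_p)
  qed
  then obtain C where C: "\<And>w. G (w + p) - G w = C"
    using has_field_derivative_zero_constant[of UNIV "\<lambda>w. G (w + p) - G w"] by auto
  have CTn: "CT (\<lambda>z. g (exp w0 * z ^ n)) = C / p" if n: "n > 0" for n w0
  proof -
    have cis: "exp w0 * cis (2 * pi * t) ^ n = exp (w0 + of_nat n * p * of_real t)" for t
      by (simp add: exp_add p_def cis_conv_exp exp_of_nat_mult[symmetric] mult_ac)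
    have step: "G (w + of_nat k * p) - G w = of_nat k * C" for k w
    proof (induction k)
      case (Suc k)
      then show ?case using C[of "w + of_nat k * p"] by (simp add: algebra_simps)
    qed simp
    have p0: "p \<noteq> 0" by (simp add: p_def)
    \<comment> \<open>Going round \<open>n\<close> times raises \<open>G\<close> by
      \<open>n * C\<close>, and the chain rule divides by \<open>n * p\<close>: neither
      \<open>n\<close> nor \<open>w0\<close> survives.\<close>
    have "CT (\<lambda>z. g (exp w0 * z ^ n)) = G (w0 + of_nat n * p * of_real 1) / (of_nat n * p)
          - G (w0 + of_nat n * p * of_real 0) / (of_nat n * p)"
      unfolding CT_def cis
    proof (rule unit_leb_integral_FTC)
      have "continuous_on UNIV (\<lambda>w. g (exp w))"
        using \<open>(\<lambda>w. g (exp w)) holomorphic_on UNIV\<close> by (rule holomorphic_on_imp_continuous_on)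
      then show "continuous_on UNIV (\<lambda>t. g (exp (w0 + of_nat n * p * complex_of_real t)))"
        by (rule continuous_on_compose2[where g = "\<lambda>w. g (exp w)"]) (auto intro!: continuous_intros)
      show "((\<lambda>t. G (w0 + of_nat n * p * complex_of_real t) / (of_nat n * p)) has_vector_derivative
           g (exp (w0 + of_nat n * p * complex_of_real t))) (at t)" for t
      proof -
        have "((\<lambda>z. G (w0 + of_nat n * p * z) / (of_nat n * p)) has_field_derivative
               g (exp (w0 + of_nat n * p * of_real t)) * (of_nat n * p) / (of_nat n * p)) (at (of_real t))"
          by (intro DERIV_cdivide DERIV_chain2[OF G]) (auto intro!: derivative_eq_intros)
        then show ?thesis
          using n p0 has_vector_derivative_real_field by fastforce
      qed
    qed
    also have "\<dots> = C / p"
      using step[of w0 n] n p0 by (simp add: field_simps)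
    finally show ?thesis .
  qed
  from c obtain w0 where "c = exp w0" by (metis exp_Ln)
  then show ?thesis using CTn[OF n, of w0] CTn[of 1 0] by simp
qed

lemma CT_const [simp]: "CT (\<lambda>z. c) = c"
  using prob_space.prob_space[OF prob_space_unit_leb] by (simp add: CT_def)

lemma CT_cmult: "CT (\<lambda>z. c * g z) = c * CT g"
  by (simp add: CT_def)

text \<open>Scaling the contour by 2 leaves the constant term alone but also multiplies it by
  \<open>2 powi n\<close>, which differs from 1.\<close>

lemma CT_power_int:
  assumes "n \<noteq> 0"
  shows "CT (\<lambda>z. z powi n) = 0"
proof -
  have "CT (\<lambda>z. (2 * z ^ 1) powi n) = CT (\<lambda>z. z powi n)"
    by (rule CT_scale_power) (auto intro!: holomorphic_intros)
  then have "2 powi n * CT (\<lambda>z. z powi n) = CT (\<lambda>z. z powi n)"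
    by (simp add: power_int_mult_distrib CT_cmult)
  moreover have "(2::complex) powi n \<noteq> 1"
  proof
    assume "(2::complex) powi n = 1"
    then have "norm ((2::complex) powi n) = 1" by simp
    then have "(2::real) powi n = 1" by (simp add: norm_power_int)
    moreover have "(2::real) ^ k \<noteq> 1" if "k > 0" for k
    proof -
      have "1 < (2::real) ^ k" by (rule one_less_power) (use that in auto)
      then show ?thesis by (rule less_imp_neq[THEN not_sym])
    qed
    ultimately show False using assms
      by (auto simp: power_int_def power_one_over split: if_splits)
  qed
  ultimately show ?thesis by simp
qed

section \<open>Integration over the infinite torus\<close>

text \<open>Infinitely many coordinates, so that the number of variables can change within one and the same
  functional.\<close>
abbreviation angles :: "(nat \<Rightarrow> real) measure" where
  "angles \<equiv> PiM UNIV (\<lambda>_. unit_leb)"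

lemma prob_space_angles: "prob_space angles"
  by (intro prob_space_PiM prob_space_unit_leb)

definition torus_int :: "((nat \<Rightarrow> complex) \<Rightarrow> complex) \<Rightarrow> complex" where
  "torus_int F = (\<integral>\<theta>. F (\<lambda>i. cis (2 * pi * \<theta> i)) \<partial>angles)"

abbreviation torus :: "(nat \<Rightarrow> complex) set" where
  "torus \<equiv> {s. \<forall>i. norm (s i) = 1}"

abbreviation borel_seq :: "(nat \<Rightarrow> complex) measure" where
  "borel_seq \<equiv> PiM UNIV (\<lambda>_. borel)"

text \<open>Weaker than holomorphy: enough for integrability, and easily kept when one coordinate is
  integrated out or coordinates are multiplied together.\<close>

definition torus_bounded :: "((nat \<Rightarrow> complex) \<Rightarrow> complex) \<Rightarrow> bool" where
  "torus_bounded F \<longleftrightarrow> F \<in> borel_measurable borel_seq \<and> (\<exists>B. \<forall>s\<in>torus. norm (F s) \<le> B)"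

lemma integral_bounded_prob:
  fixes f :: "'a \<Rightarrow> complex"
  assumes "prob_space M" and "f \<in> borel_measurable M" and B: "\<And>x. x \<in> space M \<Longrightarrow> norm (f x) \<le> B"
  shows "integrable M f" and "norm (\<integral>x. f x \<partial>M) \<le> B"
proof -
  interpret prob_space M by fact
  show i: "integrable M f"
    by (rule integrable_const_bound[of _ B]) (use assms in auto)
  have "norm (\<integral>x. f x \<partial>M) \<le> (\<integral>x. norm (f x) \<partial>M)" by simp
  also have "\<dots> \<le> (\<integral>x. B \<partial>M)"
    by (rule integral_mono) (use i B in auto)
  finally show "norm (\<integral>x. f x \<partial>M) \<le> B" by (simp add: prob_space)
qed

lemma measurable_angles_cis [measurable]:
  "(\<lambda>\<theta> i. cis (2 * pi * \<theta> i)) \<in> angles \<rightarrow>\<^sub>M borel_seq"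
proof (rule measurable_PiM_single')
  fix i :: nat
  have "(\<lambda>t. cis (2 * pi * t)) \<in> borel_measurable unit_leb"
    by (intro measurable_restrict_space1) (auto intro!: borel_measurable_continuous_onI continuous_intros)
  then show "(\<lambda>\<theta>. cis (2 * pi * \<theta> i)) \<in> borel_measurable angles"
    by (rule measurable_compose[rotated]) auto
qed auto

lemma measurable_seq_fun:
  assumes "\<And>i. f i \<in> borel_measurable M"
  shows "(\<lambda>x i. f i x) \<in> M \<rightarrow>\<^sub>M borel_seq"
  by (rule measurable_PiM_single') (use assms in auto)

lemma torus_bounded_cis:
  assumes "torus_bounded F"
  shows "(\<lambda>\<theta>. F (\<lambda>i. cis (2 * pi * \<theta> i))) \<in> borel_measurable angles"
    and "\<exists>B. \<forall>\<theta>. norm (F (\<lambda>i. cis (2 * pi * \<theta> i))) \<le> B"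
proof -
  show "(\<lambda>\<theta>. F (\<lambda>i. cis (2 * pi * \<theta> i))) \<in> borel_measurable angles"
    using assms measurable_compose[OF measurable_angles_cis, of F borel]
    unfolding torus_bounded_def by auto
  obtain B where "\<forall>s\<in>torus. norm (F s) \<le> B"
    using assms unfolding torus_bounded_def by blast
  then show "\<exists>B. \<forall>\<theta>. norm (F (\<lambda>i. cis (2 * pi * \<theta> i))) \<le> B"
    by (intro exI[of _ B]) simp
qed

lemma integrable_torus_bounded:
  assumes "torus_bounded F"
  shows "integrable angles (\<lambda>\<theta>. F (\<lambda>i. cis (2 * pi * \<theta> i)))"
  using torus_bounded_cis[OF assms] integral_bounded_prob(1)[OF prob_space_angles] by blast

lemma torus_int_cong:
  assumes "\<And>s. s \<in> torus \<Longrightarrow> F s = G s"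
  shows "torus_int F = torus_int G"
  unfolding torus_int_def using assms by (intro Bochner_Integration.integral_cong) auto

lemma torus_int_add:
  "torus_bounded F \<Longrightarrow> torus_bounded G \<Longrightarrow> torus_int (\<lambda>s. F s + G s) = torus_int F + torus_int G"
  unfolding torus_int_def by (simp add: integrable_torus_bounded)

lemma torus_int_cmult: "torus_int (\<lambda>s. c * F s) = c * torus_int F"
  unfolding torus_int_def by simp

lemma torus_int_sum:
  "(\<And>a. a \<in> A \<Longrightarrow> torus_bounded (F a)) \<Longrightarrow> torus_int (\<lambda>s. \<Sum>a\<in>A. F a s) = (\<Sum>a\<in>A. torus_int (F a))"
  unfolding torus_int_def by (simp add: integrable_torus_bounded)

lemma torus_int_const [simp]: "torus_int (\<lambda>s. c) = c"
  using prob_space.prob_space[OF prob_space_angles] by (simp add: torus_int_def)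

lemma torus_int_tendsto:
  assumes "\<And>n. torus_bounded (F n)" and "\<And>n s. s \<in> torus \<Longrightarrow> norm (F n s) \<le> B"
    and "\<And>s. s \<in> torus \<Longrightarrow> (\<lambda>n. F n s) \<longlonglongrightarrow> G s"
  shows "(\<lambda>n. torus_int (F n)) \<longlonglongrightarrow> torus_int G"
  unfolding torus_int_def
proof (rule integral_dominated_convergence)
  show m: "(\<lambda>\<theta>. F n (\<lambda>i. cis (2 * pi * \<theta> i))) \<in> borel_measurable angles" for n
    by (rule torus_bounded_cis(1)[OF assms(1)])
  show "(\<lambda>\<theta>. G (\<lambda>i. cis (2 * pi * \<theta> i))) \<in> borel_measurable angles"
    by (rule borel_measurable_LIMSEQ_metric[where f = "\<lambda>n \<theta>. F n (\<lambda>i. cis (2 * pi * \<theta> i))", OF m])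
       (use assms(3) in auto)
  show "integrable angles (\<lambda>_. B)"
    using prob_space_angles by (simp add: prob_space.finite_measure finite_measure.integrable_const)
qed (use assms in auto)

section \<open>Splitting one coordinate off the infinite product measure\<close>

lemma angles_eq_distr:
  "distr (unit_leb \<Otimes>\<^sub>M PiM (UNIV - {i}) (\<lambda>_. unit_leb)) angles (\<lambda>p. (snd p)(i := fst p)) = angles"
proof -
  have ins: "insert i (UNIV - {i}) = UNIV" by blast
  show ?thesis
    by (rule distr_pair_PiM_eq_PiM[of "UNIV - {i}" "\<lambda>_. unit_leb" i, unfolded ins split_beta'])
       (rule prob_space_unit_leb)+
qed

lemma measurable_angles_upd:
  "(\<lambda>p. (snd p)(i := fst p)) \<in> unit_leb \<Otimes>\<^sub>M PiM (UNIV - {i}) (\<lambda>_. unit_leb) \<rightarrow>\<^sub>M angles"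
  by (rule measurable_fun_upd[where J = "UNIV - {i}"]) (blast, rule measurable_snd, rule measurable_fst)

lemma angles_integral_split:
  fixes G :: "(nat \<Rightarrow> real) \<Rightarrow> complex"
  assumes G: "G \<in> borel_measurable angles" and B: "\<And>\<theta>. norm (G \<theta>) \<le> B"
  shows "(\<integral>\<theta>. G \<theta> \<partial>angles) =
    (\<integral>X. (\<integral>t. G (X(i := t)) \<partial>unit_leb) \<partial>PiM (UNIV - {i}) (\<lambda>_. unit_leb))"
proof -
  let ?P = "PiM (UNIV - {i}) (\<lambda>_. unit_leb)"
  have P: "prob_space ?P" by (intro prob_space_PiM prob_space_unit_leb)
  have psf: "pair_sigma_finite unit_leb ?P"
    using P prob_space_unit_leb by (simp add: pair_sigma_finite_def prob_space_imp_sigma_finite)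
  have UP: "prob_space (unit_leb \<Otimes>\<^sub>M ?P)"
    by (rule prob_space_pair[OF prob_space_unit_leb P])
  have "(\<integral>\<theta>. G \<theta> \<partial>angles) =
      (\<integral>\<theta>. G \<theta> \<partial>distr (unit_leb \<Otimes>\<^sub>M ?P) angles (\<lambda>p. (snd p)(i := fst p)))"
    unfolding angles_eq_distr ..
  also have "\<dots> = (\<integral>p. G ((snd p)(i := fst p)) \<partial>(unit_leb \<Otimes>\<^sub>M ?P))"
    by (rule integral_distr[OF measurable_angles_upd G])
  also have "\<dots> = (\<integral>p. (\<lambda>(x, X). G (X(i := x))) p \<partial>(unit_leb \<Otimes>\<^sub>M ?P))"
    by (simp only: split_beta)
  also have "\<dots> = (\<integral>X. (\<integral>t. G (X(i := t)) \<partial>unit_leb) \<partial>?P)"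
  proof (rule pair_sigma_finite.integral_snd[OF psf, symmetric])
    have "(\<lambda>(x, X). G (X(i := x))) \<in> borel_measurable (unit_leb \<Otimes>\<^sub>M ?P)"
      using measurable_compose[OF measurable_angles_upd G] unfolding split_beta' .
    then show "integrable (unit_leb \<Otimes>\<^sub>M ?P) (\<lambda>(x, X). G (X(i := x)))"
      by (rule integral_bounded_prob(1)[OF UP, where B = B]) (simp add: B split_beta)
  qed
  finally show ?thesis .
qed

text \<open>The outer integral on the right still runs over coordinate \<open>i\<close>, on which
  its integrand no longer depends. Total mass 1 makes this harmless, and both sides stay within the
  same functional.\<close>

lemma torus_int_CT:
  assumes F: "torus_bounded F"
  shows "torus_int F = torus_int (\<lambda>s. CT (\<lambda>z. F (s(i := z))))"
proof -
  let ?P = "PiM (UNIV - {i}) (\<lambda>_. unit_leb)"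
  let ?c = "\<lambda>\<theta> i. cis (2 * pi * \<theta> (i::nat))"
  interpret U: prob_space unit_leb by (rule prob_space_unit_leb)
  obtain B where B: "\<And>\<theta>. norm (F (?c \<theta>)) \<le> B" using torus_bounded_cis(2)[OF F] by blast
  have meas: "(\<lambda>\<theta>. F (?c \<theta>)) \<in> borel_measurable angles" by (rule torus_bounded_cis(1)[OF F])
  have upd: "(?c \<theta>)(i := cis (2 * pi * t)) = ?c (\<theta>(i := t))" for \<theta> t
    by (auto simp: fun_eq_iff)
  have "(\<lambda>p. (fst p)(i := snd p)) \<in> angles \<Otimes>\<^sub>M unit_leb \<rightarrow>\<^sub>M angles"
    by (rule measurable_fun_upd[where J = UNIV]) (blast, rule measurable_fst, rule measurable_snd)
  from measurable_compose[OF this meas]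
  have *: "(\<lambda>(\<theta>, t). F (?c (\<theta>(i := t)))) \<in> borel_measurable (angles \<Otimes>\<^sub>M unit_leb)"
    unfolding split_beta' .
  have meas': "(\<lambda>\<theta>. \<integral>t. F (?c (\<theta>(i := t))) \<partial>unit_leb) \<in> borel_measurable angles"
    by (rule U.borel_measurable_lebesgue_integral[OF *])
  have "norm (\<integral>t. F (?c (\<theta>(i := t))) \<partial>unit_leb) \<le> B" for \<theta>
  proof (cases "integrable unit_leb (\<lambda>t. F (?c (\<theta>(i := t))))")
    case True
    then show ?thesis
      by (intro integral_bounded_prob(2)[OF prob_space_unit_leb borel_measurable_integrable]) (rule True, rule B)
  next
    \<comment> \<open>The default value 0 of a non-integrable function obeys the bound as well, so
      no slice has to be shown measurable.\<close>
    case False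
    then show ?thesis using order_trans[OF norm_ge_zero B] by (simp add: not_integrable_integral_eq)
  qed
  from angles_integral_split[OF meas' this, of i]
  have "torus_int (\<lambda>s. CT (\<lambda>z. F (s(i := z)))) =
      (\<integral>X. (\<integral>t'. (\<integral>t. F (?c (X(i := t))) \<partial>unit_leb) \<partial>unit_leb) \<partial>?P)"
    unfolding torus_int_def CT_def upd by simp
  also have "\<dots> = (\<integral>X. (\<integral>t. F (?c (X(i := t))) \<partial>unit_leb) \<partial>?P)"
    using U.prob_space by simp
  also have "\<dots> = torus_int F"
    unfolding torus_int_def by (rule angles_integral_split[OF meas B, symmetric])
  finally show ?thesis by simp
qed

lemma torus_int_cong_CT:
  assumes "torus_bounded F" and "torus_bounded G"
    and "\<And>s. s \<in> torus \<Longrightarrow> CT (\<lambda>z. F (s(i := z))) = CT (\<lambda>z. G (s(i := z)))"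
  shows "torus_int F = torus_int G"
  using torus_int_CT[OF assms(1), of i] torus_int_CT[OF assms(2), of i] torus_int_cong[OF assms(3)]
  by simp

lemma torus_int_reindex:
  assumes F: "torus_bounded F" and \<pi>: "inj \<pi>"
  shows "torus_int (\<lambda>s. F (\<lambda>i. s (\<pi> i))) = torus_int F"
proof -
  let ?c = "\<lambda>\<theta> i. cis (2 * pi * \<theta> (i::nat))"
  have D: "distr angles angles (\<lambda>\<omega>. \<lambda>n\<in>UNIV. \<omega> (\<pi> n)) = angles"
    using distr_PiM_reindex[of UNIV "\<lambda>_. unit_leb" \<pi> UNIV] \<pi> prob_space_unit_leb by simp
  have m: "(\<lambda>\<omega>. \<lambda>n\<in>UNIV. \<omega> (\<pi> n)) \<in> angles \<rightarrow>\<^sub>M angles"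
    by (rule measurable_restrict) auto
  have "torus_int F = (\<integral>\<theta>. F (?c \<theta>) \<partial>distr angles angles (\<lambda>\<omega>. \<lambda>n\<in>UNIV. \<omega> (\<pi> n)))"
    unfolding D torus_int_def ..
  also have "\<dots> = (\<integral>\<theta>. F (?c (\<lambda>n\<in>UNIV. \<theta> (\<pi> n))) \<partial>angles)"
    by (rule integral_distr[OF m torus_bounded_cis(1)[OF F]])
  finally show ?thesis by (simp add: torus_int_def)
qed

section \<open>Separately holomorphic functions on the infinite complex torus\<close>

definition annuli :: "real \<Rightarrow> (nat \<Rightarrow> complex) set" where
  "annuli R = {s. \<forall>i. 1 / R \<le> norm (s i) \<and> norm (s i) \<le> R}"

text \<open>A function of the tail of the sequence is constant in each coordinate, so separate
  holomorphy alone gives neither measurability nor bounds; both are demanded. Bounds on all annuli,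
  not just on the torus, keep the class stable under scaling of coordinates and provide Cauchy
  estimates.\<close>

definition polyholo :: "((nat \<Rightarrow> complex) \<Rightarrow> complex) \<Rightarrow> bool" where
  "polyholo F \<longleftrightarrow> F \<in> borel_measurable borel_seq
     \<and> (\<forall>R>0. \<exists>B. \<forall>s\<in>annuli R. norm (F s) \<le> B)
     \<and> (\<forall>s i. (\<forall>j. s j \<noteq> 0) \<longrightarrow> (\<lambda>z. F (s(i := z))) holomorphic_on -{0})"

lemma polyholo_bounded:
  assumes "polyholo F" and "R > 0"
  obtains B where "B > 0" and "\<And>s. s \<in> annuli R \<Longrightarrow> norm (F s) \<le> B"
proof -
  obtain B where B: "\<forall>s\<in>annuli R. norm (F s) \<le> B"
    using assms unfolding polyholo_def by blast
  show ?thesis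
    by (rule that[of "max B 1"]) (use B in \<open>auto simp: le_max_iff_disj\<close>)
qed

lemma polyholo_measurable: "polyholo F \<Longrightarrow> F \<in> borel_measurable borel_seq"
  by (simp add: polyholo_def)

lemma polyholo_holomorphic:
  "polyholo F \<Longrightarrow> (\<And>j. s j \<noteq> 0) \<Longrightarrow> (\<lambda>z. F (s(i := z))) holomorphic_on -{0}"
  by (simp add: polyholo_def)

lemma torus_bounded_polyholo:
  assumes "polyholo F"
  shows "torus_bounded F"
proof -
  obtain B where "\<And>s. s \<in> annuli 1 \<Longrightarrow> norm (F s) \<le> B"
    using polyholo_bounded[OF assms, of 1] by auto
  then have "\<forall>s\<in>torus. norm (F s) \<le> B" by (simp add: annuli_def)
  then show ?thesis
    using polyholo_measurable[OF assms] unfolding torus_bounded_def by blast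
qed

lemma polyholo_const [simp]: "polyholo (\<lambda>_. c)"
  by (auto simp: polyholo_def)

lemma polyholo_add:
  assumes F: "polyholo F" and G: "polyholo G"
  shows "polyholo (\<lambda>s. F s + G s)"
  unfolding polyholo_def
proof (intro conjI allI impI)
  show "(\<lambda>s. F s + G s) \<in> borel_measurable borel_seq"
    by (intro borel_measurable_add polyholo_measurable F G)
  fix R :: real assume R: "R > 0"
  obtain B where B: "\<And>s. s \<in> annuli R \<Longrightarrow> norm (F s) \<le> B" using polyholo_bounded[OF F R] by metis
  obtain C where C: "\<And>s. s \<in> annuli R \<Longrightarrow> norm (G s) \<le> C" using polyholo_bounded[OF G R] by metis
  show "\<exists>B. \<forall>s\<in>annuli R. norm (F s + G s) \<le> B"
    by (intro exI[of _ "B + C"] ballI norm_triangle_mono B C)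
qed (use F G in \<open>auto intro!: holomorphic_on_add simp: polyholo_holomorphic\<close>)

lemma polyholo_mult:
  assumes F: "polyholo F" and G: "polyholo G"
  shows "polyholo (\<lambda>s. F s * G s)"
  unfolding polyholo_def
proof (intro conjI allI impI)
  show "(\<lambda>s. F s * G s) \<in> borel_measurable borel_seq"
    by (intro borel_measurable_times polyholo_measurable F G)
  fix R :: real assume R: "R > 0"
  obtain B where B0: "B > 0" and B: "\<And>s. s \<in> annuli R \<Longrightarrow> norm (F s) \<le> B"
    using polyholo_bounded[OF F R] by metis
  obtain C where C: "\<And>s. s \<in> annuli R \<Longrightarrow> norm (G s) \<le> C" using polyholo_bounded[OF G R] by metis
  show "\<exists>B. \<forall>s\<in>annuli R. norm (F s * G s) \<le> B"
    by (intro exI[of _ "B * C"] ballI) (use B0 in \<open>auto simp: norm_mult intro!: mult_mono B C\<close>)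
qed (use F G in \<open>auto intro!: holomorphic_on_mult simp: polyholo_holomorphic\<close>)

lemma polyholo_cmult: "polyholo F \<Longrightarrow> polyholo (\<lambda>s. c * F s)"
  by (intro polyholo_mult polyholo_const)

lemma polyholo_uminus: "polyholo F \<Longrightarrow> polyholo (\<lambda>s. - F s)"
  using polyholo_cmult[of F "-1"] by simp

lemma polyholo_diff: "polyholo F \<Longrightarrow> polyholo G \<Longrightarrow> polyholo (\<lambda>s. F s - G s)"
  using polyholo_add[OF _ polyholo_uminus, of F G] by simp

lemma polyholo_prod: "(\<And>a. a \<in> A \<Longrightarrow> polyholo (F a)) \<Longrightarrow> polyholo (\<lambda>s. \<Prod>a\<in>A. F a s)"
  by (induction A rule: infinite_finite_induct) (auto intro: polyholo_mult)

lemma polyholo_sum: "(\<And>a. a \<in> A \<Longrightarrow> polyholo (F a)) \<Longrightarrow> polyholo (\<lambda>s. \<Sum>a\<in>A. F a s)"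
  by (induction A rule: infinite_finite_induct) (auto intro: polyholo_add)

lemma polyholo_comp:
  assumes g: "g holomorphic_on -{0}" and M: "M \<in> borel_measurable borel_seq"
    and ann: "\<And>R. R > 0 \<Longrightarrow> \<exists>R'>0. \<forall>s\<in>annuli R. 1 / R' \<le> norm (M s) \<and> norm (M s) \<le> R'"
    and hol: "\<And>s i. (\<And>j. s j \<noteq> 0) \<Longrightarrow> (\<lambda>z. M (s(i := z))) holomorphic_on -{0}"
    and nz: "\<And>s. (\<And>j. s j \<noteq> 0) \<Longrightarrow> M s \<noteq> 0"
  shows "polyholo (\<lambda>s. g (M s))"
  unfolding polyholo_def
proof (intro conjI allI impI)
  \<comment> \<open>Nothing is known about \<open>g\<close> at 0; a single exceptional point does
    not spoil Borel measurability.\<close>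
  have "(\<lambda>z. if z \<in> -{0} then g z else g 0) \<in> borel_measurable borel"
    by (rule borel_measurable_continuous_on_if)
       (use holomorphic_on_imp_continuous_on[OF g] in auto)
  also have "(\<lambda>z. if z \<in> -{0} then g z else g 0) = g" by auto
  finally show "(\<lambda>s. g (M s)) \<in> borel_measurable borel_seq"
    by (rule measurable_compose[OF M])
next
  fix R :: real assume "R > 0"
  with ann obtain R' where R': "R' > 0" "\<And>s. s \<in> annuli R \<Longrightarrow> 1 / R' \<le> norm (M s) \<and> norm (M s) \<le> R'"
    by metis
  \<comment> \<open>On the annuli \<open>M\<close> takes values in a compact ring around 0, where
    the continuous \<open>g\<close> is bounded.\<close>
  let ?K = "cball 0 R' - ball (0::complex) (1 / R')"
  have "compact ?K" by (intro compact_diff compact_cball open_ball)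
  moreover have "continuous_on ?K g"
    using holomorphic_on_imp_continuous_on[OF g] R'(1) by (elim continuous_on_subset) auto
  ultimately have "bounded (g ` ?K)" by (intro compact_imp_bounded compact_continuous_image)
  then obtain B where "\<forall>x\<in>g ` ?K. norm x \<le> B" unfolding bounded_iff by blast
  then have B: "norm (g z) \<le> B" if "z \<in> ?K" for z using that by blast
  show "\<exists>B. \<forall>s\<in>annuli R. norm (g (M s)) \<le> B"
    by (intro exI[of _ B] ballI B) (use R'(2) in force)
next
  fix s :: "nat \<Rightarrow> complex" and i assume s: "\<forall>j. s j \<noteq> 0"
  have "(\<lambda>z. M (s(i := z))) ` (-{0}) \<subseteq> -{0}"
  proof (rule image_subsetI)
    fix z :: complex assume "z \<in> -{0}"
    then have "(s(i := z)) j \<noteq> 0" for j using s by auto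
    then have "M (s(i := z)) \<noteq> 0" by (rule nz)
    then show "M (s(i := z)) \<in> -{0}" by simp
  qed
  then show "(\<lambda>z. g (M (s(i := z)))) holomorphic_on -{0}"
    using holomorphic_on_compose_gen[OF hol g, of s i] s by (auto simp: o_def)
qed

lemma holomorphic_upd_coord: "(\<lambda>z. (s(k := z)) i) holomorphic_on A"
  by (cases "i = k") (auto intro!: holomorphic_intros)

lemma polyholo_coord:
  assumes "g holomorphic_on -{0}"
  shows "polyholo (\<lambda>s. g (s i))"
proof (rule polyholo_comp[OF assms])
  show "(\<lambda>z. (s(j := z)) i) holomorphic_on -{0}" for s :: "nat \<Rightarrow> complex" and j
    by (rule holomorphic_upd_coord)
qed (auto simp: annuli_def)

lemma polyholo_power_int [simp]: "polyholo (\<lambda>s. s i powi n)"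
  by (rule polyholo_coord) (auto intro!: holomorphic_intros)

lemma polyholo_proj [simp]: "polyholo (\<lambda>s. s i)"
  using polyholo_power_int[of i 1] by simp

text \<open>Substitution into a function that is holomorphic only off 0 requires arguments bounded
  away from 0 on every annulus; a bound on the inverse says just that.\<close>

definition polyunit :: "((nat \<Rightarrow> complex) \<Rightarrow> complex) \<Rightarrow> bool" where
  "polyunit M \<longleftrightarrow> polyholo M \<and> polyholo (\<lambda>s. inverse (M s)) \<and> (\<forall>s. (\<forall>j. s j \<noteq> 0) \<longrightarrow> M s \<noteq> 0)"

lemma polyunit_polyholo: "polyunit M \<Longrightarrow> polyholo M"
  by (simp add: polyunit_def)

lemma polyunit_const: "c \<noteq> 0 \<Longrightarrow> polyunit (\<lambda>_. c)"
  by (simp add: polyunit_def)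

lemma polyunit_proj: "polyunit (\<lambda>s. s i)"
  unfolding polyunit_def by (auto intro!: polyholo_coord holomorphic_intros)

lemma polyunit_mult: "polyunit M \<Longrightarrow> polyunit M' \<Longrightarrow> polyunit (\<lambda>s. M s * M' s)"
  unfolding polyunit_def by (auto intro!: polyholo_mult)

lemma polyunit_inverse: "polyunit M \<Longrightarrow> polyunit (\<lambda>s. inverse (M s))"
  unfolding polyunit_def by auto

lemma polyunit_divide: "polyunit M \<Longrightarrow> polyunit M' \<Longrightarrow> polyunit (\<lambda>s. M s / M' s)"
  unfolding divide_inverse by (intro polyunit_mult polyunit_inverse)

lemma polyunit_power: "polyunit M \<Longrightarrow> polyunit (\<lambda>s. M s ^ n)"
  by (induction n) (auto intro: polyunit_const polyunit_mult)

lemma polyunit_prod: "(\<And>a. a \<in> A \<Longrightarrow> polyunit (M a)) \<Longrightarrow> polyunit (\<lambda>s. \<Prod>a\<in>A. M a s)"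
  by (induction A rule: infinite_finite_induct) (auto intro: polyunit_const polyunit_mult)

lemma polyholo_comp_polyunit:
  assumes g: "g holomorphic_on -{0}" and M: "polyunit M"
  shows "polyholo (\<lambda>s. g (M s))"
proof (rule polyholo_comp[OF g])
  have M': "polyholo M" "polyholo (\<lambda>s. inverse (M s))" and nz: "\<And>s. (\<And>j. s j \<noteq> 0) \<Longrightarrow> M s \<noteq> 0"
    using M by (auto simp: polyunit_def)
  show "M \<in> borel_measurable borel_seq" using M' by (intro polyholo_measurable)
  show "M s \<noteq> 0" if "\<And>j. s j \<noteq> 0" for s using nz that .
  show "(\<lambda>z. M (s(i := z))) holomorphic_on -{0}" if "\<And>j. s j \<noteq> 0" for s i
    using polyholo_holomorphic[OF M'(1) that] .
  fix R :: real assume R: "R > 0"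
  obtain B where B: "B > 0" "\<And>s. s \<in> annuli R \<Longrightarrow> norm (M s) \<le> B"
    using polyholo_bounded[OF M'(1) R] by metis
  obtain C where C: "C > 0" "\<And>s. s \<in> annuli R \<Longrightarrow> norm (inverse (M s)) \<le> C"
    using polyholo_bounded[OF M'(2) R] by metis
  have "1 / (B + C) \<le> norm (M s) \<and> norm (M s) \<le> B + C" if s: "s \<in> annuli R" for s
  proof -
    have "s j \<noteq> 0" for j
    proof
      assume "s j = 0"
      then have "1 / R \<le> 0" using s by (auto simp: annuli_def dest: spec[of _ j])
      then show False using R by simp
    qed
    then have pos: "norm (M s) > 0" using nz by simp
    have "inverse (norm (M s)) \<le> B + C" using C(2)[OF s] B(1) by (simp add: norm_inverse)
    then have "1 \<le> (B + C) * norm (M s)" using pos by (simp add: field_simps)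
    then show ?thesis using B C(1) B(2)[OF s] by (simp add: divide_le_eq mult.commute)
  qed
  then show "\<exists>R'>0. \<forall>s\<in>annuli R. 1 / R' \<le> norm (M s) \<and> norm (M s) \<le> R'"
    using B(1) C(1) by (intro exI[of _ "B + C"]) auto
qed

lemma polyholo_comp_ratio: "g holomorphic_on -{0} \<Longrightarrow> polyholo (\<lambda>s. g (s i / s j))"
  by (intro polyholo_comp_polyunit polyunit_divide polyunit_proj)

lemma polyholo_upd_cmult:
  assumes F: "polyholo F" and c: "c \<noteq> 0"
  shows "polyholo (\<lambda>s. F (s(i := c * s i)))"
  unfolding polyholo_def
proof (intro conjI allI impI)
  have "(\<lambda>s j. (s(i := c * s i)) j) \<in> borel_seq \<rightarrow>\<^sub>M borel_seq"
  proof (rule measurable_seq_fun)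
    show "(\<lambda>s. (s(i := c * s i)) j) \<in> borel_measurable borel_seq" for j
      by (cases "j = i") auto
  qed
  from measurable_compose[OF this polyholo_measurable[OF F]]
  show "(\<lambda>s. F (s(i := c * s i))) \<in> borel_measurable borel_seq" by (simp add: fun_upd_def)
next
  fix R :: real assume R: "R > 0"
  \<comment> \<open>Large enough for the untouched coordinates and for both the outer and the inner
    radius of the scaled one.\<close>
  define R' where "R' = R + R * norm c + R / norm c"
  have R': "R' \<ge> R" "R' \<ge> R * norm c" "R' \<ge> R / norm c" "R' > 0"
    using R c unfolding R'_def by (auto intro!: add_pos_pos add_nonneg_nonneg)
  have "s(i := c * s i) \<in> annuli R'" if s: "s \<in> annuli R" for s
    unfolding annuli_def
  proof (intro CollectI allI)
    fix j
    have b: "1 / R \<le> norm (s j)" "norm (s j) \<le> R" using s by (auto simp: annuli_def)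
    show "1 / R' \<le> norm ((s(i := c * s i)) j) \<and> norm ((s(i := c * s i)) j) \<le> R'"
    proof (cases "j = i")
      case True
      have "1 / R' \<le> 1 / (R / norm c)" using R' R c by (intro divide_left_mono) auto
      also have "\<dots> = norm c * (1 / R)" by simp
      also have "\<dots> \<le> norm c * norm (s j)" using b by (intro mult_left_mono) auto
      finally have "1 / R' \<le> norm c * norm (s j)" .
      moreover have "norm c * norm (s j) \<le> norm c * R" using b by (intro mult_left_mono) auto
      ultimately show ?thesis using True R'(2) by (simp add: norm_mult mult.commute)
    next
      case False
      have "1 / R' \<le> 1 / R" using R' R by (intro divide_left_mono) auto
      then show ?thesis using False b R'(1) by auto
    qed
  qed
  then show "\<exists>B. \<forall>s\<in>annuli R. norm (F (s(i := c * s i))) \<le> B"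
    using polyholo_bounded[OF F R'(4)] by metis
next
  fix s :: "nat \<Rightarrow> complex" and j assume s: "\<forall>j. s j \<noteq> 0"
  show "(\<lambda>z. F ((s(j := z))(i := c * (s(j := z)) i))) holomorphic_on -{0}"
  proof (cases "j = i")
    case True
    have "(\<lambda>z. F (s(i := z))) \<circ> (\<lambda>z. c * z) holomorphic_on -{0}"
      by (rule holomorphic_on_compose_gen[where t = "-{0}"])
         (use c s in \<open>auto intro!: holomorphic_intros polyholo_holomorphic[OF F]\<close>)
    then show ?thesis using True by (simp add: o_def)
  next
    case False
    then have "(s(j := z))(i := c * (s(j := z)) i) = (s(i := c * s i))(j := z)" for z
      by (auto simp: fun_eq_iff)
    then show ?thesis
      using polyholo_holomorphic[OF F, of "s(i := c * s i)" j] s c by auto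
  qed
qed

text \<open>Contour deformation: with the other coordinates fixed this is
  \<open>CT_scale_power\<close> with exponent 1. All recursions rest on it.\<close>

lemma torus_int_upd_cmult:
  assumes F: "polyholo F" and c: "c \<noteq> 0"
  shows "torus_int (\<lambda>s. F (s(i := c * s i))) = torus_int F"
proof (rule torus_int_cong_CT[where i = i])
  show "torus_bounded (\<lambda>s. F (s(i := c * s i)))" "torus_bounded F"
    by (intro torus_bounded_polyholo polyholo_upd_cmult F c)+
  fix s :: "nat \<Rightarrow> complex" assume "s \<in> torus"
  then have "s j \<noteq> 0" for j by (metis (mono_tags) mem_Collect_eq norm_zero zero_neq_one)
  from CT_scale_power[OF polyholo_holomorphic[OF F this, where i = i] c, of 1]
  show "CT (\<lambda>z. F ((s(i := z))(i := c * (s(i := z)) i))) = CT (\<lambda>z. F (s(i := z)))" by simp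
qed

lemma polyholo_scale:
  assumes F: "polyholo F" and c: "c \<noteq> 0"
  shows "polyholo (\<lambda>s. F (\<lambda>j. if j < n then c * s j else s j))"
    and "torus_int (\<lambda>s. F (\<lambda>j. if j < n then c * s j else s j)) = torus_int F"
proof (induction n)
  case (Suc n)
  have eq: "(\<lambda>j. if j < Suc n then c * s j else s j) =
      (\<lambda>j. if j < n then c * (s(n := c * s n)) j else (s(n := c * s n)) j)" for s :: "nat \<Rightarrow> complex"
    by (auto simp: fun_eq_iff less_Suc_eq)
  {
    case 1
    show ?case unfolding eq using polyholo_upd_cmult[OF Suc(1) c, of n] by simp
  next
    case 2
    show ?case unfolding eq using torus_int_upd_cmult[OF Suc(1) c, of n] Suc(2) by simp
  }
qed (use F in simp_all)

declare Y.simps [simp del]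

section \<open>Alternating functionals of exponent vectors\<close>

text \<open>\<open>A e\<close> stands for the constant term of the monomial with exponents \<open>e\<close> times an alternating
  function of \<open>N\<close> variables. The \<open>shift\<close> assumptions of the two locales extending this one express that
  constant terms are invariant under \<open>s\<^sub>i \<mapsto> q s\<^sub>i\<close>.\<close>
locale alternating_functional =
  fixes N :: nat and A :: "(nat \<Rightarrow> int) \<Rightarrow> complex"
  assumes A_cong: "(\<And>l. l < N \<Longrightarrow> e l = e' l) \<Longrightarrow> A e = A e'"
    and A_swap: "i < N \<Longrightarrow> j < N \<Longrightarrow> i \<noteq> j \<Longrightarrow> A (\<lambda>l. e (Transposition.transpose i j l)) = - A e"
begin

lemma A_eq_0:
  assumes "i < N" "j < N" "i \<noteq> j" "e i = e j"
  shows "A e = 0"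
proof -
  have "(\<lambda>l. e (Transposition.transpose i j l)) = e"
    using assms(4) by (auto simp: Transposition.transpose_def fun_eq_iff)
  then show ?thesis using A_swap[OF assms(1-3), of e] by simp
qed

text \<open>The cycle is a product of \<open>n\<close> adjacent transpositions.\<close>

lemma A_rotate:
  "n < N \<Longrightarrow> A (\<lambda>l. if l < n then e (Suc l) else if l = n then e 0 else e l) = (-1) ^ n * A e"
proof (induction n)
  case 0
  have "(\<lambda>l. if l < 0 then e (Suc l) else if l = 0 then e 0 else e l) = e" by auto
  then show ?case by simp
next
  case (Suc n)
  let ?r = "\<lambda>n l. if l < n then e (Suc l) else if l = n then e 0 else e l"
  have "?r (Suc n) = (\<lambda>l. ?r n (Transposition.transpose n (Suc n) l))"
    by (auto simp: fun_eq_iff Transposition.transpose_def)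
  then have "A (?r (Suc n)) = - A (?r n)"
    using A_swap[of n "Suc n" "?r n"] Suc.prems by simp
  then show ?case using Suc by simp
qed

text \<open>Staircases with the first \<open>i\<close> entries raised. Raising entries one at a time
  leads from \<open>front 0 k\<close> to \<open>front N k\<close>, which agrees with
  \<open>front 0 (k - 1)\<close> on the first \<open>N\<close> indices; this closes the chain into a
  recursion in \<open>k\<close>.\<close>

definition front :: "nat \<Rightarrow> int \<Rightarrow> nat \<Rightarrow> int" where
  "front i k l = (if l < i then 1 else 0) - int l - k"

lemma A_front_N: "A (front N k) = A (front 0 (k - 1))"
  by (rule A_cong) (simp add: front_def)

lemma A_rotate_eq:
  assumes "N > 0" and "\<And>l. Suc l < N \<Longrightarrow> e (Suc l) = e' l" and "e 0 = e' (N - 1)"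
  shows "A e = (-1) ^ (N - 1) * A e'"
proof -
  let ?r = "\<lambda>l. if l < N - 1 then e (Suc l) else if l = N - 1 then e 0 else e l"
  have "A ?r = A e'"
    by (rule A_cong) (use assms in auto)
  moreover have "A ?r = (-1) ^ (N - 1) * A e"
    using A_rotate[of "N - 1" e] assms(1) by simp
  ultimately have "(-1) ^ (N - 1) * A e' = ((-1) ^ (N - 1) * (-1) ^ (N - 1)) * A e" by simp
  then show ?thesis by (simp flip: power_mult_distrib)
qed

end

section \<open>Recursions in k and m for the Wilson line terms\<close>

locale wilson_functional = alternating_functional +
  fixes x q r :: complex
  assumes N_pos: "N > 0" and norm_q: "norm q < 1" and q_nz: "q \<noteq> 0" and r_sq: "r\<^sup>2 = q" and x_nz: "x \<noteq> 0"
    and shift: "i < N \<Longrightarrow> A e - x / r * A (e(i := e i + 1)) =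
      (-1) ^ (N - 1) * q powi (e i) * A (\<lambda>l. e l + 1 - (if l = i then int N else 0))"
begin

lemma r_nz: "r \<noteq> 0"
  using r_sq q_nz by auto

lemma q_power_neq_1: "k > 0 \<Longrightarrow> q ^ k \<noteq> 1"
proof
  assume "k > 0" "q ^ k = 1"
  then have "norm q ^ k = 1" by (metis norm_one norm_power)
  with \<open>k > 0\<close> norm_q show False
    by (metis norm_ge_zero not_gr_zero power_eq_1_iff abs_norm_cancel less_irrefl real_norm_def)
qed

text \<open>The vector fed into \<open>shift\<close> is \<open>front i k\<close> with its first
  entry lowered again. For \<open>i > 1\<close> that entry equals the second one and the constant
  term vanishes; for \<open>i = 1\<close> the plain staircase remains. On the other side entry 0
  becomes the smallest and rotates to the end, and the sign of this rotation cancels the one in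
  \<open>shift\<close>.\<close>

lemma front_step:
  assumes "1 \<le> i" "i \<le> N"
  shows "(if i = 1 then A (front 0 k) else 0) - x / r * A (front i k) = q powi (- k) * A (front (i - 1) k)"
proof -
  let ?e = "(front i k)(0 := - k)"
  have "A ?e = (if i = 1 then A (front 0 k) else 0)"
  proof (cases "i = 1")
    case True
    then show ?thesis by (auto intro!: A_cong simp: front_def)
  next
    case False
    then have "A ?e = 0"
      using assms by (intro A_eq_0[of 0 1]) (auto simp: front_def)
    then show ?thesis using False by simp
  qed
  moreover have "?e(0 := ?e 0 + 1) = front i k"
    using assms by (auto simp: fun_eq_iff front_def)
  moreover have "A (\<lambda>l. ?e l + 1 - (if l = 0 then int N else 0)) = (-1) ^ (N - 1) * A (front (i - 1) k)"
    by (rule A_rotate_eq) (use assms N_pos in \<open>auto simp: front_def\<close>)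
  ultimately show ?thesis
    using shift[of 0 ?e] N_pos by (simp flip: power_mult_distrib mult.assoc)
qed

lemma front_1: "A (front 1 k) = r / x * (1 - q powi (- k)) * A (front 0 k)"
  using front_step[of 1 k] N_pos x_nz r_nz by (simp add: field_simps)

lemma front_Suc:
  "Suc i \<le> N \<Longrightarrow> A (front (Suc i) k) = (- (r / x) * q powi (- k)) ^ i * (r / x * (1 - q powi (- k)) * A (front 0 k))"
proof (induction i)
  case 0
  then show ?case using front_1 by simp
next
  case (Suc i)
  have "- (x / r) * A (front (Suc (Suc i)) k) = q powi (- k) * A (front (Suc i) k)"
    using front_step[of "Suc (Suc i)" k] Suc.prems by simp
  then have "A (front (Suc (Suc i)) k) = - (r / x) * (q powi (- k) * A (front (Suc i) k))"
    by (simp flip: \<open>- (x / r) * _ = _\<close> add: x_nz r_nz)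
  also have "\<dots> = (- (r / x) * q powi (- k)) * A (front (Suc i) k)" by (simp add: mult.assoc)
  also have "A (front (Suc i) k) = (- (r / x) * q powi (- k)) ^ i * (r / x * (1 - q powi (- k)) * A (front 0 k))"
    using Suc by simp
  finally show ?case by (simp only: power_Suc mult.assoc)
qed

text \<open>Each of the \<open>N\<close> raising steps contributes
  \<open>- (r / x) * q powi (- k)\<close>. Only the first one, where no term of the relation
  vanishes by collision, adds the factor \<open>1 - q powi k\<close>; the q-factorials in the
  denominators come from it.\<close>

lemma front_0_rec: 
  "A (front 0 (k - 1)) = (- (r / x) * q powi (- k)) ^ N * (1 - q powi k) * A (front 0 k)"
proof -
  have "A (front 0 (k - 1)) = A (front (Suc (N - 1)) k)"
    using A_front_N N_pos by simp
  also have "\<dots> = (- (r / x) * q powi (- k)) ^ (N - 1) * (r / x * (1 - q powi (- k)) * A (front 0 k))"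
    using N_pos by (intro front_Suc) simp
  also have "r / x * (1 - q powi (- k)) = (- (r / x) * q powi (- k)) * (1 - q powi k)"
  proof -
    have "q powi (- k) * q powi k = 1" using q_nz by (simp flip: power_int_add)
    moreover have "y * (1 - a) = - y * a * (1 - b)" if "a * b = 1" for a b y :: complex
    proof -
      have "y * a * b = y" using that by (simp add: mult.assoc)
      then show ?thesis by (simp add: algebra_simps)
    qed
    ultimately show ?thesis by blast
  qed
  also have "(- (r / x) * q powi (- k)) ^ (N - 1) * ((- (r / x) * q powi (- k)) * (1 - q powi k) * A (front 0 k))
     = (- (r / x) * q powi (- k)) ^ Suc (N - 1) * (1 - q powi k) * A (front 0 k)"
    by (simp only: power_Suc2 mult.assoc)
  finally show ?thesis using N_pos by simp
qed

text \<open>At \<open>k = 0\<close> the factor \<open>1 - q powi k\<close> is 0, which kills index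
  -1; the recursion carries the zero downwards.\<close>

lemma front_0_neg: "A (front 0 (- 1 - int n)) = 0"
proof (induction n)
  case 0
  then show ?case using front_0_rec[of 0] by simp
next
  case (Suc n)
  then show ?case using front_0_rec[of "- 1 - int n"] by (simp add: algebra_simps)
qed

lemma front_0_pos:
  "A (front 0 (int n)) = A (front 0 0) * ((- x) ^ (N * n) * r ^ (N * n\<^sup>2) / qpoch q q n)"
proof (induction n)
  case (Suc n)
  let ?k = "int (Suc n)"
  have q1: "1 - q ^ Suc n \<noteq> 0" using q_power_neq_1[of "Suc n"] by simp
  have "A (front 0 (int n)) = (- (r / x) * inverse (q ^ Suc n)) ^ N * (1 - q ^ Suc n) * A (front 0 ?k)"
    using front_0_rec[of ?k] by (simp add: power_int_minus del: power_Suc of_nat_Suc)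
      (simp add: power_int_def del: power_Suc)
  \<comment> \<open>The base is inverted by \<open>(- x) * r ^ (2 * n + 1)\<close>, because
    \<open>r\<^sup>2 = q\<close>. The odd exponents of \<open>r\<close> add up to the square in the
    closed form.\<close>
  moreover have "(- (r / x) * inverse (q ^ Suc n)) ^ N * ((- x) * r ^ (2 * n + 1)) ^ N = 1"
  proof -
    have "r * r ^ (2 * n + 1) = q ^ Suc n"
      unfolding r_sq[symmetric] by (simp flip: power_mult power_Suc)
    then have "(- (r / x) * inverse (q ^ Suc n)) * ((- x) * r ^ (2 * n + 1)) = 1"
      using x_nz q_nz by (simp add: field_simps)
    then show ?thesis by (simp flip: power_mult_distrib)
  qed
  ultimately have "A (front 0 (int n)) * ((- x) * r ^ (2 * n + 1)) ^ N = (1 - q ^ Suc n) * A (front 0 ?k)"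
    by (simp add: mult_ac)
  then have "A (front 0 ?k) = A (front 0 (int n)) * ((- x) * r ^ (2 * n + 1)) ^ N / (1 - q ^ Suc n)"
    using q1 by (simp add: field_simps)
  also have "((- x) * r ^ (2 * n + 1)) ^ N = (- x) ^ N * r ^ (N * (2 * n + 1))"
    by (simp only: power_mult_distrib power_mult[symmetric] mult.commute[of N])
  finally have "A (front 0 ?k) = A (front 0 0) * 
      ((- x) ^ (N * n) * (- x) ^ N * (r ^ (N * n\<^sup>2) * r ^ (N * (2 * n + 1))) / (qpoch q q n * (1 - q ^ Suc n)))"
    unfolding Suc.IH by simp
  also have "(- x) ^ (N * n) * (- x) ^ N = (- x) ^ (N * Suc n)"
    by (simp add: power_add mult.commute)
  also have "r ^ (N * n\<^sup>2) * r ^ (N * (2 * n + 1)) = r ^ (N * (Suc n)\<^sup>2)"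
  proof -
    have "N * n\<^sup>2 + N * (2 * n + 1) = N * (Suc n)\<^sup>2" by (simp add: power2_eq_square algebra_simps)
    then show ?thesis by (simp only: power_add[symmetric])
  qed
  also have "qpoch q q n * (1 - q ^ Suc n) = qpoch q q (Suc n)"
    by (simp add: qpoch_Suc)
  finally show ?case .
qed simp

text \<open>The index \<open>i\<close> of the paper is \<open>N - i\<close> here.\<close>
definition wilson_term :: "nat \<Rightarrow> int \<Rightarrow> int \<Rightarrow> complex" where
  "wilson_term i m k = A (\<lambda>l. - int l - k + (if l = i then m else 0))"

lemma wilson_term_0: "wilson_term i 0 k = A (front 0 k)"
  unfolding wilson_term_def by (rule A_cong) (simp add: front_def)

text \<open>Raising all exponents by one amounts to passing from \<open>k\<close> to
  \<open>k - 1\<close>, so the relation closes on the two indices \<open>m\<close> and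
  \<open>k\<close>.\<close>

lemma wilson_term_shift:
  assumes "i < N"
  shows "wilson_term i m k - x / r * wilson_term i (m + 1) k =
     (-1) ^ (N - 1) * q powi (m - int i - k) * wilson_term i (m - int N) (k - 1)"
proof -
  let ?e = "\<lambda>l. - int l - k + (if l = i then m else 0)"
  have "?e(i := ?e i + 1) = (\<lambda>l. - int l - k + (if l = i then m + 1 else 0))" by auto
  moreover have "(\<lambda>l. ?e l + 1 - (if l = i then int N else 0)) =
      (\<lambda>l. - int l - (k - 1) + (if l = i then m - int N else 0))" by auto
  ultimately show ?thesis
    using shift[OF assms, of ?e] unfolding wilson_term_def by (simp add: algebra_simps)
qed

lemma wilson_term_eq_0:
  assumes "i < N" "j < N" "j \<noteq> i" "m = int i - int j"
  shows "wilson_term i m k = 0"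
  unfolding wilson_term_def by (rule A_eq_0[OF assms(1,2)]) (use assms in auto)

text \<open>The entry at \<open>i\<close> has become the largest; moving it to the front past
  \<open>i\<close> others gives \<open>front (Suc i) k\<close> and the sign.\<close>

lemma wilson_term_Suc:
  assumes "i < N"
  shows "wilson_term i (int i + 1) k = (-1) ^ i * A (front (Suc i) k)"
proof -
  let ?e = "\<lambda>l. - int l - k + (if l = i then int i + 1 else 0)"
  have "A ?e = A (\<lambda>l. if l < i then front (Suc i) k (Suc l) else if l = i then front (Suc i) k 0 else front (Suc i) k l)"
    by (rule A_cong) (auto simp: front_def)
  then show ?thesis unfolding wilson_term_def using A_rotate[OF assms, of "front (Suc i) k"] by simp
qed

lemma wilson_term_small:
  assumes "i + d < N"
  shows "wilson_term i (int i + 1 + int d) k = (r / x) ^ d * (-1) ^ i * A (front (Suc i) k)"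
  using assms
proof (induction d)
  case 0
  then show ?case using wilson_term_Suc by simp
next
  case (Suc d)
  \<comment> \<open>Its exponent at \<open>i\<close> coincides with the one at
    \<open>N - Suc d\<close>, so the relation degenerates to the constant ratio
    \<open>r / x\<close>.\<close>
  have "wilson_term i (int i + 1 + int d - int N) (k - 1) = 0"
    by (rule wilson_term_eq_0[of i "N - Suc d"]) (use Suc.prems in \<open>auto simp: of_nat_diff\<close>)
  then have "x / r * wilson_term i (int i + 1 + int d + 1) k = wilson_term i (int i + 1 + int d) k"
    using wilson_term_shift[of i "int i + 1 + int d" k] Suc.prems by simp
  then have "wilson_term i (int i + 1 + int d + 1) k = r / x * wilson_term i (int i + 1 + int d) k"
    using x_nz r_nz by (simp add: field_simps)
  with Suc show ?case by (simp add: algebra_simps)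
qed

lemma wilson_term_mid:
  assumes i: "i < N" and m: "1 \<le> m" "m \<le> int N"
  shows "wilson_term i m k = A (front 0 0) * Y N (N - i) m k x q r"
proof (cases "m \<le> int i")
  case True
  have "wilson_term i m k = 0"
    by (rule wilson_term_eq_0[of i "nat (int i - m)"]) (use i m True in auto)
  moreover have "Y N (N - i) m k x q r = 0"
    using m True i by (subst Y.simps) (auto simp: of_nat_diff)
  ultimately show ?thesis by simp
next
  case False
  define d where "d = nat (m - int i - 1)"
  have md: "m = int i + 1 + int d" using False by (simp add: d_def)
  have "wilson_term i m k = (r / x) ^ d * (-1) ^ i * A (front (Suc i) k)"
    unfolding md by (rule wilson_term_small) (use m md in auto)
  also have "\<dots> = (r / x) ^ d * (-1) ^ i * ((- (r / x) * q powi (- k)) ^ i * (r / x * (1 - q powi (- k)) * A (front 0 k)))"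
    using i by (simp add: front_Suc)
  finally have w: "wilson_term i m k = \<dots>" .
  show ?thesis
  proof (cases "k > 0")
    case k: False
    \<comment> \<open>At \<open>k = 0\<close> the first factor vanishes, below 0 the second.\<close>
    have "(1 - q powi (- k)) * A (front 0 k) = 0"
    proof (cases "k = 0")
      case False
      then have "k = - 1 - int (nat (- k - 1))" using k by simp
      then have "A (front 0 k) = 0" using front_0_neg by metis
      then show ?thesis by simp
    qed simp
    then have "wilson_term i m k = 0" using w by simp
    moreover have "Y N (N - i) m k x q r = 0"
      using m k by (subst Y.simps) auto
    ultimately show ?thesis by simp
  next
    case True
    then obtain n where n: "k = int (Suc n)" by (metis not0_implies_Suc of_nat_0_less_iff pos_int_cases less_irrefl)
    define K where "K = Suc n"
    have k: "k = int K" using n K_def by simp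
    have y: "Y N (N - i) m k x q r = (-1) ^ (N * K + 1) * x powi (int N * k - m)
            * r powi (int N * k\<^sup>2 + m - 2 * (int i + 1) * k) / qpoch q q n"
    proof -
      have "int N + 1 - int (N - i) = int i + 1" "nat k = K" "nat (k - 1) = n"
        using i by (auto simp: k K_def of_nat_diff)
      moreover have "m \<noteq> 0" "int N - int (N - i) + 1 \<le> m" using m False i by auto
      ultimately show ?thesis
        using m True by (subst Y.simps) (simp only: if_True if_False simp_thms)
    qed
    have qp: "qpoch q q K = qpoch q q n * (1 - q ^ K)" by (simp add: K_def qpoch_Suc)
    have q1: "1 - q ^ K \<noteq> 0" using q_power_neq_1[of K] by (simp add: K_def)
    have "wilson_term i m k = A (front 0 0) * ((r / x) ^ d * (-1) ^ i * ((- (r / x) * q powi (- k)) ^ i * (r / x * (1 - q powi (- k)) *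
       ((- x) ^ (N * K) * r ^ (N * K\<^sup>2) / (qpoch q q n * (1 - q ^ K))))))"
      unfolding w unfolding k unfolding front_0_pos[of K] qp by (simp add: mult_ac)
    \<comment> \<open>The factor \<open>1 - q ^ K\<close> cancels the last factor of
      \<open>qpoch q q K\<close>, which explains the index \<open>k - 1\<close> of the q-factorial
      in \<open>Y\<close>.\<close>
    also have "1 - q powi (- k) = - (q powi (-k)) * (1 - q ^ K)"
      using q_nz by (simp add: k power_int_minus field_simps)
    also have "(r / x) ^ d * (-1) ^ i * ((- (r / x) * q powi (- k)) ^ i * (r / x * (- (q powi (-k)) * (1 - q ^ K)) *
       ((- x) ^ (N * K) * r ^ (N * K\<^sup>2) / (qpoch q q n * (1 - q ^ K))))) =
       (- 1) ^ (N * K + 1) * ((r / x) ^ (d + i + 1) * x ^ (N * K)) * (r ^ (N * K\<^sup>2) * (q powi (- k)) ^ (i + 1)) / qpoch q q n"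
    proof -
      \<comment> \<open>If \<open>c\<close> is 0, both sides vanish by the convention on
        division.\<close>
      have gen: "u ^ d * s * ((s * u ^ i * P ^ i) * (u * (- P * w) * ((t * xx) * R / (c * w)))) =
          (s * s) * ((- t) * (u ^ (d + i + 1) * xx) * (R * P ^ (i + 1)) / c)" if "w \<noteq> 0" for u s P w t xx R c :: complex
        by (cases "c = 0") (simp_all add: power_add that field_simps)
      have "(- (r / x) * q powi (- k)) ^ i = (- 1) ^ i * (r / x) ^ i * (q powi (- k)) ^ i"
        by (simp only: power_mult_distrib power_minus[of "r / x"])
      moreover have "(- x) ^ (N * K) = (- 1) ^ (N * K) * x ^ (N * K)"
        by (rule power_minus)
      moreover have "(- 1) ^ i * (- 1) ^ i = (1 :: complex)" by (simp flip: power_mult_distrib)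
      moreover have "(- 1) ^ (N * K + 1) = - ((- 1 :: complex) ^ (N * K))" by simp
      ultimately show ?thesis by (simp only: gen[OF q1] mult_1)
    qed
    also have "(r / x) ^ (d + i + 1) = r powi m * x powi (- m)"
    proof -
      have "m = int (d + i + 1)" by (simp add: md)
      then show ?thesis by (simp only: power_int_minus power_int_of_nat power_mult_distrib power_inverse divide_inverse)
    qed
    also have "(q powi (- k)) ^ (i + 1) = r powi (- 2 * (int i + 1) * k)"
    proof -
      have "(q powi (- k)) ^ (i + 1) = ((r powi 2) powi (- k)) powi int (i + 1)"
        unfolding r_sq[symmetric] by (simp only: power_int_of_nat power_int_numeral)
      also have "\<dots> = r powi (2 * (- k) * int (i + 1))" by (simp only: power_int_mult)
      also have "2 * (- k) * int (i + 1) = - 2 * (int i + 1) * k" by (simp add: algebra_simps)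
      finally show ?thesis .
    qed
    also have "x ^ (N * K) = x powi (int N * k)"
      unfolding k of_nat_mult[symmetric] by (simp only: power_int_of_nat)
    also have "r ^ (N * K\<^sup>2) = r powi (int N * k\<^sup>2)"
      unfolding k of_nat_power[symmetric] of_nat_mult[symmetric] by (simp only: power_int_of_nat)
    finally have w': "wilson_term i m k = A (front 0 0) * ((- 1) ^ (N * K + 1) * (r powi m * x powi (- m) * x powi (int N * k)) *
        (r powi (int N * k\<^sup>2) * r powi (- 2 * (int i + 1) * k)) / qpoch q q n)" .
    have X: "x powi (int N * k - m) = x powi (- m) * x powi (int N * k)"
      using power_int_add[of x "- m" "int N * k"] x_nz by (simp add: add.commute)
    have R: "r powi (int N * k\<^sup>2 + m - 2 * (int i + 1) * k) = r powi m * (r powi (int N * k\<^sup>2) * r powi (- 2 * (int i + 1) * k))"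
    proof -
      have "int N * k\<^sup>2 + m - 2 * (int i + 1) * k = m + (int N * k\<^sup>2 + (- 2 * (int i + 1) * k))"
        by (simp add: algebra_simps)
      then show ?thesis using r_nz by (simp only: power_int_add simp_thms)
    qed
    show ?thesis
      unfolding w' y X R by (simp only: mult_ac)
  qed
qed

text \<open>Induction along the termination measure of \<open>Y\<close>. Its two recursive cases are
  the single relation \<open>wilson_term_shift\<close>, solved for different terms.\<close>

lemma wilson_term_eq_Y:
  assumes i: "i < N"
  shows "wilson_term i m k = A (front 0 0) * Y N (N - i) m k x q r"
proof (induction "if m > int N then nat (m - int N) else if m < 0 then nat (- m) else 0"
    arbitrary: m k rule: less_induct)
  case less
  consider "m = 0" | "1 \<le> m" "m \<le> int N" | "m > int N" | "m < 0" by linarith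
  then show ?case
  proof cases
    case 1
    show ?thesis
    proof (cases "k \<ge> 0")
      case True
      have "wilson_term i 0 k = A (front 0 (int (nat k)))" using True by (simp add: wilson_term_0)
      then show ?thesis using True unfolding 1 front_0_pos by (subst Y.simps) simp
    next
      case False
      then have "k = - 1 - int (nat (- k - 1))" by simp
      then have "A (front 0 k) = 0" using front_0_neg by metis
      then show ?thesis using False unfolding 1 wilson_term_0 by (subst Y.simps) simp
    qed
  next
    case 2
    then show ?thesis using wilson_term_mid i by simp
  next
    case 3
    have "wilson_term i m k = r / x * (wilson_term i (m - 1) k
       - (-1) ^ (N - 1) * q powi (m - 1 - int i - k) * wilson_term i (m - 1 - int N) (k - 1))"
      using wilson_term_shift[OF i, of "m - 1" k] x_nz r_nz by (simp add: field_simps)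
    also have "wilson_term i (m - 1) k = A (front 0 0) * Y N (N - i) (m - 1) k x q r"
      by (rule less) (use 3 in auto)
    also have "wilson_term i (m - 1 - int N) (k - 1) = A (front 0 0) * Y N (N - i) (m - 1 - int N) (k - 1) x q r"
      by (rule less) (use 3 in auto)
    finally have w: "wilson_term i m k = r / x * (A (front 0 0) * Y N (N - i) (m - 1) k x q r
       - (-1) ^ (N - 1) * q powi (m - 1 - int i - k) * (A (front 0 0) * Y N (N - i) (m - 1 - int N) (k - 1) x q r))" .
    have "Y N (N - i) m k x q r = r * inverse x * (Y N (N - i) (m - 1) k x q r
          + (-1) ^ N * q powi (m + int (N - i) - k - int N - 1) * Y N (N - i) (m - int N - 1) (k - 1) x q r)"
      using 3 by (subst Y.simps) auto
    also have "m + int (N - i) - k - int N - 1 = m - 1 - int i - k" using i by (simp add: of_nat_diff)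
    also have "m - int N - 1 = m - 1 - int N" by simp
    also have "(-1) ^ N = - ((-1::complex) ^ (N - 1))" using N_pos by (cases N) auto
    finally show ?thesis unfolding w by (simp add: divide_inverse right_diff_distrib mult_ac)
  next
    case 4
    have s: "wilson_term i (m + int N) (k + 1) - x / r * wilson_term i (m + int N + 1) (k + 1) =
       (-1) ^ (N - 1) * q powi (m + int N - int i - (k + 1)) * wilson_term i m k"
      using wilson_term_shift[OF i, of "m + int N" "k + 1"] by simp
    \<comment> \<open>The relation is read at \<open>m + N\<close> and \<open>k + 1\<close> and
      solved for its right-hand term; this power of \<open>q\<close> clears the coefficient.\<close>
    have qq: "q powi (k + 1 - m - int N + int i) * q powi (m + int N - int i - (k + 1)) = 1"
      using q_nz by (simp flip: power_int_add)
    have "(-1) ^ (N - 1) * q powi (k + 1 - m - int N + int i) * ((-1) ^ (N - 1) * q powi (m + int N - int i - (k + 1)) * wilson_term i m k)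
      = ((-1) ^ (N - 1) * (-1) ^ (N - 1)) * (q powi (k + 1 - m - int N + int i) * q powi (m + int N - int i - (k + 1))) * wilson_term i m k"
      by (simp only: mult_ac)
    also have "\<dots> = wilson_term i m k"
      unfolding qq by (simp flip: power_mult_distrib)
    finally have "wilson_term i m k = (-1) ^ (N - 1) * q powi (k + 1 - m - int N + int i) *
       (wilson_term i (m + int N) (k + 1) - x / r * wilson_term i (m + int N + 1) (k + 1))"
      unfolding s by simp
    also have "wilson_term i (m + int N) (k + 1) = A (front 0 0) * Y N (N - i) (m + int N) (k + 1) x q r"
      by (rule less) (use 4 N_pos in auto)
    also have "wilson_term i (m + int N + 1) (k + 1) = A (front 0 0) * Y N (N - i) (m + int N + 1) (k + 1) x q r"
      by (rule less) (use 4 N_pos in auto)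
    also have "k + 1 - m - int N + int i = k - int (N - i) - m + 1" using i by (simp add: of_nat_diff)
    finally have w: "wilson_term i m k = (-1) ^ (N - 1) * q powi (k - int (N - i) - m + 1)
         * (A (front 0 0) * Y N (N - i) (m + int N) (k + 1) x q r
            - x / r * (A (front 0 0) * Y N (N - i) (m + int N + 1) (k + 1) x q r))" .
    have "Y N (N - i) m k x q r = (-1) ^ (N - 1) * q powi (k - int (N - i) - m + 1)
         * (Y N (N - i) (m + int N) (k + 1) x q r - x * inverse r * Y N (N - i) (m + int N + 1) (k + 1) x q r)"
      using 4 N_pos by (subst Y.simps) auto
    then show ?thesis unfolding w by (simp add: divide_inverse right_diff_distrib mult_ac)
  qed
qed

end

section \<open>Staircase recursion in the presence of a truncated theta function\<close>

locale theta_functional = alternating_functional +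
  fixes q Q :: complex
  assumes N_pos: "N > 0" and qQ: "q * Q \<noteq> 1"
    and shift: "i < N \<Longrightarrow> A e = (-1) ^ N * q powi (e i) *
      (A (\<lambda>l. e l + 1 - (if l = i then int N + 1 else 0)) - Q * A (\<lambda>l. e l + 1 - (if l = i then int N else 0)))"
begin

text \<open>In the first term of \<open>shift\<close> the top entry drops to the end of
  \<open>front (i - 1) 0\<close>. In the second it lands one higher and collides with the last
  entry, unless \<open>i = N\<close>: then all entries are raised and the rotation restores
  \<open>front N 0\<close> itself.\<close>

lemma front_step:
  assumes "1 \<le> i" "i \<le> N"
  shows "A (front i 0) = - q * (A (front (i - 1) 0) - (if i = N then Q * A (front N 0) else 0))"
proof -
  let ?e = "front i 0"
  have e0: "?e 0 = 1" using assms by (simp add: front_def)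
  have "A (\<lambda>l. ?e l + 1 - (if l = 0 then int N + 1 else 0)) = (-1) ^ (N - 1) * A (front (i - 1) 0)"
    by (rule A_rotate_eq) (use assms N_pos in \<open>auto simp: front_def\<close>)
  moreover have "A (\<lambda>l. ?e l + 1 - (if l = 0 then int N else 0)) = (-1) ^ (N - 1) * (if i = N then A (front N 0) else 0)"
  proof (cases "i = N")
    case True
    have "A (\<lambda>l. ?e l + 1 - (if l = 0 then int N else 0)) = (-1) ^ (N - 1) * A (front N 0)"
      by (rule A_rotate_eq) (use True N_pos in \<open>auto simp: front_def\<close>)
    then show ?thesis using True by simp
  next
    case False
    then have "A (\<lambda>l. ?e l + 1 - (if l = 0 then int N else 0)) = 0"
      using assms by (intro A_eq_0[of 0 "N - 1"]) (auto simp: front_def of_nat_diff)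
    then show ?thesis using False by simp
  qed
  moreover have "A ?e = (-1) ^ N * q * (A (\<lambda>l. ?e l + 1 - (if l = 0 then int N + 1 else 0))
      - Q * A (\<lambda>l. ?e l + 1 - (if l = 0 then int N else 0)))"
    using shift[of 0 ?e] N_pos unfolding e0 by simp
  ultimately have "A ?e = (-1) ^ N * q * ((-1) ^ (N - 1) * A (front (i - 1) 0)
      - Q * ((-1) ^ (N - 1) * (if i = N then A (front N 0) else 0)))"
    by simp
  also have "\<dots> = ((-1) ^ N * (-1) ^ (N - 1)) * (q * (A (front (i - 1) 0) - (if i = N then Q * A (front N 0) else 0)))"
    by (simp add: algebra_simps)
  also have "(-1) ^ N * (-1) ^ (N - 1) = (-1 :: complex)"
    using N_pos by (cases N) (auto simp flip: power_mult_distrib)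
  finally show ?thesis by simp
qed

lemma front_less: "i < N \<Longrightarrow> A (front i 0) = (- q) ^ i * A (front 0 0)"
proof (induction i)
  case (Suc i)
  have "A (front (Suc i) 0) = - q * A (front i 0)"
    using front_step[of "Suc i"] Suc.prems by simp
  then show ?case using Suc by simp
qed simp

text \<open>In the last step the unknown occurs on both sides; solving for it creates the
  denominator \<open>1 - q * Q\<close>.\<close>

lemma front_N: "A (front N 0) * (1 - q * Q) = (- q) ^ N * A (front 0 0)"
proof -
  have "1 \<le> N" using N_pos by simp
  from front_step[OF this order_refl]
  have *: "A (front N 0) = - q * (A (front (N - 1) 0) - Q * A (front N 0))"
    unfolding if_P[OF refl] .
  have "A (front N 0) * (1 - q * Q) = A (front N 0) - q * Q * A (front N 0)"
    by (simp add: algebra_simps)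
  also have "\<dots> = - q * A (front (N - 1) 0)"
    by (subst (1) *) (simp add: algebra_simps)
  also have "A (front (N - 1) 0) = (- q) ^ (N - 1) * A (front 0 0)"
    by (rule front_less) (use N_pos in simp)
  also have "- q * ((- q) ^ (N - 1) * A (front 0 0)) = (- q) ^ Suc (N - 1) * A (front 0 0)"
    by (simp only: power_Suc mult.assoc)
  finally show ?thesis using N_pos by simp
qed

text \<open>For \<open>j < N\<close> the terms form a truncated geometric series in
  \<open>q * Q\<close>. The last term, with its extra denominator \<open>1 - q * Q\<close>, is
  exactly the missing tail.\<close>

lemma sum_front: "(\<Sum>j\<le>N. (- Q) ^ j * A (front j 0)) * (1 - q * Q) = A (front 0 0)"
proof -
  have "(\<Sum>j<N. (- Q) ^ j * A (front j 0)) = (\<Sum>j<N. (q * Q) ^ j) * A (front 0 0)"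
    unfolding sum_distrib_right
  proof (rule sum.cong[OF refl])
    fix j assume "j \<in> {..<N}"
    then have "(- Q) ^ j * A (front j 0) = ((- Q) ^ j * (- q) ^ j) * A (front 0 0)"
      using front_less[of j] by (simp only: lessThan_iff mult.assoc)
    also have "(- Q) ^ j * (- q) ^ j = (q * Q) ^ j"
      by (simp only: power_mult_distrib[symmetric] minus_mult_minus mult.commute)
    finally show "(- Q) ^ j * A (front j 0) = (q * Q) ^ j * A (front 0 0)" .
  qed
  moreover have "(1 - q * Q) * (\<Sum>j<N. (q * Q) ^ j) = 1 - (q * Q) ^ N"
    by (rule one_diff_power_eq[symmetric])
  ultimately have "(\<Sum>j<N. (- Q) ^ j * A (front j 0)) * (1 - q * Q) = (1 - (q * Q) ^ N) * A (front 0 0)"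
    by (simp add: mult_ac)
  moreover have "(- Q) ^ N * A (front N 0) * (1 - q * Q) = (q * Q) ^ N * A (front 0 0)"
  proof -
    have "(- Q) ^ N * A (front N 0) * (1 - q * Q) = (- Q) ^ N * (- q) ^ N * A (front 0 0)"
      using front_N by (simp only: mult.assoc)
    also have "(- Q) ^ N * (- q) ^ N = (q * Q) ^ N"
      by (simp only: power_mult_distrib[symmetric] minus_mult_minus mult.commute)
    finally show ?thesis .
  qed
  moreover have "(\<Sum>j\<le>N. (- Q) ^ j * A (front j 0)) * (1 - q * Q) =
      (\<Sum>j<N. (- Q) ^ j * A (front j 0)) * (1 - q * Q) + (- Q) ^ N * A (front N 0) * (1 - q * Q)"
    by (simp only: lessThan_Suc_atMost[symmetric] sum.lessThan_Suc distrib_right)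
  ultimately show ?thesis
    by (simp add: left_diff_distrib)
qed

text \<open>If \<open>Suc l\<close> lies in \<open>T\<close> and \<open>l\<close> does not, the
  entries \<open>l\<close> and \<open>Suc l\<close> coincide and the term dies. Only initial
  segments survive, which are the vectors \<open>front j 0\<close>.\<close>

lemma sum_subsets:
  "(\<Sum>T\<in>Pow {..<N}. (- Q) ^ card T * A (\<lambda>l. (if l \<in> T then 1 else 0) - int l)) * (1 - q * Q) = A (front 0 0)"
proof -
  let ?f = "\<lambda>T. (- Q) ^ card T * A (\<lambda>l. (if l \<in> T then 1 else 0) - int l)"
  have inj: "inj_on (\<lambda>j. {..<j}) {..N}"
    by (auto simp: inj_on_def dest: arg_cong[where f = card])
  have "(\<Sum>T\<in>Pow {..<N}. ?f T) = (\<Sum>T\<in>(\<lambda>j. {..<j}) ` {..N}. ?f T)"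
  proof (rule sum.mono_neutral_right)
    show "\<forall>T\<in>Pow {..<N} - (\<lambda>j. {..<j}) ` {..N}. ?f T = 0"
    proof
      fix T assume T: "T \<in> Pow {..<N} - (\<lambda>j. {..<j}) ` {..N}"
      have "\<exists>l. Suc l \<in> T \<and> l \<notin> T"
      proof (rule ccontr)
        assume H: "\<not> ?thesis"
        \<comment> \<open>Without such a gap \<open>T\<close> is closed downwards, hence empty or
          the initial segment ending at its maximum.\<close>
        have down: "b \<in> T \<Longrightarrow> b - d \<in> T" for b d
        proof (induction d)
          case (Suc d)
          then show ?case using H by (cases "b - d") (auto simp: diff_Suc)
        qed simp
        have fin: "finite T" using T finite_subset by blast
        show False
        proof (cases "T = {}")
          case True
          then show False using T by (auto simp: image_iff)
        next
          case False
          have "T = {..<Suc (Max T)}"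
          proof (intro equalityI subsetI)
            fix b assume "b \<in> {..<Suc (Max T)}"
            then have "b = Max T - (Max T - b)" by simp
            then show "b \<in> T" using down[OF Max_in[OF fin False]] by metis
          qed (use fin in \<open>auto simp: less_Suc_eq_le\<close>)
          moreover have "Max T < N" using T Max_in[OF fin False] by auto
          ultimately show False using T by (metis DiffD2 Suc_leI atMost_iff image_eqI)
        qed
      qed
      then obtain l where l: "Suc l \<in> T" "l \<notin> T" by blast
      then have "Suc l < N" using T by auto
      with l have "A (\<lambda>l. (if l \<in> T then 1 else 0) - int l) = 0"
        by (intro A_eq_0[of l "Suc l"]) auto
      then show "?f T = 0" by simp
    qed
  qed auto
  also have "\<dots> = (\<Sum>j\<le>N. ?f {..<j})"
    by (simp add: sum.reindex[OF inj])
  also have "\<dots> = (\<Sum>j\<le>N. (- Q) ^ j * A (front j 0))"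
    by (simp add: front_def[abs_def])
  finally show ?thesis using sum_front by simp
qed

end

section \<open>The Vandermonde product and the Weyl denominator\<close>

definition vandermonde :: "nat \<Rightarrow> (nat \<Rightarrow> complex) \<Rightarrow> complex" where
  "vandermonde n t = (\<Prod>b<n. \<Prod>a<b. t b - t a)"

lemma vandermonde_eq_0: "a < n \<Longrightarrow> b < n \<Longrightarrow> a \<noteq> b \<Longrightarrow> t a = t b \<Longrightarrow> vandermonde n t = 0"
proof (induction a b rule: linorder_wlog)
  case (le a b)
  then have "a < b" by simp
  with le have "(\<Prod>a<b. t b - t a) = 0"
    by (intro prod_zero) (auto intro!: bexI[of _ a])
  with le show ?case unfolding vandermonde_def
    by (metis (mono_tags, lifting) finite_lessThan lessThan_iff prod_zero)
next
  case (sym a b)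
  then show ?case by metis
qed

text \<open>With the last node as an unknown \<open>z\<close>, Laplace expansion makes the
  determinant a polynomial of degree at most \<open>n\<close>, whose coefficient at \<open>n\<close>
  is the smaller Vandermonde product and which vanishes at the other nodes. Counting zeros needs
  distinct nodes; otherwise both sides are 0.\<close>

lemma det_vandermonde: "det (mat n n (\<lambda>(i, j). t j ^ i)) = vandermonde n t"
proof (induction n)
  case 0
  then show ?case by (simp add: vandermonde_def)
next
  case (Suc n)
  define A where "A z = mat (Suc n) (Suc n) (\<lambda>(i, j). (if j = n then z else t j) ^ i)" for z
  have A_carrier: "A z \<in> carrier_mat (Suc n) (Suc n)" for z by (simp add: A_def)
  define C where "C i = cofactor (A 0) i n" for i
  define P where "P = (\<Sum>i<Suc n. Polynomial.monom (C i) i)"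
  have del: "mat_delete (A z) i n = mat_delete (A 0) i n" if "i < Suc n" for i z
    by (rule eq_matI) (use that in \<open>auto simp: A_def mat_delete_def\<close>)
  have det_A: "det (A z) = poly P z" for z
  proof -
    have "det (A z) = (\<Sum>i<Suc n. A z $$ (i, n) * cofactor (A z) i n)"
      by (rule laplace_expansion_column[OF A_carrier]) simp
    also have "\<dots> = (\<Sum>i<Suc n. z ^ i * C i)"
    proof (rule sum.cong[OF refl])
      fix i assume "i \<in> {..<Suc n}"
      then have "cofactor (A z) i n = C i" "A z $$ (i, n) = z ^ i"
        using del[of i z] by (simp_all add: C_def cofactor_def) (simp add: A_def)
      then show "A z $$ (i, n) * cofactor (A z) i n = z ^ i * C i" by simp
    qed
    also have "\<dots> = poly P z" by (simp only: P_def poly_sum poly_monom mult.commute)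
    finally show ?thesis .
  qed
  have "mat_delete (A 0) n n = mat n n (\<lambda>(i, j). t j ^ i)"
    by (rule eq_matI) (auto simp: A_def mat_delete_def)
  then have Cn: "C n = vandermonde n t" using Suc.IH by (simp add: C_def cofactor_def)
  have An: "A (t n) = mat (Suc n) (Suc n) (\<lambda>(i, j). t j ^ i)"
    by (rule eq_matI) (auto simp: A_def less_Suc_eq)
  show ?case
  proof (cases "inj_on t {..<n}")
    case True
    define Q where "Q = Polynomial.smult (vandermonde n t) (\<Prod>a<n. [:- t a, 1:])"
    have deg: "Polynomial.degree (\<Prod>a<n. [:- t a, 1:]) = n"
      by (subst degree_prod_eq_sum_degree) auto
    have lead: "lead_coeff (\<Prod>a<n. [:- t a, 1:]) = 1"
      by (subst lead_coeff_prod) auto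
    have "P = Q"
    proof (rule poly_eqI_degree_lead_coeff[where n = n and A = "t ` {..<n}"])
      show "Polynomial.coeff P n = Polynomial.coeff Q n"
        using lead by (simp add: P_def Q_def coeff_sum Cn deg)
      show "card (t ` {..<n}) \<ge> n" using card_image[OF True] by simp
      show "Polynomial.degree P \<le> n" unfolding P_def
        by (intro degree_sum_le order_trans[OF degree_monom_le]) auto
      show "Polynomial.degree Q \<le> n" using deg by (simp add: Q_def)
      fix z assume "z \<in> t ` {..<n}"
      then obtain a where a: "a < n" "z = t a" by auto
      have "det (A z) = 0"
        by (rule det_identical_columns[OF A_carrier, of a n])
           (use a in \<open>auto intro!: eq_vecI simp: A_def\<close>)
      moreover have "poly Q z = 0" using a by (auto simp: Q_def poly_prod)
      ultimately show "poly P z = poly Q z" by (simp add: det_A)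
    qed
    then have "poly P (t n) = vandermonde (Suc n) t"
      by (simp add: Q_def poly_prod vandermonde_def)
    then show ?thesis using det_A[of "t n"] An by simp
  next
    case False
    then obtain a b where ab: "a < n" "b < n" "a \<noteq> b" "t a = t b"
      by (auto simp: inj_on_def)
    have "det (mat (Suc n) (Suc n) (\<lambda>(i, j). t j ^ i)) = 0"
      by (rule det_identical_columns[of _ "Suc n" a b])
         (use ab in \<open>auto intro!: eq_vecI\<close>)
    then show ?thesis using vandermonde_eq_0[of a "Suc n" b t] ab by simp
  qed
qed

lemma vandermonde_Leibniz:
  "vandermonde n t = (\<Sum>p | p permutes {..<n}. of_int (sign p) * (\<Prod>i<n. t (p i) ^ i))"
proof -
  have "vandermonde n t = det (mat n n (\<lambda>(i, j). t j ^ i))" by (rule det_vandermonde[symmetric])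
  also have "\<dots> = (\<Sum>p | p permutes {0..<n}. of_int (sign p) * (\<Prod>i = 0..<n. t (p i) ^ i))"
  proof (rule trans[OF det_def'[OF mat_carrier]], rule sum.cong[OF refl])
    fix p assume "p \<in> {p. p permutes {0..<n}}"
    then have "p i < n" if "i < n" for i using permutes_in_image[of p "{0..<n}" i] that by simp
    then show "of_int (sign p) * (\<Prod>i = 0..<n. mat n n (\<lambda>(i, j). t j ^ i) $$ (i, p i)) =
        of_int (sign p) * (\<Prod>i = 0..<n. t (p i) ^ i)"
      by simp
  qed
  finally show ?thesis by (simp add: atLeast0LessThan)
qed

lemma vandermonde_permute:
  assumes p: "p permutes {..<n}"
  shows "vandermonde n (\<lambda>l. t (p l)) = of_int (sign p) * vandermonde n t"
proof -
  have fin: "finite {..<n}" by simp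
  have perm: "permutation p" "\<And>s. s permutes {..<n} \<Longrightarrow> permutation s"
    using p permutes_imp_permutation[OF fin] by auto
  have "of_int (sign p) * vandermonde n t =
      (\<Sum>s | s permutes {..<n}. of_int (sign p) * (of_int (sign s) * (\<Prod>i<n. t (s i) ^ i)))"
    unfolding vandermonde_Leibniz by (rule sum_distrib_left)
  also have "\<dots> = (\<Sum>s | s permutes {..<n}. of_int (sign p) * (of_int (sign (p \<circ> s)) * (\<Prod>i<n. t ((p \<circ> s) i) ^ i)))"
    by (rule setum_permutations_compose_left[OF p])
  also have "\<dots> = (\<Sum>s | s permutes {..<n}. of_int (sign s) * (\<Prod>i<n. t (p (s i)) ^ i))"
  proof (rule sum.cong[OF refl])
    fix s assume "s \<in> {s. s permutes {..<n}}"
    then have "sign (p \<circ> s) = sign p * sign s" using perm by (intro sign_compose) auto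
    moreover have "sign p * sign p = 1" by (rule sign_idempotent)
    ultimately have "of_int (sign p) * of_int (sign (p \<circ> s)) = (of_int (sign s) :: complex)"
      by (metis mult.assoc mult_1 of_int_mult)
    then show "of_int (sign p) * (of_int (sign (p \<circ> s)) * (\<Prod>i<n. t ((p \<circ> s) i) ^ i)) =
       of_int (sign s) * (\<Prod>i<n. t (p (s i)) ^ i)"
      by (simp flip: mult.assoc)
  qed
  finally show ?thesis unfolding vandermonde_Leibniz by simp
qed

lemma prod_off_diagonal:
  fixes n :: nat
  shows "(\<Prod>i<n. \<Prod>j\<in>{..<n} - {i}. h i j) = (\<Prod>b<n. \<Prod>a<b. h a b * h b a :: 'a :: comm_monoid_mult)"
proof (induction n)
  case (Suc n)
  have "(\<Prod>i<Suc n. \<Prod>j\<in>{..<Suc n} - {i}. h i j) =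
      (\<Prod>i<n. h i n * (\<Prod>j\<in>{..<n} - {i}. h i j)) * (\<Prod>j<n. h n j)"
  proof -
    have "{..<Suc n} - {i} = insert n ({..<n} - {i})" if "i < n" for i using that by auto
    then have "(\<Prod>j\<in>{..<Suc n} - {i}. h i j) = h i n * (\<Prod>j\<in>{..<n} - {i}. h i j)" if "i < n" for i
      using that by simp
    moreover have "{..<Suc n} - {n} = {..<n}" by auto
    ultimately show ?thesis by simp
  qed
  also have "\<dots> = (\<Prod>b<Suc n. \<Prod>a<b. h a b * h b a)"
    using Suc.IH by (simp add: prod.distrib mult_ac)
  finally show ?case .
qed simp

lemma prod_off_diagonal_permute:
  fixes n :: nat
  assumes p: "p permutes {..<n}"
  shows "(\<Prod>i<n. \<Prod>j\<in>{..<n} - {i}. h (p i) (p j)) = (\<Prod>i<n. \<Prod>j\<in>{..<n} - {i}. h i j :: 'a :: comm_monoid_mult)"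
proof -
  have "(\<Prod>j\<in>{..<n} - {i}. h (p i) (p j)) = (\<Prod>j\<in>{..<n} - {p i}. h (p i) j)" if "i < n" for i
  proof -
    have "p ` ({..<n} - {i}) = {..<n} - {p i}"
      using p by (simp add: image_set_diff permutes_inj permutes_image)
    moreover have "inj_on p ({..<n} - {i})" using permutes_inj_on[OF p] .
    ultimately show ?thesis using prod.reindex[of p "{..<n} - {i}" "h (p i)"] by simp
  qed
  then have "(\<Prod>i<n. \<Prod>j\<in>{..<n} - {i}. h (p i) (p j)) = (\<Prod>i<n. (\<lambda>i. \<Prod>j\<in>{..<n} - {i}. h i j) (p i))"
    by (intro prod.cong[OF refl]) simp
  also have "\<dots> = (\<Prod>i<n. \<Prod>j\<in>{..<n} - {i}. h i j)"
    using prod.permute[OF p, of "\<lambda>i. \<Prod>j\<in>{..<n} - {i}. h i j"] by (simp add: o_def)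
  finally show ?thesis .
qed

text \<open>This is v (u/v; q) (q v/u; q), up to v and (q; q) a Jacobi theta function in u/v. In
  this normalisation it is exactly antisymmetric and homogeneous of degree 1.\<close>

definition theta_pair :: "complex \<Rightarrow> complex \<Rightarrow> complex \<Rightarrow> complex" where
  "theta_pair q u v = (v - u) * (qpoch_inf (q * (u / v)) q * qpoch_inf (q * (v / u)) q)"

text \<open>Up to a power of (q; q) and a monomial, the Weyl-Kac denominator of affine type
  A.\<close>

definition weyl_den :: "nat \<Rightarrow> complex \<Rightarrow> (nat \<Rightarrow> complex) \<Rightarrow> complex" where
  "weyl_den n q s = (\<Prod>b<n. \<Prod>a<b. theta_pair q (s a) (s b))"

lemma weyl_den_cong: "(\<And>l. l < n \<Longrightarrow> s l = s' l) \<Longrightarrow> weyl_den n q s = weyl_den n q s'"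
  unfolding weyl_den_def by (intro prod.cong) auto

lemma weyl_den_Suc: "weyl_den (Suc n) q s = weyl_den n q s * (\<Prod>a<n. theta_pair q (s a) (s n))"
  by (simp add: weyl_den_def)

lemma weyl_den_eq:
  "weyl_den n q s = vandermonde n s * (\<Prod>i<n. \<Prod>j\<in>{..<n} - {i}. qpoch_inf (q * (s i / s j)) q)"
  unfolding prod_off_diagonal weyl_den_def vandermonde_def theta_pair_def by (simp add: prod.distrib)

lemma weyl_den_permute:
  assumes "p permutes {..<n}"
  shows "weyl_den n q (\<lambda>l. s (p l)) = of_int (sign p) * weyl_den n q s"
  unfolding weyl_den_eq vandermonde_permute[OF assms]
    prod_off_diagonal_permute[OF assms, of "\<lambda>i j. qpoch_inf (q * (s i / s j)) q"] by simp

text \<open>Peeling the first factor off both products of a pair gives (1 - u/v)(1 - v/u) = (v -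
  u)(1/v - 1/u). The first factor completes a theta function, the second goes into the polynomial to
  be expanded by Leibniz.\<close>

lemma prod_qpoch_eq_weyl_den:
  assumes q: "norm q < 1" and s: "\<And>j. j < n \<Longrightarrow> s j \<noteq> 0"
  shows "(\<Prod>i<n. \<Prod>j\<in>{..<n} - {i}. qpoch_inf (s i / s j) q) = weyl_den n q s * vandermonde n (\<lambda>j. inverse (s j))"
proof -
  have "qpoch_inf (u / v) q * qpoch_inf (v / u) q = theta_pair q u v * (inverse v - inverse u)"
    if "u \<noteq> 0" "v \<noteq> 0" for u v
  proof -
    have "qpoch_inf (u / v) q * qpoch_inf (v / u) q =
        (1 - u / v) * (1 - v / u) * (qpoch_inf (q * (u / v)) q * qpoch_inf (q * (v / u)) q)"
      using qpoch_inf_rec[OF q, of "u / v"] qpoch_inf_rec[OF q, of "v / u"] by (simp add: mult_ac)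
    also have "(1 - u / v) * (1 - v / u) = (v - u) * (inverse v - inverse u)"
      using that by (simp add: field_simps)
    finally show ?thesis by (simp add: theta_pair_def mult_ac)
  qed
  then have "(\<Prod>b<n. \<Prod>a<b. qpoch_inf (s a / s b) q * qpoch_inf (s b / s a) q) =
      (\<Prod>b<n. \<Prod>a<b. theta_pair q (s a) (s b) * (inverse (s b) - inverse (s a)))"
    using s by (intro prod.cong) auto
  then show ?thesis
    unfolding prod_off_diagonal weyl_den_def vandermonde_def by (simp add: prod.distrib)
qed

lemma theta_pair_commute: "theta_pair q v u = - theta_pair q u v"
  by (simp add: theta_pair_def algebra_simps)

text \<open>The prefactor \<open>v - q * u\<close> supplies the leading factor missing from one
  product, while the other product yields \<open>1 - v / u\<close>, which restores
  \<open>v - u\<close>.\<close>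

lemma theta_pair_shift:
  assumes q: "norm q < 1" "q \<noteq> 0" and uv: "u \<noteq> 0" "v \<noteq> 0"
  shows "theta_pair q (q * u) v = - (v / u) * theta_pair q u v"
proof -
  have "theta_pair q (q * u) v = (v - q * u) * (qpoch_inf (q * (u / v) * q) q * qpoch_inf (v / u) q)"
    using q by (simp add: theta_pair_def mult_ac)
  also have "qpoch_inf (v / u) q = (1 - v / u) * qpoch_inf (q * (v / u)) q"
    using qpoch_inf_rec[OF q(1), of "v / u"] by (simp add: mult_ac)
  also have "v - q * u = v * (1 - q * (u / v))"
    using uv by (simp add: field_simps)
  also have "v * (1 - q * (u / v)) * (qpoch_inf (q * (u / v) * q) q * ((1 - v / u) * qpoch_inf (q * (v / u)) q))
     = v * (1 - v / u) * (((1 - q * (u / v)) * qpoch_inf (q * (u / v) * q) q) * qpoch_inf (q * (v / u)) q)"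
    by (simp only: mult_ac)
  also have "(1 - q * (u / v)) * qpoch_inf (q * (u / v) * q) q = qpoch_inf (q * (u / v)) q"
    by (rule qpoch_inf_rec[OF q(1), symmetric])
  also have "v * (1 - v / u) = - (v / u) * (v - u)"
    using uv by (simp add: field_simps)
  finally show ?thesis by (simp add: theta_pair_def)
qed

lemma theta_pair_shift':
  assumes "norm q < 1" "q \<noteq> 0" "u \<noteq> 0" "v \<noteq> 0"
  shows "theta_pair q v (q * u) = - (v / u) * theta_pair q v u"
  using theta_pair_shift[OF assms] theta_pair_commute[of q v u] theta_pair_commute[of q v "q * u"] by simp

lemma weyl_den_shift:
  assumes q: "norm q < 1" "q \<noteq> 0" and i: "i < n" and s: "\<And>j. s j \<noteq> 0"
  shows "weyl_den n q (s(i := q * s i)) = (\<Prod>j\<in>{..<n} - {i}. - (s j / s i)) * weyl_den n q s"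
proof -
  \<comment> \<open>Only pairs containing \<open>i\<close> change; by antisymmetry the multiplier
    does not depend on which side of the pair \<open>i\<close> stands.\<close>
  define c where "c a b = (if a = i then - (s b / s i) else if b = i then - (s a / s i) else 1)" for a b
  have "theta_pair q ((s(i := q * s i)) a) ((s(i := q * s i)) b) = c a b * theta_pair q (s a) (s b)"
    if ab: "a < b" for a b
  proof -
    consider "a = i" "b \<noteq> i" | "b = i" "a \<noteq> i" | "a \<noteq> i" "b \<noteq> i" using ab by force
    then show ?thesis
    proof cases
      case 1
      then show ?thesis using theta_pair_shift[OF q s s, of i b] by (simp add: c_def)
    next
      case 2
      then show ?thesis using theta_pair_shift'[OF q s s, of a i] by (simp add: c_def)
    next
      case 3
      then show ?thesis by (simp add: c_def)
    qed
  qed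
  then have "weyl_den n q (s(i := q * s i)) = (\<Prod>b<n. \<Prod>a<b. c a b) * weyl_den n q s"
    unfolding weyl_den_def prod.distrib[symmetric] by (intro prod.cong) auto
  also have "(\<Prod>b<n. \<Prod>a<b. c a b) = (\<Prod>j\<in>{..<n} - {i}. - (s j / s i))"
  proof -
    have "(\<Prod>b<n. \<Prod>a<b. c a b) = (\<Prod>b<i. \<Prod>a<b. c a b) * (\<Prod>a<i. c a i) * (\<Prod>b\<in>{i<..<n}. \<Prod>a<b. c a b)"
    proof -
      have n: "{..<n} = {..<i} \<union> insert i {i<..<n}" using i by auto
      have "(\<Prod>b<n. \<Prod>a<b. c a b) = (\<Prod>b<i. \<Prod>a<b. c a b) * (\<Prod>b\<in>insert i {i<..<n}. \<Prod>a<b. c a b)"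
        unfolding n by (rule prod.union_disjoint) auto
      also have "(\<Prod>b\<in>insert i {i<..<n}. \<Prod>a<b. c a b) = (\<Prod>a<i. c a i) * (\<Prod>b\<in>{i<..<n}. \<Prod>a<b. c a b)"
        by (rule prod.insert) auto
      finally show ?thesis by (simp only: mult.assoc)
    qed
    also have "(\<Prod>b<i. \<Prod>a<b. c a b) = 1" by (intro prod.neutral ballI) (auto simp: c_def)
    also have "(\<Prod>a<i. c a i) = (\<Prod>a<i. - (s a / s i))" by (intro prod.cong) (auto simp: c_def)
    also have "(\<Prod>b\<in>{i<..<n}. \<Prod>a<b. c a b) = (\<Prod>b\<in>{i<..<n}. - (s b / s i))"
    proof (intro prod.cong refl)
      fix b assume b: "b \<in> {i<..<n}"
      have "(\<Prod>a<b. c a b) = (\<Prod>a<b. if a = i then - (s b / s i) else 1)"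
        using b by (intro prod.cong) (auto simp: c_def)
      then show "(\<Prod>a<b. c a b) = - (s b / s i)" using b by simp
    qed
    also have "1 * (\<Prod>a<i. - (s a / s i)) * (\<Prod>b\<in>{i<..<n}. - (s b / s i)) = (\<Prod>j\<in>{..<n} - {i}. - (s j / s i))"
    proof -
      have n: "{..<n} - {i} = {..<i} \<union> {i<..<n}" using i by auto
      show ?thesis unfolding n mult_1 by (rule prod.union_disjoint[symmetric]) auto
    qed
    finally show ?thesis .
  qed
  finally show ?thesis .
qed

lemma polyholo_theta_pair:
  assumes "norm q < 1"
  shows "polyholo (\<lambda>s. theta_pair q (s a) (s b))"
  unfolding theta_pair_def
  by (intro polyholo_mult polyholo_diff polyholo_proj polyholo_comp_ratio[of "\<lambda>z. qpoch_inf (q * z) q"]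
      holomorphic_on_compose_gen[of "\<lambda>z. q * z" _ "\<lambda>z. qpoch_inf z q" UNIV, unfolded o_def]
      holomorphic_qpoch_inf assms holomorphic_intros) auto

lemma polyholo_weyl_den: "norm q < 1 \<Longrightarrow> polyholo (weyl_den n q)"
  unfolding weyl_den_def[abs_def] by (intro polyholo_prod polyholo_theta_pair)

section \<open>Constant terms against the Weyl denominator\<close>

lemma torus_nonzero: "s \<in> torus \<Longrightarrow> s j \<noteq> 0"
  by (metis (mono_tags) mem_Collect_eq norm_zero zero_neq_one)

text \<open>The factors \<open>\<psi> j\<close> may differ between coordinates because shifting one
  variable alters just one of them.\<close>

definition weyl_int :: "nat \<Rightarrow> complex \<Rightarrow> (nat \<Rightarrow> complex \<Rightarrow> complex) \<Rightarrow> (nat \<Rightarrow> int) \<Rightarrow> complex" where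
  "weyl_int n q \<psi> e = torus_int (\<lambda>s. weyl_den n q s * (\<Prod>j<n. \<psi> j (s j) * s j powi e j))"

lemma weyl_int_cong:
  assumes "\<And>j z. j < n \<Longrightarrow> z \<noteq> 0 \<Longrightarrow> \<psi> j z = \<psi>' j z" and "\<And>j. j < n \<Longrightarrow> e j = e' j"
  shows "weyl_int n q \<psi> e = weyl_int n q \<psi>' e'"
  unfolding weyl_int_def
  by (intro torus_int_cong arg_cong2[of _ _ _ _ "(*)"] prod.cong) (use assms in \<open>auto simp: torus_nonzero\<close>)

lemma polyholo_weyl_integrand:
  assumes "norm q < 1" and "\<And>j. j < n \<Longrightarrow> \<psi> j holomorphic_on -{0}"
  shows "polyholo (\<lambda>s. weyl_den n q s * (\<Prod>j<n. \<psi> j (s j) * s j powi e j))"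
  by (intro polyholo_mult polyholo_weyl_den polyholo_prod polyholo_coord polyholo_power_int)
     (use assms in auto)

text \<open>The multiplier of the Weyl denominator raises each of the other \<open>n - 1\<close>
  exponents by one and lowers \<open>e i\<close> by \<open>n - 1\<close>. Writing this as +1
  everywhere and \<open>- n\<close> at \<open>i\<close> exposes the common shift.\<close>

lemma weyl_int_shift:
  assumes q: "norm q < 1" "q \<noteq> 0" and i: "i < n" and \<psi>: "\<And>j. j < n \<Longrightarrow> \<psi> j holomorphic_on -{0}"
  shows "weyl_int n q \<psi> e = (-1) ^ (n - 1) * q powi e i *
    weyl_int n q (\<psi>(i := \<lambda>z. \<psi> i (q * z))) (\<lambda>l. e l + 1 - (if l = i then int n else 0))"
proof -
  let ?F = "\<lambda>s. weyl_den n q s * (\<Prod>j<n. \<psi> j (s j) * s j powi e j)"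
  let ?R = "{..<n} - {i}"
  let ?e = "\<lambda>l. e l + 1 - (if l = i then int n else 0)"
  let ?G = "\<lambda>s. weyl_den n q s * (\<Prod>j<n. (\<psi>(i := \<lambda>z. \<psi> i (q * z))) j (s j) * s j powi ?e j)"
  have split: "(\<Prod>j<n. h j) = h i * (\<Prod>j\<in>?R. h j)" for h :: "nat \<Rightarrow> complex"
    using i by (intro prod.remove) auto
  have "weyl_int n q \<psi> e = torus_int (\<lambda>s. ?F (s(i := q * s i)))"
    unfolding weyl_int_def
    by (rule torus_int_upd_cmult[OF polyholo_weyl_integrand[OF q(1) \<psi>] q(2), symmetric])
  also have "\<dots> = torus_int (\<lambda>s. ((-1) ^ (n - 1) * q powi e i) * ?G s)"
  proof (rule torus_int_cong)
    fix s :: "nat \<Rightarrow> complex" assume s: "s \<in> torus"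
    note nz = torus_nonzero[OF s]
    have "?F (s(i := q * s i)) = (\<Prod>j\<in>?R. - (s j / s i)) * weyl_den n q s *
        (\<psi> i (q * s i) * (q * s i) powi e i * (\<Prod>j\<in>?R. \<psi> j (s j) * s j powi e j))"
      unfolding weyl_den_shift[OF q i, of s, OF nz] split by simp
    also have "\<dots> = weyl_den n q s * (\<psi> i (q * s i) * (q * s i) powi e i) *
        (\<Prod>j\<in>?R. - (s j / s i) * (\<psi> j (s j) * s j powi e j))"
      by (simp only: prod.distrib mult_ac)
    also have "(\<Prod>j\<in>?R. - (s j / s i) * (\<psi> j (s j) * s j powi e j)) =
        (\<Prod>j\<in>?R. - inverse (s i) * (\<psi> j (s j) * s j powi (e j + 1)))"
      by (intro prod.cong) (auto simp: power_int_add nz divide_inverse)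
    also have "\<dots> = (- inverse (s i)) ^ (n - 1) * (\<Prod>j\<in>?R. \<psi> j (s j) * s j powi (e j + 1))"
      by (subst prod.distrib) (use i in simp)
    also have "(- inverse (s i)) ^ (n - 1) = (-1) ^ (n - 1) * s i powi (1 - int n)"
    proof -
      have "s i powi (1 - int n) = s i powi (- int (n - 1))" using i by (simp add: of_nat_diff)
      also have "\<dots> = inverse (s i) ^ (n - 1)" by (simp only: power_int_minus power_int_of_nat power_inverse)
      finally show ?thesis by (simp add: power_minus[of "inverse (s i)"])
    qed
    also have "weyl_den n q s * (\<psi> i (q * s i) * (q * s i) powi e i) *
        ((-1) ^ (n - 1) * s i powi (1 - int n) * (\<Prod>j\<in>?R. \<psi> j (s j) * s j powi (e j + 1))) =
        ((-1) ^ (n - 1) * q powi e i) * (weyl_den n q s * ((\<psi> i (q * s i) * (s i powi e i * s i powi (1 - int n))) *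
           (\<Prod>j\<in>?R. \<psi> j (s j) * s j powi (e j + 1))))"
      by (simp only: power_int_mult_distrib mult_ac)
    also have "s i powi e i * s i powi (1 - int n) = s i powi (e i + 1 - int n)"
      using power_int_add[of "s i" "e i" "1 - int n"] nz[of i] by (simp add: add_diff_eq)
    also have "(\<Prod>j\<in>?R. \<psi> j (s j) * s j powi (e j + 1)) =
        (\<Prod>j\<in>?R. (\<psi>(i := \<lambda>z. \<psi> i (q * z))) j (s j) * s j powi ?e j)"
      by (intro prod.cong) auto
    finally show "?F (s(i := q * s i)) = ((-1) ^ (n - 1) * q powi e i) * ?G s"
      unfolding split[of "\<lambda>j. (\<psi>(i := \<lambda>z. \<psi> i (q * z))) j (s j) * s j powi ?e j"]
      by (simp only: fun_upd_same if_True simp_thms)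
  qed
  also have "\<dots> = ((-1) ^ (n - 1) * q powi e i) * torus_int ?G" by (rule torus_int_cmult)
  finally show ?thesis unfolding weyl_int_def .
qed

text \<open>Once a slot is expressed as the common factor times a binomial, this leads back to
  integrals with equal factors and changed exponents.\<close>

lemma weyl_int_linear:
  assumes q: "norm q < 1" and i: "i < n" and \<psi>: "\<And>j. j < n \<Longrightarrow> \<psi> j holomorphic_on -{0}"
  shows "weyl_int n q (\<psi>(i := \<lambda>z. \<psi> i z * (\<alpha> * z powi a + \<beta> * z powi b))) e =
    \<alpha> * weyl_int n q \<psi> (e(i := e i + a)) + \<beta> * weyl_int n q \<psi> (e(i := e i + b))"
proof -
  let ?F = "\<lambda>e s. weyl_den n q s * (\<Prod>j<n. \<psi> j (s j) * s j powi e j)"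
  let ?R = "{..<n} - {i}"
  have split: "(\<Prod>j<n. h j) = h i * (\<Prod>j\<in>?R. h j)" for h :: "nat \<Rightarrow> complex"
    using i by (intro prod.remove) auto
  have bounded: "torus_bounded (?F e)" for e
    by (intro torus_bounded_polyholo polyholo_weyl_integrand q \<psi>)
  have bounded': "torus_bounded (\<lambda>s. c * ?F e s)" for c e
    by (intro torus_bounded_polyholo polyholo_cmult polyholo_weyl_integrand q \<psi>)
  have "weyl_int n q (\<psi>(i := \<lambda>z. \<psi> i z * (\<alpha> * z powi a + \<beta> * z powi b))) e =
      torus_int (\<lambda>s. \<alpha> * ?F (e(i := e i + a)) s + \<beta> * ?F (e(i := e i + b)) s)"
    unfolding weyl_int_def
  proof (rule torus_int_cong)
    fix s :: "nat \<Rightarrow> complex" assume s: "s \<in> torus"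
    have R: "(\<Prod>j\<in>?R. f j * s j powi (e(i := c)) j) = (\<Prod>j\<in>?R. f j * s j powi e j)" for f c
      by (intro prod.cong) auto
    have R': "(\<Prod>j\<in>?R. (\<psi>(i := g)) j (s j) * s j powi e j) = (\<Prod>j\<in>?R. \<psi> j (s j) * s j powi e j)" for g
      by (intro prod.cong) auto
    show "weyl_den n q s * (\<Prod>j<n. (\<psi>(i := \<lambda>z. \<psi> i z * (\<alpha> * z powi a + \<beta> * z powi b))) j (s j) * s j powi e j) =
        \<alpha> * ?F (e(i := e i + a)) s + \<beta> * ?F (e(i := e i + b)) s"
      unfolding split R R' using torus_nonzero[OF s, of i]
      by (simp add: power_int_add algebra_simps)
  qed
  also have "\<dots> = \<alpha> * weyl_int n q \<psi> (e(i := e i + a)) + \<beta> * weyl_int n q \<psi> (e(i := e i + b))"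
    unfolding weyl_int_def by (simp only: torus_int_add[OF bounded' bounded'] torus_int_cmult)
  finally show ?thesis .
qed

lemma weyl_int_permute:
  assumes q: "norm q < 1" and \<phi>: "\<phi> holomorphic_on -{0}" and p: "p permutes {..<n}"
  shows "weyl_int n q (\<lambda>_. \<phi>) (\<lambda>l. e (p l)) = of_int (sign p) * weyl_int n q (\<lambda>_. \<phi>) e"
proof -
  let ?F = "\<lambda>s. weyl_den n q s * (\<Prod>j<n. \<phi> (s j) * s j powi e (p j))"
  have "weyl_int n q (\<lambda>_. \<phi>) (\<lambda>l. e (p l)) = torus_int (\<lambda>s. ?F (\<lambda>l. s (p l)))"
    unfolding weyl_int_def
    by (rule torus_int_reindex[symmetric])
       (auto intro!: torus_bounded_polyholo polyholo_weyl_integrand q \<phi> permutes_inj[OF p])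
  also have "\<dots> = torus_int (\<lambda>s. of_int (sign p) * (weyl_den n q s * (\<Prod>j<n. \<phi> (s j) * s j powi e j)))"
    using prod.permute[OF p, of "\<lambda>j. \<phi> (s j) * s j powi e j" for s]
    by (intro torus_int_cong) (simp add: weyl_den_permute[OF p] o_def)
  also have "\<dots> = of_int (sign p) * weyl_int n q (\<lambda>_. \<phi>) e"
    unfolding weyl_int_def by (rule torus_int_cmult)
  finally show ?thesis .
qed

lemma alternating_weyl_int:
  assumes q: "norm q < 1" and \<phi>: "\<phi> holomorphic_on -{0}"
  shows "alternating_functional n (weyl_int n q (\<lambda>_. \<phi>))"
proof
  show "weyl_int n q (\<lambda>_. \<phi>) e = weyl_int n q (\<lambda>_. \<phi>) e'" if "\<And>l. l < n \<Longrightarrow> e l = e' l" for e e'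
    by (rule weyl_int_cong) (use that in auto)
  show "weyl_int n q (\<lambda>_. \<phi>) (\<lambda>l. e (Transposition.transpose i j l)) = - weyl_int n q (\<lambda>_. \<phi>) e"
    if "i < n" "j < n" "i \<noteq> j" for e i j
    using weyl_int_permute[OF q \<phi> permutes_swap_id[of i "{..<n}" j], of e] that by (simp add: sign_swap_id)
qed

text \<open>Slot \<open>i\<close> is given the extra factor \<open>1 - (x / r) * z\<close>.
  Replacing z by q z turns it into \<open>1 - r * z * x\<close>, the leading factor which the
  shifted product has lost, so that slot \<open>i\<close> agrees with the others again.\<close>

lemma wilson_weyl_int:
  assumes n: "n > 0" and q: "norm q < 1" "q \<noteq> 0" and r: "r\<^sup>2 = q" and x: "x \<noteq> 0"
  shows "wilson_functional n (weyl_int n q (\<lambda>_ z. qpoch_inf (r * z * x) q)) x q r"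
proof -
  define \<phi> where "\<phi> z = qpoch_inf (r * z * x) q" for z
  have hol: "\<phi> holomorphic_on A" for A
    unfolding \<phi>_def
    by (rule holomorphic_on_compose_gen[of "\<lambda>z. r * z * x" _ "\<lambda>z. qpoch_inf z q" UNIV, unfolded o_def])
       (auto intro!: holomorphic_intros holomorphic_qpoch_inf q)
  interpret alternating_functional n "weyl_int n q (\<lambda>_. \<phi>)"
    by (rule alternating_weyl_int[OF q(1) hol])
  have r0: "r \<noteq> 0" using r q by auto
  have "wilson_functional n (weyl_int n q (\<lambda>_. \<phi>)) x q r"
  proof
    fix i and e :: "nat \<Rightarrow> int" assume i: "i < n"
    define \<psi> where "\<psi> = (\<lambda>_::nat. \<phi>)(i := \<lambda>z. \<phi> z * (1 * z powi 0 + (- (x / r)) * z powi 1))"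
    have \<psi>: "\<psi> j holomorphic_on -{0}" for j
      unfolding \<psi>_def by (cases "j = i") (auto intro!: holomorphic_intros hol)
    have "\<psi> i (q * z) = \<phi> z" for z
    proof -
      have "x / r * (q * z) = r * z * x" using r0 by (simp flip: r add: power2_eq_square)
      moreover have "\<phi> z = (1 - r * z * x) * \<phi> (q * z)"
        unfolding \<phi>_def using qpoch_inf_rec[OF q(1), of "r * z * x"] by (simp add: mult_ac)
      ultimately show ?thesis by (simp add: \<psi>_def)
    qed
    then have upd: "\<psi>(i := \<lambda>z. \<psi> i (q * z)) = (\<lambda>_. \<phi>)"
      by (auto simp: \<psi>_def fun_eq_iff)
    have "weyl_int n q (\<lambda>_. \<phi>) e - x / r * weyl_int n q (\<lambda>_. \<phi>) (e(i := e i + 1)) = weyl_int n q \<psi> e"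
      unfolding \<psi>_def by (subst weyl_int_linear[OF q(1) i, where \<psi> = "\<lambda>_. \<phi>", OF hol]) simp
    also have "\<dots> = (-1) ^ (n - 1) * q powi e i *
        weyl_int n q (\<lambda>_. \<phi>) (\<lambda>l. e l + 1 - (if l = i then int n else 0))"
      using weyl_int_shift[OF q i, where \<psi> = \<psi> and e = e, OF \<psi>] unfolding upd .
    finally show "weyl_int n q (\<lambda>_. \<phi>) e - x / r * weyl_int n q (\<lambda>_. \<phi>) (e(i := e i + 1)) = \<dots>" .
  qed (use assms in auto)
  then show ?thesis unfolding \<phi>_def .
qed

section \<open>The constant term of the Weyl denominator\<close>

definition weyl_const :: "nat \<Rightarrow> complex \<Rightarrow> complex" where
  "weyl_const n q = weyl_int n q (\<lambda>_ _. 1) (\<lambda>l. - int l)"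

lemma theta_pair_scale: "c \<noteq> 0 \<Longrightarrow> theta_pair q (c * u) (c * v) = c * theta_pair q u v"
  by (simp add: theta_pair_def algebra_simps)

text \<open>Index \<open>b\<close> is the larger one in \<open>b\<close> pairs, hence
  \<open>c ^ b\<close>, which the exponent \<open>- b\<close> cancels.\<close>

lemma weyl_den_scale:
  assumes c: "c \<noteq> 0"
  shows "weyl_den n q (\<lambda>l. c * s l) * (\<Prod>j<n. f j * (c * s j) powi (- int j)) =
    weyl_den n q s * (\<Prod>j<n. f j * s j powi (- int j))"
proof -
  have "weyl_den n q (\<lambda>l. c * s l) = (\<Prod>b<n. c ^ b) * weyl_den n q s"
    unfolding weyl_den_def theta_pair_scale[OF c] by (simp add: prod.distrib)
  moreover have "(\<Prod>b<n. c ^ b) * (\<Prod>j<n. f j * (c * s j) powi (- int j)) = (\<Prod>j<n. f j * s j powi (- int j))"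
    unfolding prod.distrib[symmetric]
    using c by (intro prod.cong) (auto simp: power_int_mult_distrib power_int_minus power_mult_distrib)
  ultimately show ?thesis by (simp add: mult_ac)
qed

lemma weyl_int_staircase_scale:
  assumes q: "norm q < 1" and \<phi>: "\<phi> holomorphic_on -{0}" and c: "c \<noteq> 0"
  shows "weyl_int n q (\<lambda>_ z. \<phi> (c * z)) (\<lambda>l. - int l) = weyl_int n q (\<lambda>_. \<phi>) (\<lambda>l. - int l)"
proof -
  let ?F = "\<lambda>s. weyl_den n q s * (\<Prod>j<n. \<phi> (s j) * s j powi (- int j))"
  have "weyl_int n q (\<lambda>_. \<phi>) (\<lambda>l. - int l) = torus_int (\<lambda>s. ?F (\<lambda>j. if j < n then c * s j else s j))"
    unfolding weyl_int_def
    by (rule polyholo_scale(2)[OF polyholo_weyl_integrand[OF q \<phi>] c, symmetric])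
  also have "\<dots> = torus_int (\<lambda>s. weyl_den n q s * (\<Prod>j<n. \<phi> (c * s j) * s j powi (- int j)))"
  proof (rule torus_int_cong)
    fix s :: "nat \<Rightarrow> complex"
    have "?F (\<lambda>j. if j < n then c * s j else s j) =
        weyl_den n q (\<lambda>l. c * s l) * (\<Prod>j<n. \<phi> (c * s j) * (c * s j) powi (- int j))"
      by (intro arg_cong2[of _ _ _ _ "(*)"] weyl_den_cong prod.cong) auto
    then show "?F (\<lambda>j. if j < n then c * s j else s j) = weyl_den n q s * (\<Prod>j<n. \<phi> (c * s j) * s j powi (- int j))"
      by (simp only: weyl_den_scale[OF c])
  qed
  finally show ?thesis unfolding weyl_int_def by simp
qed

lemma weyl_int_tendsto:
  assumes q: "norm q < 1" and \<phi>: "\<And>k. \<phi> k holomorphic_on -{0}"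
    and B: "\<And>k z. norm z = 1 \<Longrightarrow> norm (\<phi> k z) \<le> B"
    and lim: "\<And>z. norm z = 1 \<Longrightarrow> (\<lambda>k. \<phi> k z) \<longlonglongrightarrow> \<phi>' z"
  shows "(\<lambda>k. weyl_int n q (\<lambda>_. \<phi> k) e) \<longlonglongrightarrow> weyl_int n q (\<lambda>_. \<phi>') e"
proof -
  obtain C where C: "C > 0" "\<And>s. s \<in> annuli 1 \<Longrightarrow> norm (weyl_den n q s) \<le> C"
    using polyholo_bounded[OF polyholo_weyl_den[OF q], of 1 n] by auto
  show ?thesis unfolding weyl_int_def
  proof (rule torus_int_tendsto[where B = "C * B ^ n"])
    show "torus_bounded (\<lambda>s. weyl_den n q s * (\<Prod>j<n. \<phi> k (s j) * s j powi e j))" for k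
      by (intro torus_bounded_polyholo polyholo_weyl_integrand q \<phi>)
  next
    fix k and s :: "nat \<Rightarrow> complex" assume s: "s \<in> torus"
    have "norm (\<Prod>j<n. \<phi> k (s j) * s j powi e j) \<le> (\<Prod>j<n. B)"
      using s B unfolding prod_norm[symmetric]
      by (intro prod_mono) (auto simp: norm_mult norm_power_int)
    moreover have "norm (weyl_den n q s) \<le> C" using s by (intro C) (auto simp: annuli_def)
    ultimately show "norm (weyl_den n q s * (\<Prod>j<n. \<phi> k (s j) * s j powi e j)) \<le> C * B ^ n"
      using C(1) by (auto simp: norm_mult intro!: mult_mono)
  next
    fix s :: "nat \<Rightarrow> complex" assume s: "s \<in> torus"
    then show "(\<lambda>k. weyl_den n q s * (\<Prod>j<n. \<phi> k (s j) * s j powi e j)) \<longlonglongrightarrow>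
        weyl_den n q s * (\<Prod>j<n. \<phi>' (s j) * s j powi e j)"
      by (intro tendsto_intros lim) auto
  qed
qed

text \<open>Rescaling all variables by \<open>c \<rightarrow> 0\<close> does not change the integral, the staircase monomial
  having the degree opposite to that of the Weyl denominator.\<close>
lemma weyl_int_entire:
  assumes q: "norm q < 1" and h: "h holomorphic_on UNIV" "h 0 = 1"
  shows "weyl_int n q (\<lambda>_. h) (\<lambda>l. - int l) = weyl_const n q"
    and "weyl_int n q (\<lambda>_ z. h (inverse z)) (\<lambda>l. - int l) = weyl_const n q"
proof -
  have cont: "continuous_on UNIV h" using h(1) by (rule holomorphic_on_imp_continuous_on)
  have "bounded (h ` cball 0 1)"
    by (intro compact_imp_bounded compact_continuous_image continuous_on_subset[OF cont]) auto
  then obtain B where "\<forall>x\<in>h ` cball 0 1. norm x \<le> B"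
    unfolding bounded_iff by blast
  then have B: "norm (h z) \<le> B" if "norm z \<le> 1" for z using that by simp
  \<comment> \<open>Any null sequence of nonzero numbers in the unit disc would serve.\<close>
  define c where "c k = complex_of_real (inverse (real (Suc k)))" for k
  have c0: "c k \<noteq> 0" for k by (simp add: c_def del: of_nat_Suc)
  have c1: "norm (c k) \<le> 1" for k by (simp add: c_def norm_inverse inverse_le_1_iff del: of_nat_Suc)
  have "(\<lambda>k. c k) \<longlonglongrightarrow> of_real 0" unfolding c_def
    by (intro tendsto_of_real LIMSEQ_inverse_real_of_nat)
  then have "(\<lambda>k. c k * z) \<longlonglongrightarrow> 0" for z
    by (intro tendsto_mult_left_zero) simp
  moreover have "isCont h 0" using cont by (simp add: continuous_on_eq_continuous_at)
  ultimately have lim: "(\<lambda>k. h (c k * z)) \<longlonglongrightarrow> 1" for z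
    using isCont_tendsto_compose h(2) by fastforce
  have h': "h holomorphic_on A" for A using h(1) by (rule holomorphic_on_subset) simp
  have hol1: "(\<lambda>z. h (c * z)) holomorphic_on A" for c A
    by (rule holomorphic_on_compose_gen[of "\<lambda>z. c * z" _ h UNIV, unfolded o_def])
       (auto intro!: holomorphic_intros h')
  have hol2: "(\<lambda>z. h (c * inverse z)) holomorphic_on -{0}" for c
    by (rule holomorphic_on_compose_gen[of "\<lambda>z. c * inverse z" _ h UNIV, unfolded o_def])
       (auto intro!: holomorphic_intros h')
  have "(\<lambda>k. weyl_int n q (\<lambda>_ z. h (c k * z)) (\<lambda>l. - int l)) \<longlonglongrightarrow> weyl_const n q"
    unfolding weyl_const_def using c1
    by (intro weyl_int_tendsto[where B = B] q hol1 lim) (auto intro!: B simp: norm_mult)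
  then show "weyl_int n q (\<lambda>_. h) (\<lambda>l. - int l) = weyl_const n q"
    unfolding weyl_int_staircase_scale[OF q h' c0] using LIMSEQ_unique tendsto_const by blast
  have "(\<lambda>k. weyl_int n q (\<lambda>_ z. h (c k * inverse z)) (\<lambda>l. - int l)) \<longlonglongrightarrow> weyl_const n q"
    unfolding weyl_const_def using c1
    by (intro weyl_int_tendsto[where B = B] q hol2 lim) (auto intro!: B simp: norm_mult norm_inverse)
  \<comment> \<open>Here the variables are scaled up, by \<open>inverse (c k)\<close>, since
    \<open>h\<close> is evaluated at the inverse.\<close>
  moreover have "weyl_int n q (\<lambda>_ z. h (c k * inverse z)) (\<lambda>l. - int l) =
      weyl_int n q (\<lambda>_ z. h (inverse z)) (\<lambda>l. - int l)" for k
    using weyl_int_staircase_scale[OF q hol2[of 1], of "inverse (c k)" n] c0[of k] by simp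
  ultimately show "weyl_int n q (\<lambda>_ z. h (inverse z)) (\<lambda>l. - int l) = weyl_const n q"
    using LIMSEQ_unique tendsto_const by simp blast
qed

text \<open>For separately holomorphic \<open>G\<close>, multiplying coordinates by another coordinate is a rotation
  in each fibre.\<close>
lemma torus_int_twist:
  assumes G: "polyholo G" and n: "n \<le> M"
  shows "torus_bounded (\<lambda>s. G (\<lambda>j. if j < n then s j * s M else s j))"
    and "torus_int (\<lambda>s. G (\<lambda>j. if j < n then s j * s M else s j)) = torus_int G"
proof -
  have tb: "torus_bounded (\<lambda>s. G (\<lambda>j. if j < n then s j * s M else s j))" for n
  proof -
    obtain B where B: "\<forall>s\<in>torus. norm (G s) \<le> B"
      using torus_bounded_polyholo[OF G] unfolding torus_bounded_def by blast
    have "(\<lambda>s j. if j < n then s j * s M else s j) \<in> borel_seq \<rightarrow>\<^sub>M borel_seq"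
    proof (rule measurable_seq_fun)
      show "(\<lambda>s. if j < n then s j * s M else s j) \<in> borel_measurable borel_seq" for j
        by (cases "j < n") auto
    qed
    from measurable_compose[OF this polyholo_measurable[OF G]]
    have "(\<lambda>s. G (\<lambda>j. if j < n then s j * s M else s j)) \<in> borel_measurable borel_seq" .
    moreover have "\<forall>s\<in>torus. norm (G (\<lambda>j. if j < n then s j * s M else s j)) \<le> B"
    proof
      fix s :: "nat \<Rightarrow> complex" assume "s \<in> torus"
      then have "(\<lambda>j. if j < n then s j * s M else s j) \<in> torus" by (auto simp: norm_mult)
      with B show "norm (G (\<lambda>j. if j < n then s j * s M else s j)) \<le> B" by blast
    qed
    ultimately show ?thesis unfolding torus_bounded_def by blast
  qed
  then show "torus_bounded (\<lambda>s. G (\<lambda>j. if j < n then s j * s M else s j))" .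
  show "torus_int (\<lambda>s. G (\<lambda>j. if j < n then s j * s M else s j)) = torus_int G"
    using n
  proof (induction n)
    case (Suc n)
    have "torus_int (\<lambda>s. G (\<lambda>j. if j < Suc n then s j * s M else s j)) =
        torus_int (\<lambda>s. G (\<lambda>j. if j < n then s j * s M else s j))"
    proof (rule torus_int_cong_CT[where i = n, OF tb tb])
      fix s :: "nat \<Rightarrow> complex" assume s: "s \<in> torus"
      define s' where "s' = (\<lambda>j. if j < n then s j * s M else s j)"
      have nz: "s' j \<noteq> 0" for j using torus_nonzero[OF s] by (simp add: s'_def)
      have eq: "(\<lambda>j. if j < Suc n then (s(n := z)) j * (s(n := z)) M else (s(n := z)) j) = s'(n := s M * z ^ 1)"
        "(\<lambda>j. if j < n then (s(n := z)) j * (s(n := z)) M else (s(n := z)) j) = s'(n := z)" for z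
        using Suc.prems by (auto simp: s'_def fun_eq_iff)
      show "CT (\<lambda>z. G (\<lambda>j. if j < Suc n then (s(n := z)) j * (s(n := z)) M else (s(n := z)) j)) =
          CT (\<lambda>z. G (\<lambda>j. if j < n then (s(n := z)) j * (s(n := z)) M else (s(n := z)) j))"
        unfolding eq
        by (rule CT_scale_power[where g = "\<lambda>z. G (s'(n := z))"])
           (use polyholo_holomorphic[OF G, of s'] nz torus_nonzero[OF s] in auto)
    qed
    then show ?case using Suc by simp
  qed simp
qed

text \<open>Only one of the two products of a theta function is truncated. For \<open>a = 0\<close>
  a power series in 1/z with value 1 at infinity remains, invisible to the staircase integral; in
  the limit of large \<open>a\<close> it becomes \<open>theta_pair q z 1\<close>, the interaction
  with an extra variable set to 1.\<close>

definition theta_factor :: "complex \<Rightarrow> nat \<Rightarrow> complex \<Rightarrow> complex" where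
  "theta_factor q a z = qpoch z q a * qpoch_inf (q * inverse z) q"

lemma holomorphic_theta_factor:
  assumes "norm q < 1"
  shows "theta_factor q a holomorphic_on -{0}"
proof -
  have "(\<lambda>z. qpoch_inf (q * inverse z) q) holomorphic_on -{0}"
    by (rule holomorphic_on_compose_gen[of "\<lambda>z. q * inverse z" _ "\<lambda>z. qpoch_inf z q" UNIV, unfolded o_def])
       (auto intro!: holomorphic_intros holomorphic_qpoch_inf assms)
  then show ?thesis
    unfolding theta_factor_def[abs_def] qpoch_def by (intro holomorphic_intros)
qed

text \<open>Truncation disturbs the quasi-periodicity of the theta function by the second term,
  which disappears as \<open>a\<close> grows.\<close>

lemma theta_factor_shift:
  assumes q: "norm q < 1" "q \<noteq> 0" and z: "z \<noteq> 0"
  shows "theta_factor q a (q * z) = theta_factor q a z * (- 1 * z powi - 1 + q ^ a * z powi 0)"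
proof -
  have inv: "qpoch_inf (inverse z) q = (1 - inverse z) * qpoch_inf (q * inverse z) q"
    using qpoch_inf_rec[OF q(1), of "inverse z"] by (simp add: mult_ac)
  have qz: "q * inverse (q * z) = inverse z" using q by simp
  have sgn: "1 - inverse z = (1 - z) * (- inverse z)" using z by (simp add: field_simps)
  have "theta_factor q a (q * z) = ((1 - z) * qpoch (z * q) q a) * (- inverse z) * qpoch_inf (q * inverse z) q"
    unfolding theta_factor_def qz inv sgn by (simp only: mult_ac)
  also have "(1 - z) * qpoch (z * q) q a = qpoch z q a * (1 - z * q ^ a)"
    by (metis qpoch_Suc qpoch_Suc_shift)
  finally show ?thesis unfolding theta_factor_def using z by (simp add: field_simps power_int_minus)
qed

lemma theta_weyl_int:
  assumes n: "n > 0" and q: "norm q < 1" "q \<noteq> 0"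
  shows "theta_functional n (weyl_int n q (\<lambda>_. theta_factor q a)) q (q ^ a)"
proof -
  let ?\<phi> = "theta_factor q a"
  note hol = holomorphic_theta_factor[OF q(1), of a]
  interpret alternating_functional n "weyl_int n q (\<lambda>_. ?\<phi>)"
    by (rule alternating_weyl_int[OF q(1) hol])
  show ?thesis
  proof
    show "q * q ^ a \<noteq> 1"
    proof
      assume "q * q ^ a = 1"
      then have "norm q ^ Suc a = 1" by (metis norm_one norm_power power_Suc)
      moreover have "norm q ^ Suc a < 1" using q by (intro power_Suc_less_one) auto
      ultimately show False by simp
    qed
    fix i and e :: "nat \<Rightarrow> int" assume i: "i < n"
    let ?e = "\<lambda>l. e l + 1 - (if l = i then int n else 0)"
    have "weyl_int n q (\<lambda>_. ?\<phi>) e = (-1) ^ (n - 1) * q powi e i *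
        weyl_int n q ((\<lambda>_. ?\<phi>)(i := \<lambda>z. ?\<phi> (q * z))) ?e"
      by (rule weyl_int_shift[OF q i hol])
    also have "weyl_int n q ((\<lambda>_. ?\<phi>)(i := \<lambda>z. ?\<phi> (q * z))) ?e =
        weyl_int n q ((\<lambda>_. ?\<phi>)(i := \<lambda>z. ?\<phi> z * (- 1 * z powi - 1 + q ^ a * z powi 0))) ?e"
      by (rule weyl_int_cong) (auto simp: theta_factor_shift[OF q] simp del: power_int_minus_left)
    also have "\<dots> = - 1 * weyl_int n q (\<lambda>_. ?\<phi>) (?e(i := ?e i + (- 1))) + q ^ a * weyl_int n q (\<lambda>_. ?\<phi>) (?e(i := ?e i + 0))"
      by (rule weyl_int_linear[OF q(1) i hol])
    also have "?e(i := ?e i + 0) = ?e" by auto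
    also have "?e(i := ?e i + (- 1)) = (\<lambda>l. e l + 1 - (if l = i then int n + 1 else 0))" by auto
    finally have *: "weyl_int n q (\<lambda>_. ?\<phi>) e = (-1) ^ (n - 1) * q powi e i *
        (- 1 * weyl_int n q (\<lambda>_. ?\<phi>) (\<lambda>l. e l + 1 - (if l = i then int n + 1 else 0)) + q ^ a * weyl_int n q (\<lambda>_. ?\<phi>) ?e)" .
    have sgn: "(-1) ^ n = - ((-1::complex) ^ (n - 1))" using n by (cases n) auto
    show "weyl_int n q (\<lambda>_. ?\<phi>) e = (-1) ^ n * q powi e i *
       (weyl_int n q (\<lambda>_. ?\<phi>) (\<lambda>l. e l + 1 - (if l = i then int n + 1 else 0)) - q ^ a * weyl_int n q (\<lambda>_. ?\<phi>) ?e)"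
      unfolding * sgn by (simp add: algebra_simps)
  qed (use n in auto)
qed

text \<open>The additional factors 1 - q^a s_j, multiplied out over subsets of the variables, raise
  the staircase on each subset; \<open>sum_subsets\<close> evaluates the result.\<close>

lemma theta_weyl_int_Suc:
  assumes n: "n > 0" and q: "norm q < 1" "q \<noteq> 0"
  shows "weyl_int n q (\<lambda>_. theta_factor q (Suc a)) (\<lambda>l. - int l) * (1 - q * q ^ a) =
    weyl_int n q (\<lambda>_. theta_factor q a) (\<lambda>l. - int l)"
proof -
  interpret theta_functional n "weyl_int n q (\<lambda>_. theta_factor q a)" q "q ^ a"
    by (rule theta_weyl_int[OF assms])
  let ?\<phi> = "theta_factor q a"
  let ?e = "\<lambda>T l. (if l \<in> T then 1 else 0) - int l"
  have step: "theta_factor q (Suc a) z = ?\<phi> z * (1 - z * q ^ a)" for z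
    by (simp add: theta_factor_def qpoch_Suc)
  have "weyl_int n q (\<lambda>_. theta_factor q (Suc a)) (\<lambda>l. - int l) =
      torus_int (\<lambda>s. \<Sum>T\<in>Pow {..<n}. (- (q ^ a)) ^ card T * (weyl_den n q s * (\<Prod>j<n. ?\<phi> (s j) * s j powi ?e T j)))"
    unfolding weyl_int_def
  proof (rule torus_int_cong)
    fix s :: "nat \<Rightarrow> complex" assume s: "s \<in> torus"
    note nz = torus_nonzero[OF s]
    have "(\<Prod>j<n. - (q ^ a) * s j + 1) = (\<Sum>T\<in>Pow {..<n}. (\<Prod>j\<in>T. - (q ^ a) * s j) * (\<Prod>j\<in>{..<n} - T. 1))"
      by (rule prod_add) simp
    also have "\<dots> = (\<Sum>T\<in>Pow {..<n}. (- (q ^ a)) ^ card T * (\<Prod>j<n. s j powi (if j \<in> T then 1 else 0)))"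
    proof (rule sum.cong[OF refl])
      fix T assume T: "T \<in> Pow {..<n}"
      have "(\<Prod>j<n. s j powi (if j \<in> T then 1 else 0)) = (\<Prod>j\<in>{..<n} \<inter> T. s j)"
        by (simp add: prod.inter_restrict) (rule prod.cong, auto)
      also have "{..<n} \<inter> T = T" using T by auto
      finally show "(\<Prod>j\<in>T. - (q ^ a) * s j) * (\<Prod>j\<in>{..<n} - T. 1) =
          (- (q ^ a)) ^ card T * (\<Prod>j<n. s j powi (if j \<in> T then 1 else 0))"
        by (simp only: prod.distrib prod_constant power_one mult_1_right)
    qed
    finally have exp: "(\<Prod>j<n. 1 - s j * q ^ a) =
        (\<Sum>T\<in>Pow {..<n}. (- (q ^ a)) ^ card T * (\<Prod>j<n. s j powi (if j \<in> T then 1 else 0)))"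
      by (simp add: mult.commute)
    have "(\<Prod>j<n. theta_factor q (Suc a) (s j) * s j powi (- int j)) =
        (\<Prod>j<n. ?\<phi> (s j) * s j powi (- int j)) * (\<Prod>j<n. 1 - s j * q ^ a)"
      unfolding step by (simp only: prod.distrib mult_ac)
    also have "\<dots> = (\<Sum>T\<in>Pow {..<n}. (- (q ^ a)) ^ card T * (\<Prod>j<n. ?\<phi> (s j) * s j powi ?e T j))"
      unfolding exp sum_distrib_left
    proof (rule sum.cong[OF refl])
      fix T
      have "(\<Prod>j<n. ?\<phi> (s j) * s j powi ?e T j) =
          (\<Prod>j<n. (?\<phi> (s j) * s j powi (- int j)) * s j powi (if j \<in> T then 1 else 0))"
        by (intro prod.cong refl) (simp add: nz mult.assoc flip: power_int_add)
      then show "(\<Prod>j<n. ?\<phi> (s j) * s j powi (- int j)) * ((- (q ^ a)) ^ card T * (\<Prod>j<n. s j powi (if j \<in> T then 1 else 0)))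
        = (- (q ^ a)) ^ card T * (\<Prod>j<n. ?\<phi> (s j) * s j powi ?e T j)"
        by (simp only: prod.distrib mult_ac)
    qed
    finally show "weyl_den n q s * (\<Prod>j<n. theta_factor q (Suc a) (s j) * s j powi (- int j)) =
        (\<Sum>T\<in>Pow {..<n}. (- (q ^ a)) ^ card T * (weyl_den n q s * (\<Prod>j<n. ?\<phi> (s j) * s j powi ?e T j)))"
      by (simp add: sum_distrib_left mult_ac)
  qed
  also have "\<dots> = (\<Sum>T\<in>Pow {..<n}. (- (q ^ a)) ^ card T * weyl_int n q (\<lambda>_. ?\<phi>) (?e T))"
    unfolding weyl_int_def torus_int_cmult[symmetric]
    by (rule torus_int_sum)
       (auto intro!: torus_bounded_polyholo polyholo_cmult polyholo_weyl_integrand q holomorphic_theta_factor)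
  finally have *: "weyl_int n q (\<lambda>_. theta_factor q (Suc a)) (\<lambda>l. - int l) = \<dots>" .
  have "weyl_int n q (\<lambda>_. theta_factor q (Suc a)) (\<lambda>l. - int l) * (1 - q * q ^ a) = weyl_int n q (\<lambda>_. ?\<phi>) (front 0 0)"
    unfolding * by (rule sum_subsets)
  also have "front 0 0 = (\<lambda>l. - int l)" by (auto simp: front_def fun_eq_iff)
  finally show ?thesis .
qed

text \<open>The bound does not depend on \<open>a\<close>, as dominated convergence demands.\<close>

lemma norm_qpoch_le:
  assumes q: "norm q < 1" and z: "norm z = 1"
  shows "norm (qpoch z q a) \<le> exp (1 / (1 - norm q))"
proof -
  have "norm (qpoch z q a) \<le> (\<Prod>k<a. exp (norm q ^ k))"
    unfolding qpoch_def prod_norm[symmetric]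
  proof (intro prod_mono conjI norm_ge_zero)
    fix k
    have "norm (1 - z * q ^ k) \<le> 1 + norm q ^ k"
      using norm_triangle_ineq4[of 1 "z * q ^ k"] z by (simp add: norm_mult norm_power)
    also have "\<dots> \<le> exp (norm q ^ k)" by (rule exp_ge_add_one_self)
    finally show "norm (1 - z * q ^ k) \<le> exp (norm q ^ k)" .
  qed
  also have "\<dots> = exp (\<Sum>k<a. norm q ^ k)" by (simp add: exp_sum)
  also have "(\<Sum>k<a. norm q ^ k) \<le> (\<Sum>k. norm q ^ k)"
    using q by (intro sum_le_suminf summable_geometric) auto
  also have "\<dots> = 1 / (1 - norm q)" using q by (intro suminf_geometric) auto
  finally show ?thesis by simp
qed

lemma weyl_const_Suc:
  assumes n: "n > 0" and q: "norm q < 1" "q \<noteq> 0"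
  shows "weyl_const (Suc n) q * qpoch_inf q q = weyl_const n q"
proof -
  define \<phi> where "\<phi> z = qpoch_inf z q * qpoch_inf (q * inverse z) q" for z
  let ?I = "\<lambda>\<psi>. weyl_int n q (\<lambda>_. \<psi>) (\<lambda>l. - int l)"
  have hq: "(\<lambda>z. qpoch_inf (q * z) q) holomorphic_on A" for A
    by (rule holomorphic_on_compose_gen[of "\<lambda>z. q * z" _ "\<lambda>z. qpoch_inf z q" UNIV, unfolded o_def])
       (auto intro!: holomorphic_intros holomorphic_qpoch_inf q)
  have "bounded ((\<lambda>z. qpoch_inf (q * z) q) ` cball 0 1)"
    by (intro compact_imp_bounded compact_continuous_image holomorphic_on_imp_continuous_on hq) auto
  then obtain B where "\<forall>x\<in>(\<lambda>z. qpoch_inf (q * z) q) ` cball 0 1. norm x \<le> B"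
    unfolding bounded_iff by blast
  then have B: "norm (qpoch_inf (q * z) q) \<le> B" if "norm z \<le> 1" for z using that by simp
  have lim: "(\<lambda>a. ?I (theta_factor q a)) \<longlonglongrightarrow> ?I \<phi>"
  proof (rule weyl_int_tendsto[OF q(1) holomorphic_theta_factor[OF q(1)]])
    show "norm (theta_factor q a z) \<le> exp (1 / (1 - norm q)) * B" if "norm z = 1" for a z
      unfolding theta_factor_def norm_mult
      by (intro mult_mono norm_qpoch_le B) (use q that in \<open>auto simp: norm_inverse\<close>)
    show "(\<lambda>a. theta_factor q a z) \<longlonglongrightarrow> \<phi> z" for z
      unfolding theta_factor_def \<phi>_def by (intro tendsto_intros qpoch_tendsto q)
  qed
  \<comment> \<open>The factors gained at each passage from \<open>a\<close> to \<open>Suc a\<close>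
    multiply to \<open>qpoch q q a\<close>.\<close>
  have "?I (theta_factor q a) * qpoch q q a = ?I (theta_factor q 0)" for a
  proof (induction a)
    case (Suc a)
    then show ?case using theta_weyl_int_Suc[OF assms, of a] by (simp add: qpoch_Suc mult_ac)
  qed simp
  moreover have "?I (theta_factor q 0) = weyl_const n q"
    unfolding theta_factor_def using weyl_int_entire(2)[OF q(1) hq] by simp
  ultimately have "(\<lambda>a. weyl_const n q) \<longlonglongrightarrow> ?I \<phi> * qpoch_inf q q"
    using tendsto_mult[OF lim qpoch_tendsto[OF q(1), of q]] by simp
  then have "?I \<phi> * qpoch_inf q q = weyl_const n q"
    using LIMSEQ_unique tendsto_const by blast
  moreover have "weyl_const (Suc n) q = ?I \<phi>"
  proof -
    let ?H = "\<lambda>s. weyl_den (Suc n) q s * (\<Prod>j<Suc n. 1 * s j powi (- int j))"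
    have theta1: "theta_pair q u 1 = \<phi> u" for u
      using qpoch_inf_rec[OF q(1), of u] by (simp add: theta_pair_def \<phi>_def divide_inverse mult_ac)
    have "weyl_const (Suc n) q = torus_int ?H"
      by (simp only: weyl_const_def weyl_int_def)
    \<comment> \<open>The twist makes \<open>s n\<close> a common factor of all variables, which
      drops out by balance of degrees; what is left is the configuration with last variable
      1.\<close>
    also have "\<dots> = torus_int (\<lambda>s. ?H (\<lambda>j. if j < n then s j * s n else s j))"
      by (rule torus_int_twist(2)[OF polyholo_weyl_integrand[where \<psi> = "\<lambda>_ _. 1"], symmetric]) (simp_all add: q)
    also have "\<dots> = torus_int (\<lambda>s. weyl_den n q s * (\<Prod>j<n. \<phi> (s j) * s j powi (- int j)))"
    proof (rule torus_int_cong)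
      fix s :: "nat \<Rightarrow> complex" assume s: "s \<in> torus"
      let ?t = "s(n := 1)"
      have "?H (\<lambda>j. if j < n then s j * s n else s j) =
          weyl_den (Suc n) q (\<lambda>j. s n * ?t j) * (\<Prod>j<Suc n. 1 * (s n * ?t j) powi (- int j))"
        by (intro arg_cong2[of _ _ _ _ "(*)"] weyl_den_cong prod.cong) (auto simp: less_Suc_eq mult.commute)
      also have "\<dots> = ?H ?t"
        by (rule weyl_den_scale[OF torus_nonzero[OF s]])
      also have "\<dots> = weyl_den n q ?t * ((\<Prod>a<n. theta_pair q (?t a) 1) * (\<Prod>j<n. ?t j powi (- int j)))"
        by (simp add: weyl_den_Suc)
      also have "weyl_den n q ?t = weyl_den n q s" by (rule weyl_den_cong) auto
      also have "(\<Prod>a<n. theta_pair q (?t a) 1) * (\<Prod>j<n. ?t j powi (- int j)) = (\<Prod>j<n. \<phi> (s j) * s j powi (- int j))"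
        unfolding prod.distrib[symmetric] theta1 by (intro prod.cong) auto
      finally show "?H (\<lambda>j. if j < n then s j * s n else s j) =
          weyl_den n q s * (\<Prod>j<n. \<phi> (s j) * s j powi (- int j))" .
    qed
    finally show ?thesis unfolding weyl_int_def .
  qed
  ultimately show ?thesis by simp
qed

text \<open>The constant is the inverse of the prefactor (q; q)^(N-1) of the Wilson line for N = n +
  1. The chain starts at one variable, where the Weyl denominator is an empty product.\<close>

lemma weyl_const_eq:
  assumes "norm q < 1" "q \<noteq> 0"
  shows "weyl_const (Suc n) q * qpoch_inf q q ^ n = 1"
proof (induction n)
  case 0
  show ?case by (simp add: weyl_const_def weyl_int_def weyl_den_def)
next
  case (Suc n)
  then show ?case using weyl_const_Suc[OF _ assms, of "Suc n"] by (simp add: mult.assoc[symmetric])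
qed

section \<open>Reduction of the Wilson line integral\<close>

text \<open>Defined on unconstrained points, so that it can be evaluated both at SU(N) points and at
  N free variables.\<close>

definition wilson_integrand :: "nat \<Rightarrow> int \<Rightarrow> complex \<Rightarrow> complex \<Rightarrow> complex \<Rightarrow> (nat \<Rightarrow> complex) \<Rightarrow> complex" where
  "wilson_integrand n m x q r s = (\<Prod>i<n. \<Prod>j\<in>{..<n} - {i}. qpoch_inf (s i / s j) q) *
     (\<Prod>i<n. qpoch_inf (r * s i * x) q) * (\<Sum>i<n. s i powi m)"

lemma wilson_integrand_cong:
  "(\<And>l. l < n \<Longrightarrow> s l = s' l) \<Longrightarrow> wilson_integrand n m x q r s = wilson_integrand n m x q r s'"
  unfolding wilson_integrand_def by (intro arg_cong2[of _ _ _ _ "(*)"] prod.cong sum.cong) auto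

lemma holomorphic_qpoch_inf_mult:
  assumes "norm q < 1"
  shows "(\<lambda>z. qpoch_inf (c * z * d) q) holomorphic_on A"
  by (rule holomorphic_on_compose_gen[of "\<lambda>z. c * z * d" _ "\<lambda>z. qpoch_inf z q" UNIV, unfolded o_def])
     (auto intro!: holomorphic_intros holomorphic_qpoch_inf assms)

lemma polyholo_wilson_integrand:
  assumes q: "norm q < 1" and \<sigma>: "\<And>i. polyunit (\<lambda>s. \<sigma> s i)"
  shows "polyholo (\<lambda>s. wilson_integrand n m x q r (\<sigma> s))"
  unfolding wilson_integrand_def
  by (intro polyholo_mult polyholo_prod polyholo_sum
      polyholo_comp_polyunit[of "\<lambda>z. qpoch_inf z q"] polyholo_comp_polyunit[of "\<lambda>z. qpoch_inf (r * z * x) q"]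
      polyholo_comp_polyunit[of "\<lambda>z. z powi m"] polyunit_divide \<sigma>
      holomorphic_qpoch_inf holomorphic_qpoch_inf_mult q) (auto intro!: holomorphic_intros)

lemma torus_int_symmetrize:
  assumes q: "norm q < 1" and F: "polyholo F"
    and sym: "\<And>p s. p permutes {..<n} \<Longrightarrow> F (\<lambda>l. s (p l)) = F s"
  shows "torus_int (\<lambda>s. weyl_den n q s * vandermonde n (\<lambda>j. inverse (s j)) * F s) =
    fact n * torus_int (\<lambda>s. weyl_den n q s * (\<Prod>j<n. inverse (s j) ^ j) * F s)"
proof -
  let ?G = "\<lambda>s. weyl_den n q s * (\<Prod>j<n. inverse (s j) ^ j) * F s"
  let ?P = "{p. p permutes {..<n}}"
  have G: "polyholo ?G"
    by (intro polyholo_mult polyholo_weyl_den polyholo_prod F q polyunit_polyholo polyunit_power polyunit_inverse polyunit_proj)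
  have summand: "polyholo (\<lambda>s. weyl_den n q s * (of_int (sign p) * (\<Prod>i<n. inverse (s (p i)) ^ i)) * F s)" for p
    by (intro polyholo_mult polyholo_weyl_den polyholo_prod polyholo_const F q polyunit_polyholo polyunit_power polyunit_inverse polyunit_proj)
  have "torus_int (\<lambda>s. weyl_den n q s * vandermonde n (\<lambda>j. inverse (s j)) * F s) =
      torus_int (\<lambda>s. \<Sum>p\<in>?P. weyl_den n q s * (of_int (sign p) * (\<Prod>i<n. inverse (s (p i)) ^ i)) * F s)"
    unfolding vandermonde_Leibniz by (simp only: sum_distrib_left sum_distrib_right)
  also have "\<dots> = (\<Sum>p\<in>?P. torus_int (\<lambda>s. weyl_den n q s * (of_int (sign p) * (\<Prod>i<n. inverse (s (p i)) ^ i)) * F s))"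
    by (rule torus_int_sum) (rule torus_bounded_polyholo[OF summand])
  also have "\<dots> = (\<Sum>p\<in>?P. torus_int ?G)"
  proof (rule sum.cong[OF refl])
    fix p assume "p \<in> ?P"
    then have p: "p permutes {..<n}" by simp
    have "torus_int (\<lambda>s. weyl_den n q s * (of_int (sign p) * (\<Prod>i<n. inverse (s (p i)) ^ i)) * F s) =
        torus_int (\<lambda>s. ?G (\<lambda>l. s (p l)))"
      unfolding weyl_den_permute[OF p] sym[OF p] by (simp only: mult_ac)
    also have "\<dots> = torus_int ?G"
      by (rule torus_int_reindex[OF torus_bounded_polyholo[OF G] permutes_inj[OF p]])
    finally show "torus_int (\<lambda>s. weyl_den n q s * (of_int (sign p) * (\<Prod>i<n. inverse (s (p i)) ^ i)) * F s) = torus_int ?G" .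
  qed
  also have "\<dots> = fact n * torus_int ?G"
    using card_permutations[of "{..<n}" n] by simp
  finally show ?thesis .
qed

text \<open>The exponents collect three sources: \<open>- l\<close> from the Leibniz term,
  \<open>- k\<close> from the twist, and \<open>m\<close> at the index chosen in the power
  sum.\<close>

lemma torus_int_wilson_integrand:
  assumes q: "norm q < 1"
  shows "torus_int (\<lambda>s. wilson_integrand n m x q r s * (\<Prod>j<n. s j powi (- k))) =
    fact n * (\<Sum>i<n. weyl_int n q (\<lambda>_ z. qpoch_inf (r * z * x) q) (\<lambda>l. - int l - k + (if l = i then m else 0)))"
proof -
  let ?F = "\<lambda>s. (\<Prod>i<n. qpoch_inf (r * s i * x) q) * (\<Sum>i<n. s i powi m) * (\<Prod>j<n. s j powi (- k))"
  let ?E = "\<lambda>i l. - int l - k + (if l = i then m else 0)"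
  have hol: "(\<lambda>z. qpoch_inf (r * z * x) q) holomorphic_on A" for A by (rule holomorphic_qpoch_inf_mult[OF q])
  have F: "polyholo ?F"
    by (intro polyholo_mult polyholo_prod polyholo_sum polyholo_power_int
      polyholo_coord[of "\<lambda>z. qpoch_inf (r * z * x) q"] hol)
  have sym: "?F (\<lambda>l. s (p l)) = ?F s" if p: "p permutes {..<n}" for p s
    using prod.permute[OF p, of "\<lambda>i. qpoch_inf (r * s i * x) q"] sum.permute[OF p, of "\<lambda>i. s i powi m"]
      prod.permute[OF p, of "\<lambda>i. s i powi (- k)"] by (simp only: o_def)
  have "torus_int (\<lambda>s. wilson_integrand n m x q r s * (\<Prod>j<n. s j powi (- k))) =
      torus_int (\<lambda>s. weyl_den n q s * vandermonde n (\<lambda>j. inverse (s j)) * ?F s)"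
    unfolding wilson_integrand_def
    by (intro torus_int_cong) (simp add: prod_qpoch_eq_weyl_den[OF q] torus_nonzero mult_ac)
  also have "\<dots> = fact n * torus_int (\<lambda>s. weyl_den n q s * (\<Prod>j<n. inverse (s j) ^ j) * ?F s)"
    by (rule torus_int_symmetrize[OF q F sym])
  also have "torus_int (\<lambda>s. weyl_den n q s * (\<Prod>j<n. inverse (s j) ^ j) * ?F s) =
      torus_int (\<lambda>s. \<Sum>i<n. weyl_den n q s * (\<Prod>j<n. qpoch_inf (r * s j * x) q * s j powi ?E i j))"
  proof (rule torus_int_cong)
    fix s :: "nat \<Rightarrow> complex" assume s: "s \<in> torus"
    note nz = torus_nonzero[OF s]
    have "(\<Prod>j<n. qpoch_inf (r * s j * x) q * s j powi ?E i j) =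
        (\<Prod>j<n. inverse (s j) ^ j) * ((\<Prod>i<n. qpoch_inf (r * s i * x) q) * s i powi m * (\<Prod>j<n. s j powi (- k)))"
      if i: "i < n" for i
    proof -
      have "s j powi ?E i j = inverse (s j) ^ j * s j powi (- k) * (if j = i then s j powi m else 1)" for j
      proof -
        have "inverse (s j) ^ j = s j powi (- int j)"
          by (simp only: power_int_minus power_int_of_nat power_inverse)
        then show ?thesis using nz[of j] by (simp add: power_int_add power_int_diff power_int_minus divide_inverse)
      qed
      moreover have "(\<Prod>j<n. if j = i then s j powi m else 1) = s i powi m"
        using i by simp
      ultimately show ?thesis by (simp only: prod.distrib mult_ac)
    qed
    then show "weyl_den n q s * (\<Prod>j<n. inverse (s j) ^ j) * ?F s =
        (\<Sum>i<n. weyl_den n q s * (\<Prod>j<n. qpoch_inf (r * s j * x) q * s j powi ?E i j))"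
      by (simp add: sum_distrib_left sum_distrib_right mult_ac)
  qed
  also have "\<dots> = (\<Sum>i<n. weyl_int n q (\<lambda>_ z. qpoch_inf (r * z * x) q) (?E i))"
    unfolding weyl_int_def
    by (rule torus_int_sum) (intro torus_bounded_polyholo polyholo_weyl_integrand q hol)
  finally show ?thesis .
qed

section \<open>Expansion of the SU(N) integrand by degree\<close>

lemma torus_bounded_CT:
  assumes F: "torus_bounded F"
  shows "torus_bounded (\<lambda>s. CT (\<lambda>z. F (s(i := z))))"
proof -
  interpret U: prob_space unit_leb by (rule prob_space_unit_leb)
  obtain B where B: "\<forall>s\<in>torus. norm (F s) \<le> B" and F_meas: "F \<in> borel_measurable borel_seq"
    using F unfolding torus_bounded_def by blast
  have cis_meas: "(\<lambda>t. cis (2 * pi * t)) \<in> borel_measurable unit_leb"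
    by (intro measurable_restrict_space1) (auto intro!: borel_measurable_continuous_onI continuous_intros)
  have upd: "(\<lambda>p. (fst p)(i := cis (2 * pi * snd p))) \<in> borel_seq \<Otimes>\<^sub>M unit_leb \<rightarrow>\<^sub>M borel_seq"
    by (rule measurable_fun_upd[where J = UNIV])
       (blast, rule measurable_fst, rule measurable_compose[OF measurable_snd cis_meas])
  have meas: "(\<lambda>(s, t). F (s(i := cis (2 * pi * t)))) \<in> borel_measurable (borel_seq \<Otimes>\<^sub>M unit_leb)"
    using measurable_compose[OF upd F_meas] unfolding split_beta' .
  have meas': "(\<lambda>s. CT (\<lambda>z. F (s(i := z)))) \<in> borel_measurable borel_seq"
    unfolding CT_def by (rule U.borel_measurable_lebesgue_integral[OF meas])
  have "norm (CT (\<lambda>z. F (s(i := z)))) \<le> max B 0" if s: "s \<in> torus" for s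
  proof (cases "integrable unit_leb (\<lambda>t. F (s(i := cis (2 * pi * t))))")
    case True
    have "norm (F (s(i := cis (2 * pi * t)))) \<le> max B 0" for t
      using B s by (auto simp: le_max_iff_disj)
    then show ?thesis unfolding CT_def
      by (intro integral_bounded_prob(2)[OF prob_space_unit_leb borel_measurable_integrable[OF True]])
  next
    case False
    then show ?thesis by (simp add: CT_def not_integrable_integral_eq)
  qed
  with meas' show ?thesis unfolding torus_bounded_def by blast
qed

lemma CT_norm_le:
  assumes g: "continuous_on (sphere 0 1) g" and B: "\<And>z. norm z = 1 \<Longrightarrow> norm (g z) \<le> B"
  shows "norm (CT g) \<le> B"
  unfolding CT_def
proof (rule integral_bounded_prob(2)[OF prob_space_unit_leb])
  have "continuous_on UNIV (\<lambda>t. g (cis (2 * pi * t)))"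
    by (rule continuous_on_compose2[OF g]) (auto intro!: continuous_intros)
  then show "(\<lambda>t. g (cis (2 * pi * t))) \<in> borel_measurable unit_leb"
    by (intro measurable_restrict_space1) (simp add: borel_measurable_continuous_onI)
qed (use B in auto)

lemma CT_sums:
  assumes f: "\<And>k. continuous_on (sphere 0 1) (f k)" and a: "summable a"
    and le: "\<And>k z. norm z = 1 \<Longrightarrow> norm (f k z) \<le> a k"
    and lim: "\<And>z. norm z = 1 \<Longrightarrow> (\<lambda>k. f k z) sums g z"
  shows "(\<lambda>k. CT (f k)) sums CT g"
proof -
  have meas: "(\<lambda>t. f k (cis (2 * pi * t))) \<in> borel_measurable unit_leb" for k
  proof -
    have "continuous_on UNIV (\<lambda>t. f k (cis (2 * pi * t)))"
      by (rule continuous_on_compose2[OF f]) (auto intro!: continuous_intros)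
    then show ?thesis
      by (intro measurable_restrict_space1) (simp add: borel_measurable_continuous_onI)
  qed
  have int: "integrable unit_leb (\<lambda>t. f k (cis (2 * pi * t)))" for k
    by (rule integral_bounded_prob(1)[OF prob_space_unit_leb meas, where B = "a k"]) (simp add: le)
  have "(\<lambda>n. \<integral>t. (\<Sum>k<n. f k (cis (2 * pi * t))) \<partial>unit_leb) \<longlonglongrightarrow> CT g"
    unfolding CT_def
  proof (rule integral_dominated_convergence[where w = "\<lambda>_. suminf a"])
    have m: "(\<lambda>t. \<Sum>k<n. f k (cis (2 * pi * t))) \<in> borel_measurable unit_leb" for n
      by (intro borel_measurable_sum meas)
    show "(\<lambda>t. \<Sum>k<n. f k (cis (2 * pi * t))) \<in> borel_measurable unit_leb" for n by (rule m)
    have l: "(\<lambda>n. \<Sum>k<n. f k (cis (2 * pi * t))) \<longlonglongrightarrow> g (cis (2 * pi * t))" for t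
      using lim[of "cis (2 * pi * t)"] unfolding sums_def by simp
    then show "AE t in unit_leb. (\<lambda>n. \<Sum>k<n. f k (cis (2 * pi * t))) \<longlonglongrightarrow> g (cis (2 * pi * t))" by simp
    show "(\<lambda>t. g (cis (2 * pi * t))) \<in> borel_measurable unit_leb"
      by (rule borel_measurable_LIMSEQ_metric[where f = "\<lambda>n t. \<Sum>k<n. f k (cis (2 * pi * t))", OF m l])
    show "integrable unit_leb (\<lambda>_. suminf a)"
      using prob_space_unit_leb by (simp add: prob_space.finite_measure finite_measure.integrable_const)
    have "norm (\<Sum>k<n. f k (cis (2 * pi * t))) \<le> suminf a" for n t
    proof -
      have "norm (\<Sum>k<n. f k (cis (2 * pi * t))) \<le> (\<Sum>k<n. a k)"
        by (intro sum_norm_le le) simp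
      also have "\<dots> \<le> suminf a"
        by (rule sum_le_suminf[OF a]) (use order_trans[OF norm_ge_zero le[of 1]] in auto)
      finally show ?thesis .
    qed
    then show "AE t in unit_leb. norm (\<Sum>k<n. f k (cis (2 * pi * t))) \<le> suminf a" for n by simp
  qed
  then show ?thesis
    unfolding sums_def CT_def using int by simp
qed

text \<open>Termwise integration identifies the constant terms with Taylor coefficients, and the
  Taylor series is then evaluated at 1.\<close>

lemma entire_sums_CT:
  assumes h: "h holomorphic_on UNIV"
  shows "(\<lambda>n. CT (\<lambda>w. h w * w powi (- int n))) sums h 1"
proof -
  define a where "a n = (deriv ^^ n) h 0 / fact n" for n
  have pow: "(\<lambda>n. a n * z ^ n) sums h z" for z
    using holomorphic_power_series[of h 0 "norm z + 1" z] holomorphic_on_subset[OF h]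
    by (simp add: a_def)
  \<comment> \<open>Convergence at 2 gives absolute convergence on the unit circle, hence the
    majorant for \<open>CT_sums\<close>.\<close>
  have "summable (\<lambda>n. norm (a n * 1 ^ n))"
    by (rule powser_insidea[of a 2]) (use pow[of 2] in \<open>auto simp: sums_iff\<close>)
  then have abs: "summable (\<lambda>n. norm (a n))" by simp
  have "CT (\<lambda>w. h w * w powi (- int n)) = a n" for n
  proof -
    have "(\<lambda>k. CT (\<lambda>w. a k * w powi (int k - int n))) sums CT (\<lambda>w. h w * w powi (- int n))"
    proof (rule CT_sums[OF _ abs])
      show "continuous_on (sphere 0 1) (\<lambda>w. a k * w powi (int k - int n))" for k
        by (intro continuous_intros) auto
      show "norm (a k * z powi (int k - int n)) \<le> norm (a k)" if "norm z = 1" for k z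
        using that by (simp add: norm_mult norm_power_int)
      fix z :: complex assume z: "norm z = 1"
      then have "z \<noteq> 0" by auto
      then have eq: "a k * z powi (int k - int n) = a k * z ^ k * z powi (- int n)" for k
        by (simp add: power_int_diff power_int_minus divide_inverse)
      show "(\<lambda>k. a k * z powi (int k - int n)) sums (h z * z powi (- int n))"
        unfolding eq by (rule sums_mult2[OF pow])
    qed
    moreover have "CT (\<lambda>w. a k * w powi (int k - int n)) = (if k = n then a n else 0)" for k
      using CT_power_int[of "int k - int n"] by (simp add: CT_cmult)
    ultimately have "(\<lambda>k. if k = n then a n else 0) sums CT (\<lambda>w. h w * w powi (- int n))" by simp
    moreover have "(\<lambda>k. if k = n then a n else 0) sums a n" by (rule sums_single)
    ultimately show ?thesis using sums_unique2 by blast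
  qed
  then show ?thesis using pow[of 1] by simp
qed

definition su_point :: "nat \<Rightarrow> (nat \<Rightarrow> complex) \<Rightarrow> nat \<Rightarrow> complex" where
  "su_point M s i = (if i < M then s i else inverse (\<Prod>j<M. s j))"

lemma polyunit_su_point: "polyunit (\<lambda>s. su_point M s i)"
  unfolding su_point_def by (cases "i < M") (auto intro!: polyunit_inverse polyunit_prod polyunit_proj)

lemma su_point_upd: "su_point M (s(M := z)) = su_point M s"
  by (auto simp: su_point_def fun_eq_iff)

lemma wilson_integrand_scale:
  assumes "c \<noteq> 0"
  shows "wilson_integrand n m x q r (\<lambda>i. c * s i) =
    (\<Prod>i<n. \<Prod>j\<in>{..<n} - {i}. qpoch_inf (s i / s j) q) *
    (\<Prod>i<n. qpoch_inf (r * (c * s i) * x) q) * (c powi m * (\<Sum>i<n. s i powi m))"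
  unfolding wilson_integrand_def sum_distrib_left using assms
  by (simp add: power_int_mult_distrib)

text \<open>Multiplying an \<open>SU(N)\<close> point by the free coordinate \<open>s M\<close> changes only the factors containing \<open>x\<close>
  and, by \<open>s M powi m\<close>, the power sum; the expansion in powers of \<open>s M\<close> sorts the former by degree.\<close>
definition su_generating :: "nat \<Rightarrow> int \<Rightarrow> complex \<Rightarrow> complex \<Rightarrow> complex \<Rightarrow> (nat \<Rightarrow> complex) \<Rightarrow> complex" where
  "su_generating M m x q r s = wilson_integrand (Suc M) m x q r (\<lambda>i. s M * su_point M s i) * s M powi (- m)"

lemma su_generating_upd:
  assumes "z \<noteq> 0"
  shows "su_generating M m x q r (s(M := z)) =
    (\<Prod>i<Suc M. \<Prod>j\<in>{..<Suc M} - {i}. qpoch_inf (su_point M s i / su_point M s j) q) *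
    (\<Prod>i<Suc M. qpoch_inf (r * (z * su_point M s i) * x) q) * (\<Sum>i<Suc M. su_point M s i powi m)"
proof -
  have "z powi m * z powi (- m) = 1" using assms by (simp flip: power_int_add)
  then show ?thesis
    unfolding su_generating_def su_point_upd fun_upd_same wilson_integrand_scale[OF assms]
    by (simp add: mult_ac)
qed

lemma polyholo_su_generating:
  assumes "norm q < 1"
  shows "polyholo (su_generating M m x q r)"
  unfolding su_generating_def[abs_def]
  by (intro polyholo_mult polyholo_wilson_integrand polyunit_mult polyunit_proj polyunit_su_point polyholo_power_int assms)

lemma torus_bounded_add:
  assumes "torus_bounded F" "torus_bounded G"
  shows "torus_bounded (\<lambda>s. F s + G s)"
proof -
  obtain B where B: "\<forall>s\<in>torus. norm (F s) \<le> B" using assms(1) unfolding torus_bounded_def by blast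
  obtain C where C: "\<forall>s\<in>torus. norm (G s) \<le> C" using assms(2) unfolding torus_bounded_def by blast
  have "\<forall>s\<in>torus. norm (F s + G s) \<le> B + C" using B C by (meson norm_triangle_mono)
  moreover have "(\<lambda>s. F s + G s) \<in> borel_measurable borel_seq"
    using assms by (intro borel_measurable_add) (simp_all add: torus_bounded_def)
  ultimately show ?thesis unfolding torus_bounded_def by blast
qed

lemma torus_bounded_sum: "(\<And>a. torus_bounded (F a)) \<Longrightarrow> torus_bounded (\<lambda>s. \<Sum>a\<in>A. F a s)"
  by (induction A rule: infinite_finite_induct)
     (simp_all add: torus_bounded_add torus_bounded_polyholo[OF polyholo_const])

text \<open>At \<open>s M = 1\<close> the generating function is the SU(N) integrand, and its Taylor
  coefficients in \<open>s M\<close> are constant terms. Summing them under the torus integral needs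
  a majorant uniform in the point.\<close>

lemma su_integral_sums:
  assumes q: "norm q < 1"
  shows "(\<lambda>n. torus_int (\<lambda>s. su_generating M m x q r s * s M powi (- int n)))
    sums torus_int (\<lambda>s. wilson_integrand (Suc M) m x q r (su_point M s))"
proof -
  let ?H = "su_generating M m x q r"
  let ?T = "\<lambda>n s. CT (\<lambda>w. ?H (s(M := w)) * w powi (- int n))"
  have H: "polyholo ?H" by (rule polyholo_su_generating[OF q])
  have Hn: "polyholo (\<lambda>s. ?H s * s M powi (- int n))" for n
    by (intro polyholo_mult H polyholo_power_int)
  obtain B where B: "B > 0" "\<And>s. s \<in> annuli 2 \<Longrightarrow> norm (?H s) \<le> B"
    using polyholo_bounded[OF H, of 2] by auto
  have sums: "(\<lambda>n. ?T n s) sums wilson_integrand (Suc M) m x q r (su_point M s)" if s: "s \<in> torus" for s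
  proof -
    note nz = torus_nonzero[OF s]
    \<comment> \<open>At \<open>w = 0\<close> the generating function itself has the wrong value,
      its ratios having become 0/0; \<open>h\<close> is the entire function that agrees with it
      elsewhere.\<close>
    define h where "h w = (\<Prod>i<Suc M. \<Prod>j\<in>{..<Suc M} - {i}. qpoch_inf (su_point M s i / su_point M s j) q) *
      (\<Prod>i<Suc M. qpoch_inf (w * (r * su_point M s i * x)) q) * (\<Sum>i<Suc M. su_point M s i powi m)" for w
    have "(\<lambda>w. qpoch_inf (w * c) q) holomorphic_on UNIV" for c
      using holomorphic_qpoch_inf_mult[OF q, of 1 c UNIV] by simp
    then have "h holomorphic_on UNIV"
      unfolding h_def[abs_def] by (intro holomorphic_intros)
    from entire_sums_CT[OF this] have "(\<lambda>n. CT (\<lambda>w. h w * w powi (- int n))) sums h 1" .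
    moreover have "CT (\<lambda>w. h w * w powi (- int n)) = ?T n s" for n
    proof -
      have "?H (s(M := z)) = h z" if "z \<noteq> 0" for z
        unfolding su_generating_upd[OF that] h_def by (simp only: mult_ac)
      then show ?thesis unfolding CT_def by (simp only: cis_neq_zero simp_thms)
    qed
    moreover have "h 1 = wilson_integrand (Suc M) m x q r (su_point M s)"
      by (simp only: h_def wilson_integrand_def mult_1)
    ultimately show ?thesis by simp
  qed
  \<comment> \<open>Cauchy estimate on the circle of radius 2; the bound \<open>B\<close> holds for
    all points of the torus at once.\<close>
  have bound: "norm (?T n s) \<le> B * (1 / 2) ^ n" if s: "s \<in> torus" for n s
  proof -
    have hol: "(\<lambda>w. ?H (s(M := w)) * w powi (- int n)) holomorphic_on -{0}"
      using polyholo_holomorphic[OF Hn torus_nonzero[OF s], where i = M] by simp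
    have hol2: "(\<lambda>z. (\<lambda>w. ?H (s(M := w)) * w powi (- int n)) (2 * z ^ 1)) holomorphic_on -{0}"
      by (rule holomorphic_on_compose_gen[OF _ hol, unfolded o_def]) (auto intro!: holomorphic_intros)
    have "?T n s = CT (\<lambda>z. (\<lambda>w. ?H (s(M := w)) * w powi (- int n)) (2 * z ^ 1))"
      by (rule CT_scale_power[OF hol, symmetric]) auto
    also have "norm \<dots> \<le> B * (1 / 2) ^ n"
    proof (rule CT_norm_le)
      show "continuous_on (sphere 0 1) (\<lambda>z. (\<lambda>w. ?H (s(M := w)) * w powi (- int n)) (2 * z ^ 1))"
        by (rule continuous_on_subset[OF holomorphic_on_imp_continuous_on[OF hol2]]) auto
      fix z :: complex assume z: "norm z = 1"
      then have "s(M := 2 * z ^ 1) \<in> annuli 2" using s by (auto simp: annuli_def norm_mult)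
      moreover have "norm ((2 * z ^ 1) powi (- int n)) = (1 / 2) ^ n"
        using z by (simp add: norm_power_int norm_mult power_int_minus power_one_over inverse_eq_divide norm_divide norm_power)
      ultimately show "norm (?H (s(M := 2 * z ^ 1)) * (2 * z ^ 1) powi (- int n)) \<le> B * (1 / 2) ^ n"
        unfolding norm_mult by (intro mult_mono B(2)) (use B in auto)
    qed
    finally show ?thesis .
  qed
  have T: "torus_bounded (?T n)" for n
    using torus_bounded_CT[OF torus_bounded_polyholo[OF Hn[of n]], of M] by simp
  have "(\<lambda>K. torus_int (\<lambda>s. \<Sum>n<K. ?T n s)) \<longlonglongrightarrow> torus_int (\<lambda>s. wilson_integrand (Suc M) m x q r (su_point M s))"
  proof (rule torus_int_tendsto[where B = "2 * B"])
    show "torus_bounded (\<lambda>s. \<Sum>n<K. ?T n s)" for K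
      by (rule torus_bounded_sum[OF T])
    show "norm (\<Sum>n<K. ?T n s) \<le> 2 * B" if s: "s \<in> torus" for K s
    proof -
      have "norm (\<Sum>n<K. ?T n s) \<le> (\<Sum>n<K. B * (1 / 2) ^ n)"
        by (intro sum_norm_le bound s)
      also have "\<dots> = B * (\<Sum>n<K. (1 / 2) ^ n)" by (simp only: sum_distrib_left)
      also have "\<dots> \<le> B * 2"
      proof (rule mult_left_mono)
        have "(\<Sum>n<K. (1 / 2) ^ n) \<le> (\<Sum>n. (1 / 2 :: real) ^ n)"
          by (intro sum_le_suminf summable_geometric) auto
        also have "(\<Sum>n. (1 / 2 :: real) ^ n) = 2" by (subst suminf_geometric) auto
        finally show "(\<Sum>n<K. (1 / 2 :: real) ^ n) \<le> 2" .
      qed (use B(1) in simp)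
      also have "B * 2 = 2 * B" by simp
      finally show ?thesis .
    qed
    show "(\<lambda>K. \<Sum>n<K. ?T n s) \<longlonglongrightarrow> wilson_integrand (Suc M) m x q r (su_point M s)" if "s \<in> torus" for s
      using sums[OF that] unfolding sums_def .
  qed
  moreover have "torus_int (\<lambda>s. \<Sum>n<K. ?T n s) = (\<Sum>n<K. torus_int (\<lambda>s. ?H s * s M powi (- int n)))" for K
  proof -
    have "torus_int (\<lambda>s. \<Sum>n<K. ?T n s) = (\<Sum>n<K. torus_int (?T n))"
      by (rule torus_int_sum[OF T])
    also have "\<dots> = (\<Sum>n<K. torus_int (\<lambda>s. ?H s * s M powi (- int n)))"
    proof (rule sum.cong[OF refl])
      show "torus_int (?T n) = torus_int (\<lambda>s. ?H s * s M powi (- int n))" for n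
        using torus_int_CT[OF torus_bounded_polyholo[OF Hn[of n]], of M] by simp
    qed
    finally show ?thesis .
  qed
  ultimately show ?thesis unfolding sums_def by simp
qed

text \<open>Up to rotations, \<open>su_cover\<close> is \<open>s M\<close> times an \<open>SU(N)\<close> point; as a function of \<open>s M\<close> it factors
  through the \<open>N\<close>-th power.\<close>
definition su_cover :: "nat \<Rightarrow> (nat \<Rightarrow> complex) \<Rightarrow> nat \<Rightarrow> complex" where
  "su_cover M s i = (if i < M then s i else s M ^ Suc M * inverse (\<Prod>j<M. s j))"

lemma polyunit_su_cover: "polyunit (\<lambda>s. su_cover M s i)"
  unfolding su_cover_def
  by (cases "i < M") (auto intro!: polyunit_mult polyunit_power polyunit_inverse polyunit_prod polyunit_proj simp del: power_Suc)

lemma su_cover_twist: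
  assumes s: "\<And>j. s j \<noteq> 0"
  shows "su_cover M (\<lambda>j. if j < M then s j * s M else s j) = (\<lambda>i. s M * su_point M s i)"
proof
  fix i
  have "(\<Prod>j<M. if j < M then s j * s M else s j) = (\<Prod>j<M. s j) * s M ^ M"
  proof -
    have "(\<Prod>j<M. if j < M then s j * s M else s j) = (\<Prod>j<M. s j * s M)" by (rule prod.cong) auto
    then show ?thesis by (simp add: prod.distrib)
  qed
  then show "su_cover M (\<lambda>j. if j < M then s j * s M else s j) i = s M * su_point M s i"
    using s by (auto simp: su_cover_def su_point_def mult_ac)
qed

lemma cis_root_powi_neq_1:
  assumes "n > 0" and "\<not> int n dvd d"
  shows "cis (2 * pi / real n) powi (- d) \<noteq> 1"
proof
  assume "cis (2 * pi / real n) powi (- d) = 1"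
  then have "cis (of_int (- d) * (2 * pi / real n)) = 1" by (simp only: cis_power_int)
  then obtain k where "of_int (- d) * (2 * pi / real n) = of_int k * (2 * pi)"
    unfolding cis_eq_1_iff by blast
  then have "pi * real_of_int (- d) = pi * real_of_int (k * int n)"
    using assms(1) by (simp add: field_simps)
  then have "real_of_int (- d) = real_of_int (k * int n)"
    by (simp only: mult_cancel_left pi_neq_zero simp_thms)
  then have "- d = k * int n" by (simp only: of_int_eq_iff)
  then have "d = int n * (- k)" by (simp add: mult.commute)
  then show False using assms(2) by simp
qed

text \<open>After the twist the integrand depends on \<open>s M\<close> through its N-th power and a
  monomial of exponent -(n + m). Rotation by a primitive N-th root of unity kills it unless N
  divides n + m; in that case the N-th power can be replaced by a free variable, giving N
  unconstrained ones.\<close>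

lemma torus_int_su_generating:
  assumes q: "norm q < 1"
  shows "torus_int (\<lambda>s. su_generating M m x q r s * s M powi (- n)) =
    (if int (Suc M) dvd n + m then torus_int (\<lambda>s. wilson_integrand (Suc M) m x q r s *
        (\<Prod>j<Suc M. s j powi (- ((n + m) div int (Suc M))))) else 0)"
proof -
  define N where "N = Suc M"
  define d where "d = n + m"
  let ?G = "\<lambda>s. wilson_integrand N m x q r (su_cover M s) * s M powi (- d)"
  have G: "polyholo ?G"
    by (intro polyholo_mult polyholo_wilson_integrand polyunit_su_cover polyholo_power_int q)
  have "torus_int (\<lambda>s. su_generating M m x q r s * s M powi (- n)) =
      torus_int (\<lambda>s. ?G (\<lambda>j. if j < M then s j * s M else s j))"
  proof (rule torus_int_cong)
    fix s :: "nat \<Rightarrow> complex" assume s: "s \<in> torus"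
    have "s M powi (- m) * s M powi (- n) = s M powi (- m + - n)"
      by (rule power_int_add[symmetric]) (use torus_nonzero[OF s, of M] in simp)
    also have "- m + - n = - d" by (simp add: d_def)
    finally have "s M powi (- m) * s M powi (- n) = s M powi (- d)" .
    then show "su_generating M m x q r s * s M powi (- n) = ?G (\<lambda>j. if j < M then s j * s M else s j)"
      unfolding su_cover_twist[where s = s, OF torus_nonzero[OF s]] su_generating_def by (simp add: N_def mult.assoc)
  qed
  also have "\<dots> = torus_int ?G" by (rule torus_int_twist(2)[OF G order_refl])
  finally have *: "torus_int (\<lambda>s. su_generating M m x q r s * s M powi (- n)) = torus_int ?G" .
  have cover: "wilson_integrand N m x q r (su_cover M (s(M := z))) =
      wilson_integrand N m x q r (s(M := z ^ N * inverse (\<Prod>j<M. s j)))" for s z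
    by (rule wilson_integrand_cong) (auto simp: su_cover_def N_def less_Suc_eq simp del: power_Suc)
  show ?thesis
  proof (cases "int N dvd d")
    case False
    define \<zeta> where "\<zeta> = cis (2 * pi / real N)"
    have \<zeta>: "\<zeta> \<noteq> 0" "\<zeta> powi (- d) \<noteq> 1"
      using cis_root_powi_neq_1[OF _ False] by (auto simp: \<zeta>_def N_def)
    have "real N * (2 * pi / real N) = 2 * pi" by (simp add: N_def)
    moreover have "\<zeta> ^ N = cis (real N * (2 * pi / real N))" unfolding \<zeta>_def by (rule Complex.DeMoivre)
    ultimately have \<zeta>N: "\<zeta> ^ N = 1" by simp
    have "CT (\<lambda>z. ?G (s(M := z))) = 0" if s: "s \<in> torus" for s
    proof -
      let ?g = "\<lambda>z. ?G (s(M := z))"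
      have "CT ?g = CT (\<lambda>z. ?g (\<zeta> * z ^ 1))"
        by (rule CT_scale_power[symmetric])
           (use polyholo_holomorphic[OF G torus_nonzero[OF s], where i = M] \<zeta>(1) in auto)
      also have "(\<lambda>z. ?g (\<zeta> * z ^ 1)) = (\<lambda>z. \<zeta> powi (- d) * ?g z)"
        unfolding cover using \<zeta>N by (simp add: power_mult_distrib power_int_mult_distrib mult_ac)
      also have "CT \<dots> = \<zeta> powi (- d) * CT ?g" by (rule CT_cmult)
      finally have "CT ?g = \<zeta> powi (- d) * CT ?g" .
      then show ?thesis using \<zeta>(2) mult_cancel_right1[of "CT ?g" "\<zeta> powi (- d)"] by blast
    qed
    then have "torus_int ?G = torus_int (\<lambda>s. 0)"
      unfolding torus_int_CT[OF torus_bounded_polyholo[OF G], of M] by (rule torus_int_cong)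
    then show ?thesis using False unfolding * by (simp add: N_def d_def)
  next
    case True
    define k where "k = d div int N"
    have d: "d = int N * k" using True by (simp add: k_def)
    let ?F = "\<lambda>s. wilson_integrand N m x q r s * (\<Prod>j<N. s j powi (- k))"
    have W: "polyholo (wilson_integrand N m x q r)"
      using polyholo_wilson_integrand[OF q, of "\<lambda>s. s"] polyunit_proj by simp
    have F: "polyholo ?F"
      by (intro polyholo_mult W polyholo_prod polyholo_power_int)
    have "torus_int ?G = torus_int ?F"
    proof (rule torus_int_cong_CT[where i = M, OF torus_bounded_polyholo[OF G] torus_bounded_polyholo[OF F]])
      fix s :: "nat \<Rightarrow> complex" assume s: "s \<in> torus"
      note nz = torus_nonzero[OF s]
      define c where "c = (\<Prod>j<M. s j)"
      have c: "c \<noteq> 0" using nz by (simp add: c_def)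
      \<comment> \<open>Here \<open>y\<close> is the product of all \<open>N\<close> coordinates,
        that is, \<open>c\<close> times the last one.\<close>
      define g where "g y = wilson_integrand N m x q r (s(M := y * inverse c)) * y powi (- k)" for y
      have "(\<lambda>y. wilson_integrand N m x q r (s(M := y * inverse c))) holomorphic_on -{0}"
        by (rule holomorphic_on_compose_gen[OF _ polyholo_holomorphic[OF W nz], of "\<lambda>y. y * inverse c", unfolded o_def])
           (use c in \<open>auto intro!: holomorphic_intros\<close>)
      then have g: "g holomorphic_on -{0}"
        unfolding g_def[abs_def] by (intro holomorphic_intros) auto
      have "CT (\<lambda>z. ?G (s(M := z))) = CT (\<lambda>z. g (1 * z ^ N))"
      proof -
        have "z powi (- d) = (z ^ N) powi (- k)" for z :: complex
        proof -
          have "- d = int N * (- k)" using d by simp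
          then show ?thesis by (simp only: power_int_mult power_int_of_nat)
        qed
        then show ?thesis unfolding cover g_def c_def by simp
      qed
      also have "\<dots> = CT g" by (rule CT_scale_power[OF g]) (auto simp: N_def)
      \<comment> \<open>Scaling by \<open>c\<close> turns the last coordinate into the free variable
        \<open>z\<close> and the monomial into the \<open>- k\<close>-th power of the full
        product.\<close>
      also have "\<dots> = CT (\<lambda>z. g (c * z ^ 1))" by (rule CT_scale_power[OF g c, symmetric]) simp
      also have "(\<lambda>z. g (c * z ^ 1)) = (\<lambda>z. ?F (s(M := z)))"
      proof
        fix z
        have "(\<Prod>j<N. (s(M := z)) j powi (- k)) = (\<Prod>j<M. s j powi (- k)) * z powi (- k)"
          by (simp add: N_def)
        also have "(\<Prod>j<M. s j powi (- k)) = c powi (- k)"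
          unfolding c_def by (induction M) (simp_all add: power_int_mult_distrib)
        finally show "g (c * z ^ 1) = ?F (s(M := z))"
          unfolding g_def using c by (simp add: power_int_mult_distrib field_simps)
      qed
      finally show "CT (\<lambda>z. ?G (s(M := z))) = CT (\<lambda>z. ?F (s(M := z)))" .
    qed
    then show ?thesis using True unfolding * by (simp add: N_def d_def k_def)
  qed
qed

section \<open>Return to the original integral and summation over k\<close>

lemma Wline_eq_torus_int:
  assumes N: "N = Suc M" and q: "norm q < 1"
  shows "Wline N m x q r = qpoch_inf q q ^ M / fact N *
    torus_int (\<lambda>s. wilson_integrand N m x q r (su_point M s))"
proof -
  let ?P = "PiM {1..<N} (\<lambda>_. unit_leb)"
  let ?F = "\<lambda>s. wilson_integrand N m x q r (su_point M s)"
  have F: "?F \<in> borel_measurable borel_seq"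
    by (intro polyholo_measurable polyholo_wilson_integrand polyunit_su_point q)
  have W: "Wintegrand N m x q r th = ?F (\<lambda>i. if i < M then cis (2 * pi * th (Suc i)) else 1)" for th
  proof -
    have "(\<Prod>j\<in>{1..<N}. cis (2 * pi * th j)) = (\<Prod>j<M. cis (2 * pi * th (Suc j)))"
      unfolding N by (rule prod.reindex_bij_witness[of _ Suc "\<lambda>j. j - 1"]) auto
    then have sv: "svar N th (Suc i) = su_point M (\<lambda>i. if i < M then cis (2 * pi * th (Suc i)) else 1) i" if "i < N" for i
      using that by (auto simp: svar_def su_point_def N)
    have "{1..N} - {Suc i} = Suc ` ({..<N} - {i})" for i
      by (simp add: image_set_diff image_Suc_lessThan)
    then have in_prod: "(\<Prod>j\<in>{1..N} - {Suc i}. f j) = (\<Prod>j\<in>{..<N} - {i}. f (Suc j))" for f :: "nat \<Rightarrow> complex" and i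
      by (simp add: prod.reindex)
    have out_prod: "(\<Prod>i\<in>{1..N}. f i) = (\<Prod>i<N. f (Suc i))" for f :: "nat \<Rightarrow> complex"
      using prod.atLeast1_atMost_eq[of f N] by simp
    have out_sum: "(\<Sum>i\<in>{1..N}. f i) = (\<Sum>i<N. f (Suc i))" for f :: "nat \<Rightarrow> complex"
      using sum.atLeast1_atMost_eq[of f N] by simp
    show ?thesis
      unfolding Wintegrand_def Let_def wilson_integrand_def out_prod out_sum in_prod
      by (intro arg_cong2[of _ _ _ _ "(*)"] prod.cong sum.cong refl) (auto simp: sv)
  qed
  have W_meas: "Wintegrand N m x q r \<in> borel_measurable ?P"
  proof -
    have "(\<lambda>th i. if i < M then cis (2 * pi * th (Suc i)) else 1) \<in> ?P \<rightarrow>\<^sub>M borel_seq"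
    proof (rule measurable_seq_fun)
      fix i
      have "(\<lambda>t. cis (2 * pi * t)) \<in> borel_measurable unit_leb"
        by (intro measurable_restrict_space1) (auto intro!: borel_measurable_continuous_onI continuous_intros)
      then have "(\<lambda>th. cis (2 * pi * th (Suc i))) \<in> borel_measurable ?P" if "i < M"
        by (rule measurable_compose[rotated]) (use that N in auto)
      then show "(\<lambda>th. if i < M then cis (2 * pi * th (Suc i)) else 1) \<in> borel_measurable ?P"
        by (cases "i < M") auto
    qed
    from measurable_compose[OF this F] show ?thesis unfolding W .
  qed
  \<comment> \<open>The angles are numbered from 1 in the Wilson line and from 0 in
    \<open>torus_int\<close>.\<close>
  let ?f = "\<lambda>\<omega>. \<lambda>n\<in>{1..<N}. \<omega> (n - 1 :: nat)"
  have D: "distr angles ?P ?f = ?P"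
    by (rule distr_PiM_reindex[of UNIV "\<lambda>_. unit_leb" "\<lambda>n. n - 1" "{1..<N}"])
       (auto simp: inj_on_def prob_space_unit_leb)
  have f: "?f \<in> angles \<rightarrow>\<^sub>M ?P"
    by (rule measurable_restrict) auto
  have "integral\<^sup>L ?P (Wintegrand N m x q r) = integral\<^sup>L (distr angles ?P ?f) (Wintegrand N m x q r)"
    unfolding D ..
  also have "\<dots> = (\<integral>\<omega>. Wintegrand N m x q r (?f \<omega>) \<partial>angles)"
    by (rule integral_distr[OF f W_meas])
  also have "\<dots> = torus_int ?F"
    unfolding torus_int_def W
    by (intro Bochner_Integration.integral_cong refl wilson_integrand_cong) (auto simp: su_point_def N intro!: prod.cong)
  finally have "integral\<^sup>L ?P (Wintegrand N m x q r) = torus_int ?F" .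
  then show ?thesis unfolding Wline_def by (simp add: N del: fact_Suc)
qed

theorem theorem1p4:
  fixes N :: nat and m :: int and x q r :: complex
  assumes "N \<ge> 2" and "norm q < 1" and "q \<noteq> 0" and "r\<^sup>2 = q" and "x \<noteq> 0"
  shows "(\<lambda>j. \<Sum>i\<in>{1..N}. Y N i m (\<lceil>of_int m / of_nat N :: real\<rceil> + int j) x q r)
           sums Wline N m x q r"
proof -
  define M where "M = N - 1"
  have N: "N = Suc M" using assms(1) by (simp add: M_def)
  have N_pos: "N > 0" using N by simp
  define A where "A = weyl_int N q (\<lambda>_ z. qpoch_inf (r * z * x) q)"
  interpret wilson_functional N A x q r
    unfolding A_def by (rule wilson_weyl_int) (use assms in auto)
  have A0: "A (front 0 0) = weyl_const N q"
  proof -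
    have "front 0 0 = (\<lambda>l. - int l)" by (auto simp: front_def fun_eq_iff)
    then show ?thesis
      unfolding A_def using weyl_int_entire(1)[OF assms(2) holomorphic_qpoch_inf_mult[OF assms(2)]] by simp
  qed
  define C where "C = qpoch_inf q q ^ M / fact N"
  define U where "U k = torus_int (\<lambda>s. wilson_integrand N m x q r s * (\<Prod>j<N. s j powi (- k)))" for k
  \<comment> \<open>The factorial from the symmetrisation and the constant term of the Weyl
    denominator cancel the prefactor exactly.\<close>
  have CU: "C * U k = (\<Sum>i\<in>{1..N}. Y N i m k x q r)" for k
  proof -
    have "U k = fact N * (\<Sum>i<N. wilson_term i m k)"
      unfolding U_def torus_int_wilson_integrand[OF assms(2)] wilson_term_def unfolding A_def ..
    also have "(\<Sum>i<N. wilson_term i m k) = weyl_const N q * (\<Sum>i<N. Y N (N - i) m k x q r)"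
      unfolding sum_distrib_left A0[symmetric] by (intro sum.cong wilson_term_eq_Y) auto
    also have "(\<Sum>i<N. Y N (N - i) m k x q r) = (\<Sum>i\<in>{1..N}. Y N i m k x q r)"
      by (rule sum.reindex_bij_witness[of _ "\<lambda>i. N - i" "\<lambda>i. N - i"]) auto
    finally have "C * U k = (weyl_const (Suc M) q * qpoch_inf q q ^ M) * (\<Sum>i\<in>{1..N}. Y N i m k x q r)"
      unfolding C_def N by (simp add: mult_ac del: fact_Suc)
    then show ?thesis using weyl_const_eq[OF assms(2,3), of M] by simp
  qed
  define f where "f n = C * (if int N dvd int n + m then U ((int n + m) div int N) else 0)" for n
  have "f sums Wline N m x q r"
    unfolding f_def Wline_eq_torus_int[OF N assms(2)] C_def[symmetric]
    using sums_mult[OF su_integral_sums[OF assms(2), of M m x r], of C]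
    unfolding torus_int_su_generating[OF assms(2)] U_def N by simp
  \<comment> \<open>A degree \<open>n\<close> contributes to index \<open>k\<close> exactly when n =
    N k - m; as \<open>n\<close> is nonnegative, the least such \<open>k\<close> is this
    ceiling.\<close>
  define k0 where "k0 = \<lceil>of_int m / of_nat N :: real\<rceil>"
  have k0: "int N * k0 \<ge> m" "int N * (k0 - 1) < m"
  proof -
    have "of_int m / of_nat N \<le> (of_int k0 :: real)" "(of_int k0 :: real) - 1 < of_int m / of_nat N"
      unfolding k0_def by linarith+
    then have "real_of_int m \<le> real_of_int (int N * k0)" "real_of_int (int N * (k0 - 1)) < real_of_int m"
      using N_pos by (simp_all add: field_simps)
    then show "int N * k0 \<ge> m" "int N * (k0 - 1) < m" by (simp_all only: of_int_le_iff of_int_less_iff)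
  qed
  \<comment> \<open>The contributing degrees in increasing order. Dropping the zero terms between
    them turns the sum over degrees into the sum over \<open>k\<close>.\<close>
  define g where "g j = nat (int N * (k0 + int j) - m)" for j
  have g: "int (g j) + m = int N * (k0 + int j)" for j
    using k0(1) by (simp add: g_def distrib_left add_increasing2)
  have "strict_mono g"
  proof (rule strict_monoI)
    fix i j :: nat assume "i < j"
    then have "int (g i) + m < int (g j) + m" unfolding g using N_pos by simp
    then show "g i < g j" by simp
  qed
  moreover have "f n = 0" if "n \<notin> range g" for n
  proof -
    have "\<not> int N dvd int n + m"
    proof
      assume "int N dvd int n + m"
      then obtain k where k: "int n + m = int N * k" by (auto elim: dvdE)
      then have "int N * (k0 - 1) < int N * k" using k0(2) by linarith
      then have "k0 \<le> k" using N_pos by (simp add: mult_less_cancel_left)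
      then have "int (g (nat (k - k0))) + m = int n + m" unfolding g k by simp
      then have "n = g (nat (k - k0))" by simp
      then show False using that by blast
    qed
    then show ?thesis by (simp add: f_def)
  qed
  ultimately have "(\<lambda>j. f (g j)) sums Wline N m x q r"
    using \<open>f sums _\<close> sums_mono_reindex by blast
  moreover have "f (g j) = (\<Sum>i\<in>{1..N}. Y N i m (k0 + int j) x q r)" for j
    unfolding f_def g using N_pos CU by simp
  ultimately show ?thesis by (simp add: k0_def)
qed

end
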